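(* Consider a Markovian multi-class queueing network with queue-configuration process $\mathcal X$, a positive direction $\vec v$ and a function $\phi:\mathbb X\to(0,1]$ vanishing at infinity with $\phi(\emptyset)=1$, such that conditions (M1) and (M2) (stated in the context) hold for $\Theta=\langle\vec v\,\rangle=\{r\cdot\vec v:r\ge 0\}$. Let $\tilde\varphi_t,\tilde\varphi,r_*,\bar r,r_\varepsilon$ be as defined in the context. Let $\varepsilon\in(0,1)$, let $x_0\in(0,\bar r)$, let $\{t_n\}_{n\ge 0}$ be an increasing sequence of non-negative numbers with $t_0=0$, and let $\{a_n\}_{n\ge1}$ be a decreasing sequence of positive numbers with $a_n\to0$, satisfying $$\lim_{n\to\infty}t_n=\infty,\qquad \sum_{n\ge1}a_n=\infty,\qquad \sum_{n\ge1}a_n^2<\infty .$$ Let $\{x_n\}_{n\ge 0}$ be the random sequence defined by $$x_n=x_{n-1}+a_n(z_n-\varepsilon),\qquad n\ge1,$$ where, for each $n\ge1$, the conditional distribution of $z_n$ given $x_0,\dots,x_{n-1}$ is $\mathfrak D_n(x_{n-1})$ (defined in the context). Then $x_n\to r_\varepsilon$ almost surely as $n\to\infty$. Furthermore, assume in addition that the family of derivatives $\tilde\varphi_t'$ converges uniformly on $(0,r_* )$ as $t\to\infty$, and that $\inf_{r\in(0,r_* )}|\tilde\varphi'(r)|>0$. If $a_n=a\cdot n^{-\omega}$ for all $n\ge 1$, with $\omega\in(1/2,1]$ and $a>(\omega-1/2)/\inf_{r\in(0,r_* )}|\tilde\varphi'(r)|$, and $$\sup_{r\in[0,r_*]}|\tilde\varphi_{t_n}(r)-\tilde\varphi(r)|=o(n^{-\kappa})\quad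 (n\to\infty)$$ for some $\kappa>\omega-1/2$, then $x_n-r_\varepsilon=O(n^{-(\omega-1/2)})$ in probability, i.e. the sequence $n^{\omega-1/2}(x_n-r_\varepsilon)$ is bounded in probability (tight).
   Context: **Network.** A (Markovian) multi-class queueing network has $\aleph$ stations and $d$ classes of jobs; class $k\in\{1,\dots,d\}$ is assigned to station $\mathcal S(k)$, where $\mathcal S:\{1,\dots,d\}\to\{1,\dots,\aleph\}$ is surjective, and $\mathcal K_i=\{k:\mathcal S(k)=i\}$. Each station has its own service/queueing policy. Jobs of class $k$ enter from outside according to a Poisson process of rate $\theta_k\ge0$ (no external arrivals if $\theta_k=0$) and require an exponentially distributed service time of rate $\beta_k>0$, independent of everything else. After completing service, a class-$k$ job becomes a class-$l$ job (and moves to station $\mathcal S(l)$) with probability $R_{kl}$, or leaves the network with probability $1-\sum_{l=1}^dR_{kl}$. The matrix $R=(R_{kl})$ is such that $(I-R)^{-1}=I+R+R^2+\cdots$ (open network). The queue-configuration process $\mathcal X=\{X_t:t\ge0\}$ is a continuous-time Markov process on a discrete state space $\mathbb X$ whose law depends on $\theta=(\theta_1,\dots,\theta_d)\in\mathbb R^d_+$ (everything else being fixed); $\mathbb P_\theta,\mathbb E_\theta$ denote the corresponding probability and expectation. $\emptyset\in\mathbb X$ denotes the empty configuration (no jobs in the network). **Stability region.** For $\Theta\subseteq\mathbb R_+^d$, $\Theta_{\rm s}=\{\theta\in\Theta:\mathcal X\text{ is positive (Harris) recurrent under }\mathbb P_\theta\}$. **Direction.** A positive direction is a vector $\vec v\in\mathbb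 R^d_+$ with $\|\vec v\|=1$; $\langle\vec v\,\rangle=\{r\cdot\vec v:r\ge0\}$, identified with $[0,\infty)$ (with its order and topology) via $r\mapsto r\cdot\vec v$. The number $r_*>0$ is defined by $r_*\cdot\vec v=\sup\langle\vec v\,\rangle_{\rm s}$, and the critical threshold is $$\bar r=\min_{i}\Big[\sum_{k\in\mathcal K_i}\frac{\delta_k}{\beta_k}\Big]^{-1},\qquad \delta=(I-R')^{-1}\vec v,$$ where $R'$ is the transpose of $R$. One has $0<r_*\le\bar r<\infty$. **Monotonicity conditions.** A function $\phi:\mathbb X\to(0,1]$ vanishes at infinity if $\{\mathbf x\in\mathbb X:\phi(\mathbf x)\ge\eta\}$ is finite for every $\eta>0$. For $\Theta\subseteq\mathbb R^d_+$ (with the componentwise order) the conditions are: (M1) the mapping $(t,\theta)\mapsto\varphi_t(\theta):=\mathbb E_\theta[\phi(X_t)\mid X_0=\emptyset]$ is jointly non-increasing on $[0,\infty)\times\Theta$. (M2) the mapping $\varphi:\Theta\to[0,1]$, $\varphi(\theta):=\lim_{t\to\infty}\varphi_t(\theta)=\inf_{t\ge0}\varphi_t(\theta)$ (the limit exists by (M1)), is continuous, and it is strictly decreasing on $\Theta_{\rm s}$. **Restriction to the ray.** For $r\ge0$, $\tilde\varphi_t(r)=\varphi_t(r\cdot\vec v)$ and $\tilde\varphi(r)=\varphi(r\cdot\vec v)$. Under (M1) and (M2) for $\Theta=\langle\vec v\,\rangle$, one has $\langle\vec v\,\rangle_{\rm s}=\{r\cdot\vec v:\tilde\varphi(r)>0\}=[0,r_*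 )\cdot\vec v$, and $\tilde\varphi:[0,r_* )\to(0,1]$ is a (decreasing) homeomorphism. For $\varepsilon\in(0,1)$, $r_\varepsilon\in(0,r_* )$ denotes the unique root of $\tilde\varphi(r)=\varepsilon$. **Sampling distributions.** Given the sequence $\{t_n\}_{n\ge0}$, for $r\ge0$ and $n\ge0$, $\mathfrak D_n(r)$ denotes the distribution of $\phi(X_{t_n})$ under $\mathbb P_\theta$ with $\theta=r\cdot\vec v$ and $X_0=\emptyset$; for $r<0$, $\mathfrak D_n(r):=\mathfrak D_n(0)$. *)

theory Defs
  imports "HOL-Probability.Probability" "HOL-Library.Landau_Symbols"
begin

text \<open>
  Classes are the elements of the finite type \<open>'k\<close>, stations those of the finite type \<open>'i\<close>,
  configurations live in the countable set \<open>configs\<close>. In configuration \<open>x\<close> there are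
  \<open>jobs x k\<close> jobs of class \<open>k\<close>, and the policy of the station of \<open>k\<close> devotes the share
  \<open>effort x k\<close> of its (unit) capacity to class \<open>k\<close>. A configuration may carry any further
  information the policies need (order of arrival, job in service, \<dots>). How it is updated is
  part of the policies and may be randomised: \<open>arrive k x\<close> is the law of the configuration
  after an external class-\<open>k\<close> arrival, \<open>transfer k l x\<close> the one after a class-\<open>k\<close> job
  completes service and becomes a class-\<open>l\<close> job, and \<open>depart k x\<close> the one after a
  class-\<open>k\<close> job completes service and leaves.
\<close>

record ('x, 'k::finite, 'i::finite) network =
  station :: "'k \<Rightarrow> 'i"
  service_rate :: "real^'k"
  routing :: "real^'k^'k"
  configs :: "'x set"
  empty_config :: 'x
  jobs :: "'x \<Rightarrow> 'k \<Rightarrow> nat"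
  effort :: "'x \<Rightarrow> 'k \<Rightarrow> real"
  arrive :: "'k \<Rightarrow> 'x \<Rightarrow> 'x pmf"
  transfer :: "'k \<Rightarrow> 'k \<Rightarrow> 'x \<Rightarrow> 'x pmf"
  depart :: "'k \<Rightarrow> 'x \<Rightarrow> 'x pmf"

text \<open>The type \<open>real^'k^'k\<close> has pointwise multiplication, so \<open>^\<close> is not the matrix power.\<close>

definition mat_power :: "real^'k^'k \<Rightarrow> nat \<Rightarrow> real^'k^'k" where
  "mat_power A n = (((**) A) ^^ n) (mat 1)"

text \<open>
  The last assumption excludes policies under which the network as a whole stands still although
  jobs are present; every non-idling policy satisfies it. With \<open>open_network\<close> it makes the
  empty configuration accessible from all configurations.
\<close>

locale multiclass_network =
  fixes N :: "('x, 'k::finite, 'i::finite) network"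
  assumes station_surj: "surj (station N)"
    and service_rate_pos: "0 < service_rate N $ k"
    and routing_nonneg: "0 \<le> routing N $ k $ l"
    and routing_substochastic: "(\<Sum>l\<in>UNIV. routing N $ k $ l) \<le> 1"
    and open_network: "invertible (mat 1 - routing N)"
      "(\<lambda>n. mat_power (routing N) n) sums matrix_inv (mat 1 - routing N)"
    and countable_configs: "countable (configs N)"
    and empty_in_configs: "empty_config N \<in> configs N"
    and jobs_zero_iff: "x \<in> configs N \<Longrightarrow> (\<forall>k. jobs N x k = 0) \<longleftrightarrow> x = empty_config N"
    and effort_nonneg: "x \<in> configs N \<Longrightarrow> 0 \<le> effort N x k"
    and effort_capacity: "x \<in> configs N \<Longrightarrow> (\<Sum>k | station N k = i. effort N x k) \<le> 1"
    and effort_present: "x \<in> configs N \<Longrightarrow> effort N x k > 0 \<Longrightarrow> jobs N x k > 0"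
    and arrive_jobs: "x \<in> configs N \<Longrightarrow> y \<in> set_pmf (arrive N k x) \<Longrightarrow>
      y \<in> configs N \<and> jobs N y = (jobs N x)(k := jobs N x k + 1)"
    and transfer_jobs: "x \<in> configs N \<Longrightarrow> effort N x k > 0 \<Longrightarrow> y \<in> set_pmf (transfer N k l x) \<Longrightarrow>
      y \<in> configs N \<and>
      jobs N y = (let q = (jobs N x)(k := jobs N x k - 1) in q(l := q l + 1))"
    and depart_jobs: "x \<in> configs N \<Longrightarrow> effort N x k > 0 \<Longrightarrow> y \<in> set_pmf (depart N k x) \<Longrightarrow>
      y \<in> configs N \<and> jobs N y = (jobs N x)(k := jobs N x k - 1)"
    and no_standstill: "x \<in> configs N \<Longrightarrow> x \<noteq> empty_config N \<Longrightarrow> \<exists>k. effort N x k > 0"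

text \<open>
  An event may leave the configuration unchanged (a class-\<open>k\<close> job may return to class \<open>k\<close>),
  so \<open>event_rate N \<theta> x x\<close> can be positive; the diagonal entry of the generator is this rate
  minus the total event rate, and the rows of the generator sum to zero.
\<close>

definition event_rate :: "('x, 'k::finite, 'i::finite) network \<Rightarrow> real^'k \<Rightarrow> 'x \<Rightarrow> 'x \<Rightarrow> real" where
  "event_rate N \<theta> x y =
     (\<Sum>k\<in>UNIV. \<theta> $ k * pmf (arrive N k x) y) +
     (\<Sum>k\<in>UNIV. service_rate N $ k * effort N x k *
        ((\<Sum>l\<in>UNIV. routing N $ k $ l * pmf (transfer N k l x) y) +
         (1 - (\<Sum>l\<in>UNIV. routing N $ k $ l)) * pmf (depart N k x) y))"

definition generator :: "('x, 'k::finite, 'i::finite) network \<Rightarrow> real^'k \<Rightarrow> 'x \<Rightarrow> 'x \<Rightarrow> real" where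
  "generator N \<theta> x y = event_rate N \<theta> x y -
     (if x = y then (\<Sum>k\<in>UNIV. \<theta> $ k) + (\<Sum>k\<in>UNIV. service_rate N $ k * effort N x k) else 0)"

text \<open>\<open>Pr x\<close> is the law under which the process \<open>X\<close> starts in \<open>x\<close>.\<close>

definition trans_prob :: "('x \<Rightarrow> 'w measure) \<Rightarrow> (real \<Rightarrow> 'w \<Rightarrow> 'x) \<Rightarrow> real \<Rightarrow> 'x \<Rightarrow> 'x \<Rightarrow> real" where
  "trans_prob Pr X t x y = measure (Pr x) {\<omega> \<in> space (Pr x). X t \<omega> = y}"

text \<open>
  The last clause is Kolmogorov's backward equation. It determines the transition probabilities
  when the rates \<open>q\<close> are bounded, as they are for the generators above.
\<close>

definition markov_jump_process ::
  "'x set \<Rightarrow> ('x \<Rightarrow> 'x \<Rightarrow> real) \<Rightarrow> ('x \<Rightarrow> 'w measure) \<Rightarrow> (real \<Rightarrow> 'w \<Rightarrow> 'x) \<Rightarrow> bool" where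
  "markov_jump_process E q Pr X \<longleftrightarrow>
     (\<forall>x\<in>E.
        prob_space (Pr x) \<and>
        (\<forall>t\<ge>0. X t \<in> measurable (Pr x) (count_space E)) \<and>
        (AE \<omega> in Pr x. X 0 \<omega> = x) \<and>
        (AE \<omega> in Pr x. \<forall>t\<ge>0. \<exists>h>0. \<forall>s\<in>{t..<t + h}. X s \<omega> = X t \<omega>) \<and>
        (\<forall>n (\<tau> :: nat \<Rightarrow> real) (\<xi> :: nat \<Rightarrow> 'x).
           0 \<le> \<tau> 0 \<longrightarrow> mono \<tau> \<longrightarrow> (\<forall>i. \<xi> i \<in> E) \<longrightarrow>
           measure (Pr x) {\<omega> \<in> space (Pr x). \<forall>i\<le>Suc n. X (\<tau> i) \<omega> = \<xi> i} =
           measure (Pr x) {\<omega> \<in> space (Pr x). \<forall>i\<le>n. X (\<tau> i) \<omega> = \<xi> i} *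
             trans_prob Pr X (\<tau> (Suc n) - \<tau> n) (\<xi> n) (\<xi> (Suc n))) \<and>
        (\<forall>y\<in>E. \<forall>t\<ge>0.
           ((\<lambda>s. trans_prob Pr X s x y) has_real_derivative
              (\<Sum>\<^sub>\<infinity>z\<in>E. q x z * trans_prob Pr X t z y)) (at t within {0..})))"

definition harris_recurrent ::
  "'x set \<Rightarrow> ('x \<Rightarrow> 'w measure) \<Rightarrow> (real \<Rightarrow> 'w \<Rightarrow> 'x) \<Rightarrow> bool" where
  "harris_recurrent S Pr X \<longleftrightarrow>
     (\<exists>\<psi> :: 'x measure. sigma_finite_measure \<psi> \<and> space \<psi> = S \<and> sets \<psi> = Pow S \<and> emeasure \<psi> S > 0 \<and>
        (\<forall>A\<subseteq>S. emeasure \<psi> A > 0 \<longrightarrow> (\<forall>x\<in>S. AE \<omega> in Pr x. \<exists>t\<ge>0. X t \<omega> \<in> A)))"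

text \<open>
  A Harris recurrent process has an invariant measure, unique up to multiples. It is positive if
  this measure is finite, i.e. can be normalised to a probability.
\<close>

definition positive_harris_recurrent ::
  "'x set \<Rightarrow> ('x \<Rightarrow> 'w measure) \<Rightarrow> (real \<Rightarrow> 'w \<Rightarrow> 'x) \<Rightarrow> bool" where
  "positive_harris_recurrent S Pr X \<longleftrightarrow>
     harris_recurrent S Pr X \<and>
     (\<exists>\<pi> :: 'x pmf. set_pmf \<pi> \<subseteq> S \<and>
        (\<forall>t\<ge>0. \<forall>y\<in>S. pmf \<pi> y = measure_pmf.expectation \<pi> (\<lambda>x. trans_prob Pr X t x y)))"

definition queue_process ::
  "('x, 'k::finite, 'i::finite) network \<Rightarrow> (real^'k \<Rightarrow> 'x \<Rightarrow> 'w measure) \<Rightarrow> (real \<Rightarrow> 'w \<Rightarrow> 'x) \<Rightarrow> bool" where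
  "queue_process N P X \<longleftrightarrow>
     (\<forall>\<theta>\<ge>0. markov_jump_process (configs N) (generator N \<theta>) (P \<theta>) X)"

text \<open>
  The process starts in the empty configuration, so under \<open>\<theta>\<close> it lives on the configurations
  accessible from there. These need not be all configurations, e.g. when some arrival rates
  vanish, and recurrence is understood on this set.
\<close>

definition accessible ::
  "('x, 'k::finite, 'i::finite) network \<Rightarrow> (real^'k \<Rightarrow> 'x \<Rightarrow> 'w measure) \<Rightarrow> (real \<Rightarrow> 'w \<Rightarrow> 'x) \<Rightarrow>
   real^'k \<Rightarrow> 'x set" where
  "accessible N P X \<theta> =
     {y \<in> configs N. \<exists>t\<ge>0. trans_prob (P \<theta>) X t (empty_config N) y > 0}"

definition stable_region ::
  "('x, 'k::finite, 'i::finite) network \<Rightarrow> (real^'k \<Rightarrow> 'x \<Rightarrow> 'w measure) \<Rightarrow> (real \<Rightarrow> 'w \<Rightarrow> 'x) \<Rightarrow>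
   (real^'k) set \<Rightarrow> (real^'k) set" where
  "stable_region N P X \<Theta> =
     {\<theta> \<in> \<Theta>. positive_harris_recurrent (accessible N P X \<theta>) (P \<theta>) X}"

definition vanishes_at_infinity :: "'x set \<Rightarrow> ('x \<Rightarrow> real) \<Rightarrow> bool" where
  "vanishes_at_infinity E \<phi> \<longleftrightarrow> (\<forall>\<eta>>0. finite {x \<in> E. \<phi> x \<ge> \<eta>})"

definition mean_at ::
  "('x, 'k::finite, 'i::finite) network \<Rightarrow> (real^'k \<Rightarrow> 'x \<Rightarrow> 'w measure) \<Rightarrow> (real \<Rightarrow> 'w \<Rightarrow> 'x) \<Rightarrow>
   ('x \<Rightarrow> real) \<Rightarrow> real \<Rightarrow> real^'k \<Rightarrow> real" where
  "mean_at N P X \<phi> t \<theta> = (LINT \<omega>|P \<theta> (empty_config N). \<phi> (X t \<omega>))"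

definition mean_limit ::
  "('x, 'k::finite, 'i::finite) network \<Rightarrow> (real^'k \<Rightarrow> 'x \<Rightarrow> 'w measure) \<Rightarrow> (real \<Rightarrow> 'w \<Rightarrow> 'x) \<Rightarrow>
   ('x \<Rightarrow> real) \<Rightarrow> real^'k \<Rightarrow> real" where
  "mean_limit N P X \<phi> \<theta> = Lim at_top (\<lambda>t. mean_at N P X \<phi> t \<theta>)"

definition condition_M1 ::
  "('x, 'k::finite, 'i::finite) network \<Rightarrow> (real^'k \<Rightarrow> 'x \<Rightarrow> 'w measure) \<Rightarrow> (real \<Rightarrow> 'w \<Rightarrow> 'x) \<Rightarrow>
   ('x \<Rightarrow> real) \<Rightarrow> (real^'k) set \<Rightarrow> bool" where
  "condition_M1 N P X \<phi> \<Theta> \<longleftrightarrow>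
     (\<forall>s t \<theta> \<theta>'. 0 \<le> s \<longrightarrow> s \<le> t \<longrightarrow> \<theta> \<in> \<Theta> \<longrightarrow> \<theta>' \<in> \<Theta> \<longrightarrow> \<theta> \<le> \<theta>' \<longrightarrow>
        mean_at N P X \<phi> t \<theta>' \<le> mean_at N P X \<phi> s \<theta>)"

definition condition_M2 ::
  "('x, 'k::finite, 'i::finite) network \<Rightarrow> (real^'k \<Rightarrow> 'x \<Rightarrow> 'w measure) \<Rightarrow> (real \<Rightarrow> 'w \<Rightarrow> 'x) \<Rightarrow>
   ('x \<Rightarrow> real) \<Rightarrow> (real^'k) set \<Rightarrow> bool" where
  "condition_M2 N P X \<phi> \<Theta> \<longleftrightarrow>
     continuous_on \<Theta> (mean_limit N P X \<phi>) \<and>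
     (\<forall>\<theta> \<in> stable_region N P X \<Theta>. \<forall>\<theta>' \<in> stable_region N P X \<Theta>.
        \<theta> < \<theta>' \<longrightarrow> mean_limit N P X \<phi> \<theta>' < mean_limit N P X \<phi> \<theta>)"

definition ray :: "real^'k \<Rightarrow> (real^'k) set" where
  "ray v = {r *\<^sub>R v | r. r \<ge> 0}"

definition r_star ::
  "('x, 'k::finite, 'i::finite) network \<Rightarrow> (real^'k \<Rightarrow> 'x \<Rightarrow> 'w measure) \<Rightarrow> (real \<Rightarrow> 'w \<Rightarrow> 'x) \<Rightarrow>
   real^'k \<Rightarrow> real" where
  "r_star N P X v = Sup {r. r \<ge> 0 \<and> r *\<^sub>R v \<in> stable_region N P X (ray v)}"

definition effective_rates :: "('x, 'k::finite, 'i::finite) network \<Rightarrow> real^'k \<Rightarrow> real^'k" where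
  "effective_rates N v = matrix_inv (mat 1 - transpose (routing N)) *v v"

definition station_load :: "('x, 'k::finite, 'i::finite) network \<Rightarrow> real^'k \<Rightarrow> 'i \<Rightarrow> real" where
  "station_load N v i = (\<Sum>k | station N k = i. effective_rates N v $ k / service_rate N $ k)"

text \<open>
  A station with load zero has threshold \<open>1/0 = \<infinity>\<close> and does not contribute to the minimum; in
  HOL, \<open>inverse 0 = 0\<close>, so such stations must be left out.
\<close>

definition r_bar :: "('x, 'k::finite, 'i::finite) network \<Rightarrow> real^'k \<Rightarrow> real" where
  "r_bar N v = Min {inverse (station_load N v i) | i. station_load N v i > 0}"

definition mean_at_ray ::
  "('x, 'k::finite, 'i::finite) network \<Rightarrow> (real^'k \<Rightarrow> 'x \<Rightarrow> 'w measure) \<Rightarrow> (real \<Rightarrow> 'w \<Rightarrow> 'x) \<Rightarrow>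
   ('x \<Rightarrow> real) \<Rightarrow> real^'k \<Rightarrow> real \<Rightarrow> real \<Rightarrow> real" where
  "mean_at_ray N P X \<phi> v t r = mean_at N P X \<phi> t (r *\<^sub>R v)"

definition mean_limit_ray ::
  "('x, 'k::finite, 'i::finite) network \<Rightarrow> (real^'k \<Rightarrow> 'x \<Rightarrow> 'w measure) \<Rightarrow> (real \<Rightarrow> 'w \<Rightarrow> 'x) \<Rightarrow>
   ('x \<Rightarrow> real) \<Rightarrow> real^'k \<Rightarrow> real \<Rightarrow> real" where
  "mean_limit_ray N P X \<phi> v r = mean_limit N P X \<phi> (r *\<^sub>R v)"

definition r_root ::
  "('x, 'k::finite, 'i::finite) network \<Rightarrow> (real^'k \<Rightarrow> 'x \<Rightarrow> 'w measure) \<Rightarrow> (real \<Rightarrow> 'w \<Rightarrow> 'x) \<Rightarrow>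
   ('x \<Rightarrow> real) \<Rightarrow> real^'k \<Rightarrow> real \<Rightarrow> real" where
  "r_root N P X \<phi> v \<epsilon> =
     (THE r. r \<in> {0<..<r_star N P X v} \<and> mean_limit_ray N P X \<phi> v r = \<epsilon>)"

text \<open>\<open>sampling_distr N P X \<phi> v t r\<close> with \<open>t = t\<^sub>n\<close> is the \<open>n\<close>-th sampling distribution at \<open>r\<close>.\<close>

definition sampling_distr ::
  "('x, 'k::finite, 'i::finite) network \<Rightarrow> (real^'k \<Rightarrow> 'x \<Rightarrow> 'w measure) \<Rightarrow> (real \<Rightarrow> 'w \<Rightarrow> 'x) \<Rightarrow>
   ('x \<Rightarrow> real) \<Rightarrow> real^'k \<Rightarrow> real \<Rightarrow> real \<Rightarrow> real measure" where
  "sampling_distr N P X \<phi> v t r =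
     distr (P ((if r < 0 then 0 else r) *\<^sub>R v) (empty_config N)) borel (\<lambda>\<omega>. \<phi> (X t \<omega>))"

definition history :: "'a measure \<Rightarrow> (nat \<Rightarrow> 'a \<Rightarrow> real) \<Rightarrow> nat \<Rightarrow> 'a measure" where
  "history M x n =
     vimage_algebra (space M) (\<lambda>\<omega>. \<lambda>i\<in>{..<n}. x i \<omega>) (Pi\<^sub>M {..<n} (\<lambda>_. borel))"

definition has_conditional_distr ::
  "'a measure \<Rightarrow> 'a measure \<Rightarrow> ('a \<Rightarrow> real) \<Rightarrow> ('a \<Rightarrow> real measure) \<Rightarrow> bool" where
  "has_conditional_distr M F Z \<kappa> \<longleftrightarrow>
     (\<forall>B \<in> sets borel. AE \<omega> in M.
        real_cond_exp M F (\<lambda>\<omega>. indicator B (Z \<omega>)) \<omega> = measure (\<kappa> \<omega>) B)"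

end

theory Submission
  imports Defs "HOL-Complex_Analysis.Great_Picard" "HOL-Real_Asymp.Real_Asymp"
begin

text \<open>
  Along the ray, the process started in the empty configuration is positive recurrent iff the limit
  of \<open>E \<phi>(X\<^sub>t)\<close> is positive. If the limit is positive, the return probabilities of the empty
  configuration, which is accessible from everywhere, are bounded away from zero; this gives
  recurrence and, by averaging over finer and finer time grids, an invariant distribution.
  Conversely, a vanishing limit means that all transition probabilities tend to zero. For large
  arrival rates the function \<open>2\<^sup>-\<^sup>n\<close> of the number \<open>n\<close> of jobs decays exponentially in mean, so the
  limit vanishes. Hence the limit is a continuous function of \<open>r\<close> which crosses the level \<open>\<epsilon>\<close>
  strictly and exactly once, at \<open>r\<^sub>\<epsilon>\<close>, and the iteration is a Robbins--Monro scheme whose noise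
  is an \<open>L\<^sup>2\<close>-bounded martingale. For the rate, the second moment of the error on the event that
  the iterates stay near the root satisfies a linear recursion.
\<close>

subsection \<open>Markov jump processes with bounded rates\<close>

text \<open>Irreducibility is not assumed, so both halves of the recurrence criterion lean on the
  empty configuration: \<open>\<phi>\<close> vanishing at infinity turns a positive mean into mass
  on a finite set, from which that configuration is occupied at a common later time with a uniformly
  positive chance. The invariant law must be invariant at all real times; a dyadic shift maps a fine
  grid into itself up to boundary terms, and continuity in time does the rest. The crude overload
  bound serves two ends: the limit falls from one to zero, so that every level in between is
  attained, and the supremum defining \<open>r_star\<close> is over a bounded set. In the iteration,
  the conditional laws are prescribed for each Borel set up to a null set depending on it, so
  conditional means are recovered from finitely many level events. For the rate, slope information
  exists only on \<open>(0, r_star)\<close>, which forces the restriction to paths that stay near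
  the root; the lower bound on the constant in the step sizes says that the contraction of the
  squared error beats the growth of the rescaling factor, the power \<open>2 * w - 1\<close> of
  \<open>n\<close>.\<close>

abbreviation expect :: "'a pmf \<Rightarrow> ('a \<Rightarrow> real) \<Rightarrow> real" where
  "expect q \<equiv> measure_pmf.expectation q"

section \<open>Series with a diagonal term, and laws as probability mass functions\<close>

lemma infsum_delta_mult:
  fixes g :: "'a \<Rightarrow> real"
  assumes "x \<in> E" and "(\<lambda>z. r z * g z) summable_on E"
  shows "(\<Sum>\<^sub>\<infinity>z\<in>E. (r z - (if x = z then l else 0)) * g z) = (\<Sum>\<^sub>\<infinity>z\<in>E. r z * g z) - l * g x"
proof -
  have "((\<lambda>z. if z = x then l * g x else 0) has_sum (l * g x)) E"
    using assms(1) by (intro has_sum_finite_neutralI[of "{x}"]) auto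
  from has_sum_add[OF has_sum_infsum[OF assms(2)] this[THEN has_sum_uminusI]]
  have h: "((\<lambda>z. r z * g z - (if z = x then l * g x else 0)) has_sum ((\<Sum>\<^sub>\<infinity>z\<in>E. r z * g z) - l * g x)) E"
    by simp
  have "((\<lambda>z. (r z - (if x = z then l else 0)) * g z) has_sum ((\<Sum>\<^sub>\<infinity>z\<in>E. r z * g z) - l * g x)) E"
    by (rule has_sum_cong[THEN iffD1, OF _ h]) (auto simp: algebra_simps)
  thus ?thesis by (rule infsumI)
qed

text \<open>Passing to \<open>pmf\<close> makes the monad operations available for iterating
  transitions. The value is meaningful only for measurable maps with countable range, which is what
  \<open>measure_pmf_law\<close> asks for.\<close>

definition law :: "'w measure \<Rightarrow> ('w \<Rightarrow> 'b) \<Rightarrow> 'b pmf" where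
  "law M f = Abs_pmf (distr M (count_space UNIV) f)"

lemma measure_pmf_law:
  assumes M: "prob_space M" and f: "f \<in> measurable M (count_space UNIV)"
    and A: "countable A" "\<And>\<omega>. \<omega> \<in> space M \<Longrightarrow> f \<omega> \<in> A"
  shows "measure_pmf (law M f) = distr M (count_space UNIV) f"
  unfolding law_def
proof (rule Abs_pmf_inverse, intro CollectI conjI)
  let ?D = "distr M (count_space UNIV) f"
  show D: "prob_space ?D" by (rule prob_space.prob_space_distr[OF M f])
  show "sets ?D = UNIV" by simp
  interpret D: prob_space ?D by fact
  have "AE x in ?D. x \<in> A"
    using A(2) f by (subst AE_distr_iff) auto
  moreover have "AE x in ?D. \<forall>y\<in>A. measure ?D {y} = 0 \<longrightarrow> x \<noteq> y"
  proof (subst AE_ball_countable[OF A(1)], intro ballI)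
    fix y
    show "AE x in ?D. measure ?D {y} = 0 \<longrightarrow> x \<noteq> y"
    proof (cases "measure ?D {y} = 0")
      case True
      hence "AE x in ?D. x \<noteq> y"
        by (intro AE_I[of _ _ "{y}"]) (auto simp: D.emeasure_eq_measure)
      thus ?thesis by eventually_elim auto
    qed auto
  qed
  ultimately show "AE x in ?D. measure ?D {x} \<noteq> 0"
    by eventually_elim auto
qed

lemma pmf_law:
  assumes "prob_space M" "f \<in> measurable M (count_space UNIV)"
    and "countable A" "\<And>\<omega>. \<omega> \<in> space M \<Longrightarrow> f \<omega> \<in> A"
  shows "pmf (law M f) y = measure M {\<omega> \<in> space M. f \<omega> = y}"
proof -
  have eq: "measure_pmf (law M f) = distr M (count_space UNIV) f"
    by (rule measure_pmf_law) (use assms in auto)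
  have "pmf (law M f) y = measure (measure_pmf (law M f)) {y}" by (simp add: pmf.rep_eq)
  also have "\<dots> = measure M {\<omega> \<in> space M. f \<omega> = y}"
    unfolding eq using assms(2) by (subst measure_distr) (auto simp: vimage_def Int_def conj_commute)
  finally show ?thesis .
qed

lemma map_pmf_law:
  assumes "prob_space M" "f \<in> measurable M (count_space UNIV)"
    and "countable A" "\<And>\<omega>. \<omega> \<in> space M \<Longrightarrow> f \<omega> \<in> A"
  shows "map_pmf g (law M f) = law M (\<lambda>\<omega>. g (f \<omega>))"
proof -
  have g: "(\<lambda>\<omega>. g (f \<omega>)) \<in> measurable M (count_space UNIV)"
    by (rule measurable_compose[OF assms(2)]) simp
  have "measure_pmf (map_pmf g (law M f)) = measure_pmf (law M (\<lambda>\<omega>. g (f \<omega>)))"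
  proof -
    have eq: "measure_pmf (law M f) = distr M (count_space UNIV) f"
      by (rule measure_pmf_law) (use assms in auto)
    have "distr (measure_pmf (law M f)) (count_space UNIV) g = distr M (count_space UNIV) (\<lambda>\<omega>. g (f \<omega>))"
      unfolding eq by (subst distr_distr) (use assms(2) in \<open>auto simp: o_def\<close>)
    also have "\<dots> = measure_pmf (law M (\<lambda>\<omega>. g (f \<omega>)))"
      by (rule measure_pmf_law[OF assms(1) g, symmetric, of "g ` A"]) (use assms in auto)
    finally show ?thesis by (simp add: map_pmf_rep_eq)
  qed
  thus ?thesis by (simp add: measure_pmf_inject)
qed

text \<open>The generator is split into a nonnegative part \<open>r\<close> and the loss
  \<open>lam\<close>, so that the backward equation reads as a nonnegative combination minus
  \<open>lam x\<close> times the function itself. Since \<open>r x x\<close> may be positive,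
  \<open>lam x\<close> counts all events, including those that leave the state unchanged.\<close>

locale bounded_jump_process =
  fixes E :: "'x set" and r :: "'x \<Rightarrow> 'x \<Rightarrow> real" and lam :: "'x \<Rightarrow> real" and L :: real
    and Pr :: "'x \<Rightarrow> 'w measure" and X :: "real \<Rightarrow> 'w \<Rightarrow> 'x"
  assumes countable_E: "countable E"
    and rate_nonneg: "x \<in> E \<Longrightarrow> z \<in> E \<Longrightarrow> 0 \<le> r x z"
    and rate_sum: "x \<in> E \<Longrightarrow> (r x has_sum lam x) E"
    and rate_bound: "x \<in> E \<Longrightarrow> lam x \<le> L"
    and jump: "markov_jump_process E (\<lambda>x y. r x y - (if x = y then lam x else 0)) Pr X"
begin

section \<open>Transition kernels and their derivatives\<close>

abbreviation p where "p \<equiv> trans_prob Pr X"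

definition T :: "real \<Rightarrow> 'x \<Rightarrow> 'x pmf" where
  "T t x = law (Pr x) (X t)"

lemma jump_process_facts:
  assumes "x \<in> E"
  shows prob_Pr: "prob_space (Pr x)"
    and X_measurable: "0 \<le> t \<Longrightarrow> X t \<in> measurable (Pr x) (count_space E)"
    and X_0: "AE \<omega> in Pr x. X 0 \<omega> = x"
    and markov: "0 \<le> \<tau> 0 \<Longrightarrow> mono \<tau> \<Longrightarrow> (\<And>i. \<xi> i \<in> E) \<Longrightarrow>
           measure (Pr x) {\<omega> \<in> space (Pr x). \<forall>i\<le>Suc n. X (\<tau> i) \<omega> = \<xi> i} =
           measure (Pr x) {\<omega> \<in> space (Pr x). \<forall>i\<le>n. X (\<tau> i) \<omega> = \<xi> i} *
             p (\<tau> (Suc n) - \<tau> n) (\<xi> n) (\<xi> (Suc n))"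
    and backward: "y \<in> E \<Longrightarrow> 0 \<le> t \<Longrightarrow> ((\<lambda>s. p s x y) has_real_derivative
              (\<Sum>\<^sub>\<infinity>z\<in>E. (r x z - (if x = z then lam x else 0)) * p t z y)) (at t within {0..})"
  using jump assms unfolding markov_jump_process_def by blast+

lemma X_in_E: "x \<in> E \<Longrightarrow> 0 \<le> t \<Longrightarrow> \<omega> \<in> space (Pr x) \<Longrightarrow> X t \<omega> \<in> E"
  using measurable_space[OF X_measurable] by fastforce

lemma X_measurable_UNIV: "x \<in> E \<Longrightarrow> 0 \<le> t \<Longrightarrow> X t \<in> measurable (Pr x) (count_space UNIV)"
  using measurable_compose[OF X_measurable, of x t "\<lambda>x. x" "count_space UNIV"] by simp

lemma measure_pmf_T:
  assumes "x \<in> E" "0 \<le> t"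
  shows "measure_pmf (T t x) = distr (Pr x) (count_space UNIV) (X t)"
  unfolding T_def
  by (rule measure_pmf_law[OF prob_Pr X_measurable_UNIV countable_E]) (use assms X_in_E in auto)

lemma pmf_T:
  assumes "x \<in> E" "0 \<le> t"
  shows "pmf (T t x) y = p t x y"
proof -
  show ?thesis unfolding T_def trans_prob_def
    by (rule pmf_law[OF prob_Pr X_measurable_UNIV countable_E]) (use assms X_in_E in auto)
qed

lemma set_T:
  assumes "x \<in> E" "0 \<le> t"
  shows "set_pmf (T t x) \<subseteq> E"
proof
  fix y assume "y \<in> set_pmf (T t x)"
  hence "p t x y \<noteq> 0" by (simp add: set_pmf_iff pmf_T assms)
  hence "{\<omega> \<in> space (Pr x). X t \<omega> = y} \<noteq> {}" unfolding trans_prob_def by (metis measure_empty)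
  thus "y \<in> E" using X_in_E[OF assms] by auto
qed

lemma expectation_T:
  fixes g :: "'x \<Rightarrow> real"
  assumes "x \<in> E" "0 \<le> t"
  shows "expect (T t x) g = (LINT \<omega>|Pr x. g (X t \<omega>))"
  unfolding measure_pmf_T[OF assms] by (rule integral_distr) (use X_measurable_UNIV[OF assms] in auto)

lemma p_bounds: "x \<in> E \<Longrightarrow> 0 \<le> t \<Longrightarrow> 0 \<le> p t x y" "x \<in> E \<Longrightarrow> 0 \<le> t \<Longrightarrow> p t x y \<le> 1"
  by (auto simp flip: pmf_T simp: pmf_le_1)

lemma p_0: "x \<in> E \<Longrightarrow> p 0 x y = (if x = y then 1 else 0)"
proof -
  assume x: "x \<in> E"
  interpret prob_space "Pr x" by (rule prob_Pr[OF x])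
  show ?thesis
  proof (cases "x = y")
    case True
    have "prob {\<omega> \<in> space (Pr x). X 0 \<omega> = x} = 1"
      using X_0[OF x] X_measurable_UNIV[OF x, of 0]
      by (intro prob_Collect_eq_1[THEN iffD2]) auto
    thus ?thesis using True by (simp add: trans_prob_def)
  next
    case False
    have "prob {\<omega> \<in> space (Pr x). X 0 \<omega> = y} = 0"
      using X_0[OF x] X_measurable_UNIV[OF x, of 0] False
      by (intro prob_Collect_eq_0[THEN iffD2]) auto
    thus ?thesis using False by (simp add: trans_prob_def)
  qed
qed

lemma rate_mult_summable:
  assumes "x \<in> E" and "\<And>z. z \<in> E \<Longrightarrow> \<bar>g z\<bar> \<le> (B::real)"
  shows "(\<lambda>z. r x z * g z) summable_on E"
proof (rule abs_summable_summable, rule Infinite_Sum.abs_summable_on_comparison_test')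
  show "(\<lambda>z. B * r x z) summable_on E"
    using rate_sum[OF assms(1)] by (intro summable_on_cmult_right) (auto simp: summable_on_def)
  show "norm (r x z * g z) \<le> B * r x z" if "z \<in> E" for z
    using assms(2)[OF that] rate_nonneg[OF assms(1) that]
    by (simp add: abs_mult) (metis mult.commute mult_right_mono)
qed

lemma p_deriv:
  assumes "x \<in> E" "y \<in> E" "0 \<le> t"
  shows "((\<lambda>s. p s x y) has_real_derivative (\<Sum>\<^sub>\<infinity>z\<in>E. r x z * p t z y) - lam x * p t x y) (at t within {0..})"
proof -
  have "(\<lambda>z. r x z * p t z y) summable_on E"
    by (rule rate_mult_summable[OF assms(1), of _ 1]) (use assms p_bounds in auto)
  thus ?thesis using backward[OF assms] infsum_delta_mult[OF assms(1), of "r x"] by simp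
qed

section \<open>Finite-dimensional distributions and the semigroup property\<close>

lemma map_upt_eq_iff: "length ys = n \<Longrightarrow> (map f [0..<n] = ys) \<longleftrightarrow> (\<forall>i<n. f i = ys ! i)"
  by (auto simp: list_eq_iff_nth_eq)

text \<open>Paths observed at \<open>n + 1\<close> times, encoded as lists so that the Markov
  property becomes a recursion that appends one state (\<open>J_Suc\<close>).\<close>

definition J :: "(nat \<Rightarrow> real) \<Rightarrow> 'x \<Rightarrow> nat \<Rightarrow> 'x list pmf" where
  "J \<tau> x n = law (Pr x) (\<lambda>\<omega>. map (\<lambda>i. X (\<tau> i) \<omega>) [0..<Suc n])"

context
  fixes \<tau> :: "nat \<Rightarrow> real" and x
  assumes \<tau>: "0 \<le> \<tau> 0" "mono \<tau>" and x: "x \<in> E"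
begin

lemma times_nonneg: "0 \<le> \<tau> i"
  using \<tau> monoD[OF \<tau>(2), of 0 i] by simp

lemma path_in_lists: "\<omega> \<in> space (Pr x) \<Longrightarrow> map (\<lambda>i. X (\<tau> i) \<omega>) [0..<n] \<in> lists E"
  using X_in_E[OF x times_nonneg] by auto

lemma path_measurable: "(\<lambda>\<omega>. map (\<lambda>i. X (\<tau> i) \<omega>) [0..<n]) \<in> measurable (Pr x) (count_space UNIV)"
proof -
  have "(\<lambda>\<omega>. map (\<lambda>i. X (\<tau> i) \<omega>) [0..<n]) \<in> measurable (Pr x) (count_space (lists E))"
    unfolding measurable_count_space_eq_countable[OF countable_lists[OF countable_E]]
  proof (intro conjI ballI)
    fix ys assume "ys \<in> lists E"
    have m: "X (\<tau> i) \<in> measurable (Pr x) (count_space UNIV)" for i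
      by (rule X_measurable_UNIV[OF x times_nonneg])
    have "{\<omega> \<in> space (Pr x). X (\<tau> i) \<omega> = c} \<in> sets (Pr x)" for i c
      using measurable_sets[OF m, of "{c}" i] by (simp add: vimage_def Int_def conj_commute)
    hence "{\<omega> \<in> space (Pr x). \<forall>i\<in>{..<n}. X (\<tau> i) \<omega> = ys ! i} \<in> sets (Pr x)"
      by (intro sets.sets_Collect_finite_All) auto
    hence "{\<omega> \<in> space (Pr x). \<forall>i<n. X (\<tau> i) \<omega> = ys ! i} \<in> sets (Pr x)"
      unfolding Ball_def lessThan_iff .
    moreover have "(\<lambda>\<omega>. map (\<lambda>i. X (\<tau> i) \<omega>) [0..<n]) -` {ys} \<inter> space (Pr x) =
      (if length ys = n then {\<omega> \<in> space (Pr x). \<forall>i<n. X (\<tau> i) \<omega> = ys ! i} else {})"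
    proof (cases "length ys = n")
      case True
      thus ?thesis using map_upt_eq_iff[OF True] by auto
    next
      case False
      hence "map (\<lambda>i. X (\<tau> i) \<omega>) [0..<n] \<noteq> ys" for \<omega> by auto
      thus ?thesis using False by auto
    qed
    ultimately show "(\<lambda>\<omega>. map (\<lambda>i. X (\<tau> i) \<omega>) [0..<n]) -` {ys} \<inter> space (Pr x) \<in> sets (Pr x)"
      by (cases "length ys = n") (simp_all only: if_True if_False refl sets.empty_sets)
  qed (use path_in_lists countable_lists[OF countable_E] in auto)
  from measurable_compose[OF this, of "\<lambda>x. x" "count_space UNIV"] show ?thesis by simp
qed

lemmas law_path = pmf_law[OF prob_Pr[OF x] path_measurable countable_lists[OF countable_E] path_in_lists]
  measure_pmf_law[OF prob_Pr[OF x] path_measurable countable_lists[OF countable_E] path_in_lists]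
  map_pmf_law[OF prob_Pr[OF x] path_measurable countable_lists[OF countable_E] path_in_lists]

lemma pmf_J: "pmf (J \<tau> x n) ys = measure (Pr x) {\<omega> \<in> space (Pr x). map (\<lambda>i. X (\<tau> i) \<omega>) [0..<Suc n] = ys}"
  unfolding J_def by (rule law_path(1))

lemma set_J: "ys \<in> set_pmf (J \<tau> x n) \<Longrightarrow> ys \<in> lists E \<and> length ys = Suc n"
proof -
  assume "ys \<in> set_pmf (J \<tau> x n)"
  hence "pmf (J \<tau> x n) ys \<noteq> 0" by (simp add: set_pmf_iff)
  hence "{\<omega> \<in> space (Pr x). map (\<lambda>i. X (\<tau> i) \<omega>) [0..<Suc n] = ys} \<noteq> {}"
    unfolding pmf_J by (metis measure_empty)
  then obtain \<omega> where "\<omega> \<in> space (Pr x)" and ys: "map (\<lambda>i. X (\<tau> i) \<omega>) [0..<Suc n] = ys" by blast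
  from path_in_lists[OF this(1), of "Suc n"] show ?thesis unfolding ys
    using arg_cong[OF ys, of length] by simp
qed

lemma map_last_J: "map_pmf last (J \<tau> x n) = T (\<tau> n) x"
proof -
  have "(\<lambda>\<omega>. last (map (\<lambda>i. X (\<tau> i) \<omega>) [0..<Suc n])) = X (\<tau> n)"
    by (rule ext) simp
  moreover have "map_pmf last (J \<tau> x n) = law (Pr x) (\<lambda>\<omega>. last (map (\<lambda>i. X (\<tau> i) \<omega>) [0..<Suc n]))"
    unfolding J_def by (rule law_path(3))
  ultimately show ?thesis unfolding T_def by (simp only:)
qed

lemma pmf_map_append:
  "pmf (map_pmf (\<lambda>z. xs @ [z]) q) (us @ [u]) = (if xs = us then pmf q u else 0)"
proof (cases "xs = us")
  case True
  have "inj (\<lambda>z. us @ [z])" by (auto simp: inj_def)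
  from pmf_map_inj'[OF this] show ?thesis using True by simp
next
  case False
  thus ?thesis by (auto simp: pmf_eq_0_set_pmf)
qed

text \<open>The Markov clause of \<open>markov_jump_process\<close> is an identity between masses of
  single paths, so point masses are compared. A list that has the wrong length or leaves
  \<open>E\<close> has mass zero on both sides.\<close>

lemma J_Suc:
  "J \<tau> x (Suc n) = bind_pmf (J \<tau> x n) (\<lambda>xs. map_pmf (\<lambda>z. xs @ [z]) (T (\<tau> (Suc n) - \<tau> n) (last xs)))"
    (is "?A = bind_pmf ?B ?f")
proof (rule pmf_eqI)
  fix ys
  show "pmf ?A ys = pmf (bind_pmf ?B ?f) ys"
  proof (cases "ys \<in> lists E \<and> length ys = Suc (Suc n)")
    case True
    then obtain us u where ys: "ys = us @ [u]" "length us = Suc n" "us \<in> lists E" "u \<in> E"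
      by (cases ys rule: rev_cases) auto
    \<comment> \<open>The Markov clause quantifies over infinite sequences with values in
      \<open>E\<close>; \<open>u\<close> is the filler beyond the end of the path.\<close>
    define \<xi> where "\<xi> i = (if i < length ys then ys ! i else u)" for i
    have \<xi>: "\<xi> i \<in> E" for i using True ys(4) by (auto simp: \<xi>_def)
    have "us \<noteq> []" using ys(2) by auto
    hence last: "\<xi> n = last us" using ys(1,2) last_conv_nth[of us] by (simp add: \<xi>_def nth_append)
    have "pmf ?A ys = measure (Pr x) {\<omega> \<in> space (Pr x). \<forall>i\<le>Suc n. X (\<tau> i) \<omega> = \<xi> i}"
    proof -
      have "\<xi> i = ys ! i" if "i < Suc (Suc n)" for i
        using that True by (simp add: \<xi>_def)
      hence "(map (\<lambda>i. X (\<tau> i) \<omega>) [0..<Suc (Suc n)] = ys) \<longleftrightarrow> (\<forall>i\<le>Suc n. X (\<tau> i) \<omega> = \<xi> i)" for \<omega>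
        by (subst map_upt_eq_iff) (use True less_Suc_eq_le in metis)+
      thus ?thesis unfolding pmf_J by presburger
    qed
    also have "\<dots> = measure (Pr x) {\<omega> \<in> space (Pr x). \<forall>i\<le>n. X (\<tau> i) \<omega> = \<xi> i} *
       p (\<tau> (Suc n) - \<tau> n) (last us) (\<xi> (Suc n))"
      using markov[OF x \<tau>, of \<xi> n] \<xi> unfolding last by blast
    also have "measure (Pr x) {\<omega> \<in> space (Pr x). \<forall>i\<le>n. X (\<tau> i) \<omega> = \<xi> i} = pmf ?B us"
    proof -
      have "\<xi> i = us ! i" if "i < Suc n" for i
        using that ys by (simp add: \<xi>_def nth_append)
      hence "(map (\<lambda>i. X (\<tau> i) \<omega>) [0..<Suc n] = us) \<longleftrightarrow> (\<forall>i\<le>n. X (\<tau> i) \<omega> = \<xi> i)" for \<omega>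
        by (subst map_upt_eq_iff) (use ys less_Suc_eq_le in metis)+
      thus ?thesis unfolding pmf_J by presburger
    qed
    also have "\<xi> (Suc n) = u" using ys by (simp add: \<xi>_def nth_append)
    also have "p (\<tau> (Suc n) - \<tau> n) (last us) u = pmf (T (\<tau> (Suc n) - \<tau> n) (last us)) u"
      using monoD[OF \<tau>(2), of n "Suc n"] \<xi>[of n] unfolding last by (simp add: pmf_T)
    finally have A: "pmf ?A ys = pmf ?B us * pmf (T (\<tau> (Suc n) - \<tau> n) (last us)) u" .
    have "pmf (bind_pmf ?B ?f) ys =
        expect ?B (\<lambda>xs. pmf (T (\<tau> (Suc n) - \<tau> n) (last us)) u * indicator {us} xs)"
      unfolding pmf_bind ys(1) pmf_map_append
      by (rule Bochner_Integration.integral_cong) (simp_all add: indicator_def)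
    also have "\<dots> = pmf (T (\<tau> (Suc n) - \<tau> n) (last us)) u * pmf ?B us"
      by (simp add: measure_pmf_single)
    finally show ?thesis using A by simp
  next
    case False
    hence "ys \<notin> set_pmf ?A" using set_J by blast
    moreover have "ys \<notin> set_pmf (bind_pmf ?B ?f)"
    proof
      assume "ys \<in> set_pmf (bind_pmf ?B ?f)"
      then obtain xs z where xs: "xs \<in> set_pmf ?B" "z \<in> set_pmf (T (\<tau> (Suc n) - \<tau> n) (last xs))" "ys = xs @ [z]"
        by auto
      have "xs \<in> lists E" "length xs = Suc n" using set_J[OF xs(1)] by auto
      hence "last xs \<in> E" by (cases xs rule: rev_cases) auto
      from set_T[OF this, of "\<tau> (Suc n) - \<tau> n"] xs monoD[OF \<tau>(2), of n "Suc n"]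
      have "z \<in> E" by auto
      with False xs \<open>xs \<in> lists E\<close> \<open>length xs = Suc n\<close> show False by auto
    qed
    ultimately show ?thesis unfolding set_pmf_iff by simp
  qed
qed

end

lemma T_add:
  assumes "x \<in> E" "0 \<le> s" "0 \<le> t"
  shows "T (s + t) x = bind_pmf (T s x) (T t)"
proof -
  \<comment> \<open>Observation at \<open>s\<close> and at \<open>s + t\<close>; the second time is
    repeated for ever to keep \<open>\<tau>\<close> monotone.\<close>
  define \<tau> where "\<tau> i = s + (if i = (0::nat) then 0 else t)" for i
  have \<tau>: "0 \<le> \<tau> 0" "mono \<tau>" using assms by (auto simp: mono_def \<tau>_def)
  have "T (s + t) x = map_pmf last (J \<tau> x (Suc 0))"
    using map_last_J[OF \<tau> assms(1), of "Suc 0"] by (simp add: \<tau>_def)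
  also have "\<dots> = bind_pmf (J \<tau> x 0) (\<lambda>xs. T t (last xs))"
    unfolding J_Suc[OF \<tau> assms(1)] by (simp add: map_bind_pmf pmf.map_comp o_def \<tau>_def)
  also have "\<dots> = bind_pmf (map_pmf last (J \<tau> x 0)) (T t)"
    by (simp add: bind_map_pmf)
  also have "map_pmf last (J \<tau> x 0) = T s x" using map_last_J[OF \<tau> assms(1), of 0] by (simp add: \<tau>_def)
  finally show ?thesis .
qed

lemma T_0: "x \<in> E \<Longrightarrow> T 0 x = return_pmf x"
  by (rule pmf_eqI) (auto simp: pmf_T p_0 pmf_return indicator_def)

text \<open>Only the paths that are in \<open>y\<close> at time \<open>s\<close> are kept.\<close>

lemma p_ge_mult:
  assumes "x \<in> E" "y \<in> E" "0 \<le> s" "0 \<le> t"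
  shows "p s x y * p t y z \<le> p (s + t) x z"
proof -
  have "p s x y * p t y z = expect (T s x) (\<lambda>u. p t y z * indicator {y} u)"
    using assms by (simp add: measure_pmf_single pmf_T)
  also have "\<dots> \<le> expect (T s x) (\<lambda>u. pmf (T t u) z)"
    using assms by (intro integral_mono measure_pmf.integrable_const_bound[where B = 1])
      (auto simp: indicator_def pmf_T pmf_le_1 p_bounds)
  also have "\<dots> = p (s + t) x z"
    using assms by (simp flip: pmf_T add: T_add pmf_bind)
  finally show ?thesis .
qed

end

text \<open>By the integrating factor, \<open>exp (l * s) * f s\<close> is nondecreasing. At 0 the
  derivative is one-sided and supplies continuity only; monotonicity comes from the open
  interval.\<close>

lemma exp_lower_bound_within:
  fixes f :: "real \<Rightarrow> real"
  assumes t: "0 \<le> t"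
    and deriv: "\<And>s. 0 \<le> s \<Longrightarrow> s \<le> t \<Longrightarrow> (f has_real_derivative f' s) (at s within {0..})"
    and ge: "\<And>s. 0 \<le> s \<Longrightarrow> s \<le> t \<Longrightarrow> - l * f s \<le> f' s"
  shows "exp (- l * t) * f 0 \<le> f t"
proof -
  define g where "g s = exp (l * s) * f s" for s
  have g: "(g has_real_derivative (exp (l * s) * (l * f s + f' s))) (at s within {0..})"
    if "0 \<le> s" "s \<le> t" for s
    unfolding g_def using deriv[OF that]
    by (auto intro!: derivative_eq_intros simp: algebra_simps)
  have "g 0 \<le> g t"
  proof (rule DERIV_nonneg_imp_increasing_open[OF t])
    show "\<exists>y. (g has_real_derivative y) (at s) \<and> 0 \<le> y" if "0 < s" "s < t" for s
    proof (intro exI conjI)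
      have "at s within {0..} = at s" using that by (intro at_within_interior) auto
      thus "(g has_real_derivative (exp (l * s) * (l * f s + f' s))) (at s)" using g[of s] that by simp
      show "0 \<le> exp (l * s) * (l * f s + f' s)" using ge[of s] that by (intro mult_nonneg_nonneg) auto
    qed
    show "continuous_on {0..t} g"
      unfolding continuous_on_eq_continuous_within
    proof
      fix s assume "s \<in> {0..t}"
      hence "continuous (at s within {0..}) g" by (intro DERIV_continuous[OF g]) auto
      thus "continuous (at s within {0..t}) g" by (rule continuous_within_subset) auto
    qed
  qed
  hence "exp (- l * t) * g 0 \<le> exp (- l * t) * g t" by (intro mult_left_mono) auto
  thus ?thesis by (simp add: g_def mult.assoc[symmetric] flip: exp_add)
qed

lemma expectation_indicator_add:
  "expect q (\<lambda>y. indicator K y + c) = measure (measure_pmf q) K + (c :: real)"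
proof -
  have "integrable (measure_pmf q) (indicator K :: _ \<Rightarrow> real)"
    by (intro measure_pmf.integrable_const_bound[where B = 1]) (auto simp: indicator_def)
  thus ?thesis by (subst Bochner_Integration.integral_add) auto
qed

section \<open>Positivity and decay of transition probabilities\<close>

context bounded_jump_process begin

lemma lam_nonneg: "x \<in> E \<Longrightarrow> 0 \<le> lam x"
  using rate_sum rate_nonneg by (metis has_sum_nonneg)

text \<open>The inflow in the backward equation is nonnegative, so \<open>p t x x\<close> is at
  least \<open>exp (- lam x * t)\<close>, the chance that no event happens up to time
  \<open>t\<close>.\<close>

lemma p_diag_pos:
  assumes "x \<in> E" "0 \<le> t"
  shows "0 < p t x x"
proof -
  have "exp (- lam x * t) * p 0 x x \<le> p t x x"
    by (rule exp_lower_bound_within[OF assms(2) p_deriv])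
       (use assms rate_nonneg p_bounds in \<open>auto intro!: infsum_nonneg\<close>)
  thus ?thesis using assms by (simp add: p_0) (meson exp_gt_zero less_le_trans)
qed

lemma p_pos_mono:
  assumes "x \<in> E" "y \<in> E" "0 \<le> s" "s \<le> t" "0 < p s x y"
  shows "0 < p t x y"
proof -
  have "0 < p s x y * p (t - s) y y" using assms p_diag_pos by simp
  also have "\<dots> \<le> p t x y" using p_ge_mult[of x y s "t - s" y] assms by simp
  finally show ?thesis .
qed

text \<open>If \<open>p t x y\<close> vanished for all \<open>t\<close>, so would its derivative,
  which is then the sum over all \<open>z\<close> of \<open>r x z * p t z y\<close>. The summand of
  the given \<open>z\<close>, however, is positive for late \<open>t\<close>.\<close>

lemma rate_pos_accessible:
  assumes x: "x \<in> E" and z: "z \<in> E" and y: "y \<in> E" and "0 < r x z" "0 \<le> s" "0 < p s z y"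
  shows "\<exists>t\<ge>0. 0 < p t x y"
proof (rule ccontr)
  assume "\<not> ?thesis"
  hence zero: "p t x y = 0" if "0 \<le> t" for t using that p_bounds[OF x that, of y] by force
  \<comment> \<open>A time after \<open>s\<close> keeps \<open>p t z y\<close> positive, and being
    interior to the half-line it has a two-sided derivative.\<close>
  define t where "t = s + 1"
  have "0 < p t z y" by (rule p_pos_mono[OF z y \<open>0 \<le> s\<close>]) (use assms in \<open>auto simp: t_def\<close>)
  have t: "0 < t" using assms by (simp add: t_def)
  have "at t within {0..} = at t" using t by (intro at_within_interior) auto
  with p_deriv[OF x y, of t] zero[of t] t
  have "((\<lambda>s. p s x y) has_real_derivative (\<Sum>\<^sub>\<infinity>z\<in>E. r x z * p t z y)) (at t)" by simp
  moreover have "((\<lambda>s. p s x y) has_real_derivative 0) (at t)"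
    by (rule has_field_derivative_transform_within_open[where f = "\<lambda>_. 0" and S = "{0<..}"])
       (use t zero in auto)
  ultimately have "(\<Sum>\<^sub>\<infinity>z\<in>E. r x z * p t z y) = 0" by (rule DERIV_unique)
  moreover have "(\<Sum>z\<in>{z}. r x z * p t z y) \<le> (\<Sum>\<^sub>\<infinity>z\<in>E. r x z * p t z y)"
    by (rule finite_sum_le_infsum) (use x z t rate_nonneg p_bounds in \<open>auto intro!: rate_mult_summable[of _ _ 1]\<close>)
  ultimately show False using \<open>0 < p t z y\<close> \<open>0 < r x z\<close> by (simp add: mult_le_0_iff)
qed

text \<open>
  A minimum principle: \<open>exp (-c t) u - u(y) p\<^sub>t(\<cdot>, y)\<close> is nonnegative at time zero and is a
  supersolution of the backward equation. If it had a negative infimum \<open>-m\<close> over \<open>[0,s] \<times> E\<close>, the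
  exponential lower bound applied after adding \<open>m\<close> would keep it above a larger constant.
\<close>

lemma p_le_exp_decay:
  assumes u: "\<And>z. z \<in> E \<Longrightarrow> 0 \<le> u z" "\<And>z. z \<in> E \<Longrightarrow> u z \<le> B"
    and G: "\<And>z. z \<in> E \<Longrightarrow> (\<Sum>\<^sub>\<infinity>w\<in>E. r z w * u w) - lam z * u z \<le> - c * u z"
    and x: "x \<in> E" and y: "y \<in> E" and s: "0 \<le> s"
  shows "u y * p s x y \<le> exp (- c * s) * u x"
proof -
  define H where "H t z = exp (- c * t) * u z - u y * p t z y" for t z
  define m where "m = - (INF (t, z)\<in>{0..s} \<times> E. H t z)"
  have B: "0 \<le> B" using u[OF x] by simp
  have lower: "- B \<le> H t z" if "0 \<le> t" "z \<in> E" for t z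
  proof -
    have "u y * p t z y \<le> B * 1" using u y B that p_bounds by (intro mult_mono) auto
    moreover have "0 \<le> exp (- c * t) * u z" using u that by simp
    ultimately show ?thesis unfolding H_def by linarith
  qed
  have bdd: "bdd_below ((\<lambda>(t, z). H t z) ` ({0..s} \<times> E))"
    using lower by (auto intro!: bdd_belowI[of _ "- B"])
  have Hm: "0 \<le> H t z + m" if "0 \<le> t" "t \<le> s" "z \<in> E" for t z
    using cINF_lower[OF bdd, of "(t, z)"] that by (simp add: m_def)
  have "\<not> 0 < m"
  proof
    assume m: "0 < m"
    have H_ge: "exp (- L * s) * m - m \<le> H t z" if t: "0 \<le> t" "t \<le> s" and z: "z \<in> E" for t z
    proof -
      define H' where "H' t = - c * exp (- c * t) * u z
        - u y * ((\<Sum>\<^sub>\<infinity>w\<in>E. r z w * p t w y) - lam z * p t z y)" for t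
      have "exp (- lam z * t) * (H 0 z + m) \<le> H t z + m"
      proof (rule exp_lower_bound_within[OF t(1)])
        fix a assume a: "0 \<le> a" "a \<le> t"
        show "((\<lambda>t. H t z + m) has_real_derivative H' a) (at a within {0..})"
          unfolding H_def H'_def using p_deriv[OF z y a(1)]
          by (auto intro!: derivative_eq_intros)
        have su: "(\<lambda>w. r z w * u w) summable_on E"
          by (rule rate_mult_summable[OF z, of _ B]) (use u in auto)
        have sp: "(\<lambda>w. r z w * p a w y) summable_on E"
          by (rule rate_mult_summable[OF z, of _ 1]) (use p_bounds a in auto)
        \<comment> \<open>The three series together expand the sum of
          \<open>r z w * (H a w + m)\<close>, whose terms are nonnegative by
          \<open>Hm\<close>.\<close>
        have "((\<lambda>w. exp (- c * a) * (r z w * u w) + (- u y) * (r z w * p a w y) + m * r z w) has_sum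
            (exp (- c * a) * (\<Sum>\<^sub>\<infinity>w\<in>E. r z w * u w) + (- u y) * (\<Sum>\<^sub>\<infinity>w\<in>E. r z w * p a w y) + m * lam z)) E"
          by (intro has_sum_add has_sum_cmult_right has_sum_infsum su sp rate_sum[OF z])
        hence "0 \<le> exp (- c * a) * (\<Sum>\<^sub>\<infinity>w\<in>E. r z w * u w) + (- u y) * (\<Sum>\<^sub>\<infinity>w\<in>E. r z w * p a w y) + m * lam z"
        proof (rule has_sum_nonneg)
          fix w assume w: "w \<in> E"
          have "0 \<le> r z w * (H a w + m)" using Hm[of a w] a t w rate_nonneg[OF z w] by simp
          thus "0 \<le> exp (- c * a) * (r z w * u w) + (- u y) * (r z w * p a w y) + m * r z w"
            by (simp add: H_def algebra_simps)
        qed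
        hence 1: "u y * (\<Sum>\<^sub>\<infinity>w\<in>E. r z w * p a w y) \<le>
            exp (- c * a) * (\<Sum>\<^sub>\<infinity>w\<in>E. r z w * u w) + m * lam z" by linarith
        have 2: "exp (- c * a) * (\<Sum>\<^sub>\<infinity>w\<in>E. r z w * u w) \<le> exp (- c * a) * (lam z * u z - c * u z)"
          using G[OF z] by (intro mult_left_mono) auto
        show "- lam z * (H a z + m) \<le> H' a"
          using 1 2 unfolding H_def H'_def by (simp add: algebra_simps)
      qed
      moreover have "0 \<le> H 0 z" using u[OF z] by (auto simp: H_def p_0[OF z])
      moreover have "exp (- L * s) \<le> exp (- lam z * t)"
        using rate_bound[OF z] lam_nonneg[OF z] t by (auto intro: mult_mono)
      ultimately show ?thesis
        using mult_mono[of "exp (- L * s)" "exp (- lam z * t)" m "H 0 z + m"] m by simp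
    qed
    have "exp (- L * s) * m - m \<le> (INF (t, z)\<in>{0..s} \<times> E. H t z)"
      by (rule cINF_greatest) (use H_ge s x in auto)
    hence "exp (- L * s) * m \<le> 0" by (simp add: m_def)
    with m show False by (simp add: mult_le_0_iff)
  qed
  thus ?thesis using Hm[of s x] s x by (simp add: H_def)
qed

text \<open>States with \<open>\<phi>\<close> below \<open>\<eta> / 2\<close> contribute at most
  \<open>\<eta> / 2\<close>. The others form a finite set, which loses its mass because each of its
  points does.\<close>

lemma expectation_tendsto_0:
  fixes \<phi> :: "'x \<Rightarrow> real"
  assumes x: "x \<in> E" and \<phi>: "\<And>y. y \<in> E \<Longrightarrow> 0 \<le> \<phi> y \<and> \<phi> y \<le> 1" "\<And>\<eta>. 0 < \<eta> \<Longrightarrow> finite {y \<in> E. \<eta> \<le> \<phi> y}"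
    and lim: "\<And>y. y \<in> E \<Longrightarrow> ((\<lambda>t. p t x y) \<longlongrightarrow> 0) at_top"
  shows "((\<lambda>t. expect (T t x) \<phi>) \<longlongrightarrow> 0) at_top"
proof (rule tendstoI)
  fix \<eta> :: real assume \<eta>: "0 < \<eta>"
  define K where "K = {y \<in> E. \<eta> / 2 \<le> \<phi> y}"
  have K: "finite K" unfolding K_def using \<eta> by (intro \<phi>) auto
  have "((\<lambda>t. \<Sum>y\<in>K. p t x y) \<longlongrightarrow> (\<Sum>y\<in>K. 0)) at_top"
    by (rule tendsto_sum) (use lim in \<open>auto simp: K_def\<close>)
  hence "\<forall>\<^sub>F t in at_top. (\<Sum>y\<in>K. p t x y) < \<eta> / 2"
    using \<eta> by (intro order_tendstoD(2)[where y = 0]) auto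
  thus "\<forall>\<^sub>F t in at_top. dist (expect (T t x) \<phi>) 0 < \<eta>"
    using eventually_ge_at_top[of 0]
  proof eventually_elim
    case (elim t)
    have ae: "AE y in T t x. y \<in> E" using set_T[OF x elim(2)] by (auto simp: AE_measure_pmf_iff)
    have "expect (T t x) \<phi> \<le> expect (T t x) (\<lambda>y. indicator K y + \<eta> / 2)"
    proof (rule integral_mono_AE)
      show "integrable (T t x) \<phi>"
        using ae \<phi>(1) by (intro measure_pmf.integrable_const_bound[where B = 1]) auto
      show "AE y in T t x. \<phi> y \<le> indicator K y + \<eta> / 2"
        using ae by eventually_elim (use \<phi>(1) \<eta> in \<open>auto simp: K_def indicator_def\<close>, force)
      show "integrable (T t x) (\<lambda>y. indicator K y + \<eta> / 2)"
        using \<eta> by (intro measure_pmf.integrable_const_bound[where B = "1 + \<eta> / 2"]) (auto simp: indicator_def)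
    qed
    also have "\<dots> = (\<Sum>y\<in>K. p t x y) + \<eta> / 2"
      using x elim by (simp add: expectation_indicator_add measure_measure_pmf_finite[OF K] pmf_T)
    finally have "expect (T t x) \<phi> < \<eta>" using elim by simp
    moreover have "0 \<le> expect (T t x) \<phi>"
      using ae \<phi>(1) by (intro integral_nonneg_AE) auto
    ultimately show ?case by simp
  qed
qed

end

text \<open>The root takes the place of irreducibility: it can be reached from every state, but
  states need not be reachable from it. Recurrence is studied on those that are, the set
  \<open>reach\<close>.\<close>

locale rooted_jump_process = bounded_jump_process +
  fixes root
  assumes root: "root \<in> E"
    and root_accessible: "x \<in> E \<Longrightarrow> \<exists>t\<ge>0. 0 < p t x root"
begin

text \<open>A mean of at least \<open>\<eta>\<close> puts mass at least \<open>\<eta> / 2\<close> on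
  the finite set \<open>K\<close>, and from each state of \<open>K\<close> the process is at the
  root at the common time \<open>S\<close> with probability at least \<open>c\<close>.\<close>

lemma return_prob_bounded_below:
  fixes \<phi> :: "'a \<Rightarrow> real"
  assumes \<phi>: "\<And>y. y \<in> E \<Longrightarrow> 0 \<le> \<phi> y \<and> \<phi> y \<le> 1" "\<And>\<eta>. 0 < \<eta> \<Longrightarrow> finite {y \<in> E. \<eta> \<le> \<phi> y}"
    and \<eta>: "0 < \<eta>" "\<And>t. 0 \<le> t \<Longrightarrow> \<eta> \<le> expect (T t root) \<phi>"
  shows "\<exists>c>0. \<exists>s\<ge>0. \<forall>t\<ge>s. c \<le> p t root root"
proof -
  define K where "K = {y \<in> E. \<eta> / 2 \<le> \<phi> y}"
  have K: "finite K" "K \<subseteq> E" unfolding K_def by (rule \<phi>(2)) (use \<eta>(1) in auto)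
  obtain s where s: "0 \<le> s y" "0 < p (s y) y root" if "y \<in> E" for y
    using root_accessible by metis
  \<comment> \<open>One time for all of \<open>K\<close>, possible because positivity persists
    (\<open>p_pos_mono\<close>); the inserted 0 covers an empty \<open>K\<close>.\<close>
  define S where "S = Max (insert 0 (s ` K))"
  have "0 < p S y root" if "y \<in> K" for y
    by (rule p_pos_mono[of _ _ "s y"]) (use that K s root in \<open>auto simp: S_def\<close>)
  moreover define c where "c = Min (insert 1 ((\<lambda>y. p S y root) ` K))"
  ultimately have c: "0 < c" "\<And>y. y \<in> K \<Longrightarrow> c \<le> p S y root" "c \<le> 1"
    using K by (auto simp: c_def)
  have S: "0 \<le> S" using K by (simp add: S_def)
  have *: "c * (\<eta> / 2) \<le> p (t + S) root root" if t: "0 \<le> t" for t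
  proof -
    have ae: "AE y in T t root. y \<in> E" using set_T[OF root t] by (auto simp: AE_measure_pmf_iff)
    have "\<eta> \<le> expect (T t root) \<phi>" by (rule \<eta>(2)[OF t])
    also have "\<dots> \<le> expect (T t root) (\<lambda>y. indicator K y + \<eta> / 2)"
    proof (rule integral_mono_AE)
      show "integrable (T t root) \<phi>"
        using ae \<phi>(1) by (intro measure_pmf.integrable_const_bound[where B = 1]) auto
      show "AE y in T t root. \<phi> y \<le> indicator K y + \<eta> / 2"
        using ae by eventually_elim (use \<phi>(1) \<eta> in \<open>auto simp: K_def indicator_def\<close>, force)
      show "integrable (T t root) (\<lambda>y. indicator K y + \<eta> / 2)"
        using \<eta> by (intro measure_pmf.integrable_const_bound[where B = "1 + \<eta> / 2"]) (auto simp: indicator_def)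
    qed
    also have "\<dots> = measure (T t root) K + \<eta> / 2" by (rule expectation_indicator_add)
    finally have "c * (\<eta> / 2) \<le> c * measure (T t root) K" using c by (intro mult_left_mono) auto
    also have "\<dots> = expect (T t root) (\<lambda>y. c * indicator K y)" by simp
    also have "\<dots> \<le> expect (T t root) (\<lambda>y. pmf (T S y) root)"
      using c S K by (intro integral_mono measure_pmf.integrable_const_bound[where B = 1])
        (auto simp: indicator_def pmf_T pmf_le_1 subset_iff)
    also have "\<dots> = p (t + S) root root"
      using root S t by (simp flip: pmf_T add: T_add pmf_bind)
    finally show ?thesis .
  qed
  have "c * (\<eta> / 2) \<le> p t root root" if "S \<le> t" for t using that *[of "t - S"] by simp
  moreover have "0 < c * (\<eta> / 2)" using c \<eta> by simp
  ultimately show ?thesis using S by blast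
qed

end

subsection \<open>Positive recurrence\<close>

lemma integral_bind_pmf:
  fixes f :: "'b \<Rightarrow> real"
  assumes "\<And>x. \<bar>f x\<bar> \<le> B"
  shows "expect (bind_pmf M N) f = expect M (\<lambda>x. expect (N x) f)"
  unfolding measure_pmf_bind
  by (rule integral_bind[where K = "count_space UNIV" and B = B and B' = 1])
     (use assms in \<open>auto simp: measure_pmf.finite_measure_axioms measure_pmf_in_subprob_algebra measure_pmf.emeasure_space_1[simplified]\<close>)

text \<open>The shifted window lies within the first \<open>n + m\<close> indices, the last
  \<open>m\<close> of which contribute at most one each. This is the boundary error of a time shift
  in a time average.\<close>

lemma sum_shift_le:
  fixes g :: "nat \<Rightarrow> real"
  assumes "\<And>j. 0 \<le> g j" "\<And>j. g j \<le> 1"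
  shows "(\<Sum>j<n. g (j + m)) \<le> (\<Sum>j<n. g j) + real m"
proof -
  have "(\<Sum>j<n. g (j + m)) = (\<Sum>j=m..<n+m. g j)"
    using sum.shift_bounds_nat_ivl[of g 0 m n] by (simp add: lessThan_atLeast0)
  also have "\<dots> \<le> (\<Sum>j\<in>{..<n+m}. g j)"
    by (rule sum_mono2) (use assms in auto)
  also have "\<dots> = (\<Sum>j<n. g j) + (\<Sum>j=n..<n+m. g j)"
    by (simp add: lessThan_atLeast0 sum.atLeastLessThan_concat)
  also have "(\<Sum>j=n..<n+m. g j) \<le> (\<Sum>j=n..<n+m. 1)"
    by (rule sum_mono) (use assms in auto)
  finally show ?thesis by simp
qed

section \<open>Recurrence through avoidance of the root at integer times\<close>

context rooted_jump_process begin

definition reach where "reach = {y \<in> E. \<exists>t\<ge>0. 0 < p t root y}"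

lemma root_reach: "root \<in> reach"
  using root p_diag_pos[OF root, of 0] by (auto simp: reach_def)

text \<open>One unit of time of the process killed on entering the root; its \<open>n\<close>-th
  power applied to the constant one is the probability of avoiding the root at the times 1 to
  \<open>n\<close> (\<open>prob_avoid\<close>).\<close>

definition Q where "Q g x = expect (T 1 x) (\<lambda>z. if z = root then 0 else g z)" for g :: "'a \<Rightarrow> real"

lemma Q_bounded: "(\<And>x. \<bar>g x\<bar> \<le> 1) \<Longrightarrow> \<bar>Q g x\<bar> \<le> 1"
proof -
  assume g: "\<And>x. \<bar>g x\<bar> \<le> 1"
  have "\<bar>Q g x\<bar> \<le> expect (T 1 x) (\<lambda>z. \<bar>if z = root then 0 else g z\<bar>)"
    unfolding Q_def by (rule integral_abs_bound)
  also have "\<dots> \<le> expect (T 1 x) (\<lambda>z. 1)"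
    by (intro integral_mono measure_pmf.integrable_const_bound[where B = 1]) (use g in auto)
  finally show ?thesis by simp
qed

text \<open>The induction absorbs the last step of the path into \<open>g\<close>, which is why
  \<open>g\<close> is arbitrary. \<open>tl\<close> drops time zero: starting at the root does not
  count as a visit.\<close>

lemma expectation_avoid:
  assumes "x \<in> E" "\<And>x. \<bar>g x\<bar> \<le> 1"
  shows "expect (J real x n) (\<lambda>xs. if root \<in> set (tl xs) then 0 else g (last xs)) = (Q ^^ n) g x"
  using assms(2)
proof (induction n arbitrary: g)
  case 0
  have m: "0 \<le> real 0" "mono real" by (auto simp: mono_def)
  have "expect (J real x 0) (\<lambda>xs. if root \<in> set (tl xs) then 0 else g (last xs)) =
    expect (J real x 0) (\<lambda>xs. g (last xs))"
  proof (rule integral_cong_AE)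
    show "AE xs in J real x 0. (if root \<in> set (tl xs) then 0 else g (last xs)) = g (last xs)"
      unfolding AE_measure_pmf_iff
    proof
      fix xs assume "xs \<in> set_pmf (J real x 0)"
      from set_J[OF m assms(1) this] have "tl xs = []" by (cases xs) auto
      thus "(if root \<in> set (tl xs) then 0 else g (last xs)) = g (last xs)" by simp
    qed
  qed auto
  also have "\<dots> = expect (map_pmf last (J real x 0)) g" by simp
  also have "map_pmf last (J real x 0) = T 0 x" using map_last_J[OF m assms(1), of 0] by simp
  finally show ?case by (simp add: T_0 assms)
next
  case (Suc n)
  have m: "0 \<le> real 0" "mono real" by (auto simp: mono_def)
  define F where "F xs = (if root \<in> set (tl xs) then 0 else g (last xs))" for xs
  have "expect (J real x (Suc n)) F =
      expect (J real x n) (\<lambda>xs. expect (T 1 (last xs)) (\<lambda>z. F (xs @ [z])))"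
    unfolding J_Suc[OF m assms(1)] by (subst integral_bind_pmf[of _ 1]) (use Suc.prems in \<open>auto simp: F_def\<close>)
  also have "\<dots> = expect (J real x n) (\<lambda>xs. if root \<in> set (tl xs) then 0 else Q g (last xs))"
  proof (rule integral_cong_AE)
    show "AE xs in J real x n. expect (T 1 (last xs)) (\<lambda>z. F (xs @ [z])) =
       (if root \<in> set (tl xs) then 0 else Q g (last xs))"
      unfolding AE_measure_pmf_iff
    proof
      fix xs assume "xs \<in> set_pmf (J real x n)"
      from set_J[OF m assms(1) this] have "xs \<noteq> []" by auto
      hence "F (xs @ [z]) = (if root \<in> set (tl xs) then 0 else if z = root then 0 else g z)" for z
        by (auto simp: F_def)
      thus "expect (T 1 (last xs)) (\<lambda>z. F (xs @ [z])) =
         (if root \<in> set (tl xs) then 0 else Q g (last xs))" by (simp add: Q_def)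
    qed
  qed auto
  also have "\<dots> = (Q ^^ n) (Q g) x" by (rule Suc.IH) (rule Q_bounded[OF Suc.prems])
  finally show ?case by (simp add: F_def[abs_def] funpow_swap1)
qed

definition avoid where "avoid x n = {\<omega> \<in> space (Pr x). \<forall>i\<in>{1..n}. X (real i) \<omega> \<noteq> root}"

lemma avoid_sets: "x \<in> E \<Longrightarrow> avoid x n \<in> sets (Pr x)"
proof -
  assume x: "x \<in> E"
  have "{\<omega> \<in> space (Pr x). X (real i) \<omega> \<noteq> root} \<in> sets (Pr x)" for i
    using measurable_sets[OF X_measurable_UNIV[OF x], of "real i" "- {root}"]
    by (simp add: vimage_def Int_def conj_commute)
  thus ?thesis unfolding avoid_def by (intro sets.sets_Collect_finite_All) auto
qed

lemma prob_avoid: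
  assumes x: "x \<in> E"
  shows "measure (Pr x) (avoid x n) = (Q ^^ n) (\<lambda>_. 1) x"
proof -
  have m: "0 \<le> real 0" "mono real" by (auto simp: mono_def)
  let ?path = "\<lambda>\<omega>. map (\<lambda>i. X (real i) \<omega>) [0..<Suc n]"
  have "tl (?path \<omega>) = map (\<lambda>i. X (real i) \<omega>) [1..<Suc n]" for \<omega>
    by (simp add: map_tl[symmetric] del: upt_Suc)
  hence tl: "root \<in> set (tl (?path \<omega>)) \<longleftrightarrow> (\<exists>i\<in>{1..n}. X (real i) \<omega> = root)" for \<omega>
    by (auto simp: image_iff simp del: upt_Suc)
  have "(Q ^^ n) (\<lambda>_. 1) x = expect (J real x n) (\<lambda>xs. if root \<in> set (tl xs) then 0 else 1)"
    using expectation_avoid[OF x, of "\<lambda>_. 1" n] by simp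
  also have "\<dots> = expect (J real x n) (indicator {xs. root \<notin> set (tl xs)})"
    by (rule Bochner_Integration.integral_cong) (auto simp: indicator_def)
  also have "\<dots> = measure (J real x n) {xs. root \<notin> set (tl xs)}" by simp
  also have "\<dots> = measure (Pr x) (avoid x n)"
  proof -
    have "measure_pmf (J real x n) = distr (Pr x) (count_space UNIV) ?path"
      unfolding J_def by (rule law_path(2)[OF m x])
    thus ?thesis using path_measurable[OF m x, of "Suc n"]
      by (simp only: measure_distr sets_count_space Pow_UNIV UNIV_I)
        (auto simp: avoid_def tl vimage_def Int_def conj_commute simp del: upt_Suc intro!: arg_cong[of _ _ "measure (Pr x)"])
  qed
  finally show ?thesis by simp
qed

text \<open>The value zero outside \<open>E\<close> makes the bounds by 0 and 1 hold for all
  arguments, as the integral estimates require.\<close>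

definition avoid_lim where "avoid_lim x = (if x \<in> E then lim (\<lambda>n. measure (Pr x) (avoid x n)) else 0)"

lemma avoid_decseq: "x \<in> E \<Longrightarrow> decseq (\<lambda>n. measure (Pr x) (avoid x n))"
proof -
  assume x: "x \<in> E"
  interpret prob_space "Pr x" by (rule prob_Pr[OF x])
  show ?thesis unfolding decseq_def
    by (intro allI impI finite_measure_mono avoid_sets x) (auto simp: avoid_def)
qed

lemma avoid_tendsto: "x \<in> E \<Longrightarrow> (\<lambda>n. measure (Pr x) (avoid x n)) \<longlonglongrightarrow> avoid_lim x"
proof -
  assume x: "x \<in> E"
  have "convergent (\<lambda>n. measure (Pr x) (avoid x n))"
    using decseq_convergent[OF avoid_decseq[OF x], of 0] by (auto simp: convergent_def)
  thus ?thesis using x by (simp add: avoid_lim_def convergent_LIMSEQ_iff)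
qed

lemma avoid_lim_bounds: "0 \<le> avoid_lim x" "avoid_lim x \<le> 1"
proof -
  have "0 \<le> avoid_lim x \<and> avoid_lim x \<le> 1"
  proof (cases "x \<in> E")
    case True
    interpret prob_space "Pr x" by (rule prob_Pr[OF True])
    show ?thesis
      using LIMSEQ_le_const[OF avoid_tendsto[OF True], of 0] LIMSEQ_le_const2[OF avoid_tendsto[OF True], of 1] by auto
  qed (simp add: avoid_lim_def)
  thus "0 \<le> avoid_lim x" "avoid_lim x \<le> 1" by auto
qed

text \<open>First-step analysis: avoiding the root \<open>n + 1\<close> times is one application of
  \<open>Q\<close> to avoiding it \<open>n\<close> times, and dominated convergence passes to the
  limit.\<close>

lemma avoid_lim_harmonic:
  assumes x: "x \<in> E"
  shows "avoid_lim x = Q avoid_lim x"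
proof -
  have ae: "AE y in T 1 x. y \<in> E" using set_T[OF x, of 1] by (auto simp: AE_measure_pmf_iff)
  have "(\<lambda>n. Q ((Q ^^ n) (\<lambda>_. 1)) x) \<longlonglongrightarrow> Q avoid_lim x"
    unfolding Q_def[of _ x]
  proof (rule integral_dominated_convergence[where w = "\<lambda>_. 1"])
    show "AE z in T 1 x. (\<lambda>n. if z = root then 0 else (Q ^^ n) (\<lambda>_. 1) z) \<longlonglongrightarrow> (if z = root then 0 else avoid_lim z)"
      using ae by eventually_elim (use avoid_tendsto prob_avoid in auto)
    have "\<bar>(Q ^^ n) (\<lambda>_. 1) z\<bar> \<le> 1" for n z
      by (induction n arbitrary: z) (auto intro: Q_bounded)
    thus "AE z in T 1 x. norm (if z = root then 0 else (Q ^^ n) (\<lambda>_. 1) z) \<le> 1" for n by auto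
  qed auto
  hence "(\<lambda>n. measure (Pr x) (avoid x (Suc n))) \<longlonglongrightarrow> Q avoid_lim x"
    by (simp add: prob_avoid[OF x])
  moreover have "(\<lambda>n. measure (Pr x) (avoid x (Suc n))) \<longlonglongrightarrow> avoid_lim x"
    by (rule LIMSEQ_Suc[OF avoid_tendsto[OF x]])
  ultimately show ?thesis by (rule LIMSEQ_unique[rotated])
qed

text \<open>
  Since \<open>avoid_lim\<close> is harmonic except at the root, its mean at time \<open>n\<close> grows by \<open>avoid_lim(root)\<close> times the
  return probability in each step; being bounded, it leaves no room for \<open>avoid_lim(root) > 0\<close>.
\<close>

lemma avoid_lim_eq_0:
  assumes c: "0 < c" "\<And>t. s \<le> t \<Longrightarrow> c \<le> p t root root" and x: "x \<in> reach"
  shows "avoid_lim x = 0"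
proof -
  define e where "e n = expect (T (real n) root) avoid_lim" for n
  have bounded: "\<bar>avoid_lim y\<bar> \<le> 1" for y using avoid_lim_bounds[of y] by simp
  have e_Suc: "e (Suc n) = e n + avoid_lim root * p (Suc n) root root" for n
  proof -
    have ae: "AE y in T (real n) root. y \<in> E" using set_T[OF root, of n] by (auto simp: AE_measure_pmf_iff)
    have "T (real (Suc n)) root = bind_pmf (T n root) (T 1)"
      using T_add[OF root, of n 1] by (simp add: add.commute)
    hence "e (Suc n) = expect (T n root) (\<lambda>y. expect (T 1 y) avoid_lim)"
      unfolding e_def by (simp add: integral_bind_pmf[of avoid_lim 1] bounded del: of_nat_Suc)
    also have "\<dots> = expect (T n root) (\<lambda>y. avoid_lim y + avoid_lim root * pmf (T 1 y) root)"
    proof (rule integral_cong_AE)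
      show "AE y in T n root. expect (T 1 y) avoid_lim = avoid_lim y + avoid_lim root * pmf (T 1 y) root"
        using ae
      proof eventually_elim
        case (elim y)
        have int: "integrable (T 1 y) (\<lambda>z. if z = root then 0 else avoid_lim z)"
          using bounded by (intro measure_pmf.integrable_const_bound[where B = 1]) auto
        have "expect (T 1 y) avoid_lim =
            expect (T 1 y) (\<lambda>z. (if z = root then 0 else avoid_lim z) + avoid_lim root * indicator {root} z)"
          by (rule Bochner_Integration.integral_cong) auto
        also have "\<dots> = Q avoid_lim y + avoid_lim root * pmf (T 1 y) root"
          using int by (subst Bochner_Integration.integral_add)
            (auto simp: Q_def measure_pmf_single intro!: integrable_mult_right measure_pmf.integrable_const_bound[where B = 1])
        finally show ?case using avoid_lim_harmonic[OF elim] by simp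
      qed
    qed auto
    also have "\<dots> = e n + avoid_lim root * expect (T n root) (\<lambda>y. pmf (T 1 y) root)"
      unfolding e_def using bounded
      by (subst Bochner_Integration.integral_add)
         (auto intro!: integrable_mult_right measure_pmf.integrable_const_bound[where B = 1] simp: pmf_le_1)
    also have "expect (T n root) (\<lambda>y. pmf (T 1 y) root) = p (Suc n) root root"
      using T_add[OF root, of n 1] by (simp flip: pmf_T[OF root] pmf_bind add: add.commute)
    finally show ?thesis .
  qed
  have e_le: "e n \<le> 1" for n
  proof -
    have "e n \<le> expect (T n root) (\<lambda>_. 1)" unfolding e_def
      by (intro integral_mono measure_pmf.integrable_const_bound[where B = 1]) (use avoid_lim_bounds in auto)
    thus ?thesis by simp
  qed
  have e_0: "e 0 = avoid_lim root" by (simp add: e_def T_0[OF root])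
  have h0: "avoid_lim root = 0"
  proof (rule ccontr)
    assume "avoid_lim root \<noteq> 0"
    hence pos: "0 < avoid_lim root * c" using avoid_lim_bounds[of root] c by auto
    define N where "N = nat \<lceil>s\<rceil>"
    have "e N + real m * (avoid_lim root * c) \<le> e (N + m)" for m
    proof (induction m)
      case (Suc m)
      have "s \<le> real N" by (simp add: N_def) linarith
      hence "avoid_lim root * c \<le> avoid_lim root * p (Suc (N + m)) root root"
        by (intro mult_left_mono c(2) avoid_lim_bounds) auto
      with Suc show ?case by (simp add: e_Suc algebra_simps del: of_nat_Suc) (simp add: algebra_simps)
    qed simp
    moreover have "0 \<le> e N" unfolding e_def by (intro Bochner_Integration.integral_nonneg) (rule avoid_lim_bounds)
    ultimately have "real m * (avoid_lim root * c) \<le> 1" for m using e_le[of "N + m"] by (smt (verit))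
    moreover obtain m where "1 < real m * (avoid_lim root * c)" using reals_Archimedean3[OF pos] by blast
    ultimately show False by (meson not_le)
  qed
  \<comment> \<open>The mean is now zero at all integer times, while each state of
    \<open>reach\<close> has positive mass at one of them.\<close>
  have e_eq: "e n = 0" for n by (induction n) (simp_all add: e_0 e_Suc h0 del: of_nat_Suc)
  from x obtain t where t: "0 \<le> t" "0 < p t root x" and xE: "x \<in> E" by (auto simp: reach_def)
  define n where "n = nat \<lceil>t\<rceil>"
  have "t \<le> real n" by (simp add: n_def) linarith
  from p_pos_mono[OF root xE t(1) this t(2)] have pn: "0 < p n root x" .
  have "p n root x * avoid_lim x = expect (T n root) (\<lambda>y. avoid_lim x * indicator {x} y)"
    by (simp add: measure_pmf_single pmf_T[OF root])
  also have "\<dots> \<le> e n" unfolding e_def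
    by (intro integral_mono measure_pmf.integrable_const_bound[where B = 1])
       (use avoid_lim_bounds bounded in \<open>auto simp: indicator_def\<close>)
  finally show ?thesis using pn avoid_lim_bounds[of x] e_eq[of n] by (simp add: mult_le_0_iff)
qed

text \<open>The unit mass at the root serves as \<open>\<psi>\<close>: it charges exactly the sets
  containing the root, so it is enough that the root is hit almost surely, and integer times already
  achieve this.\<close>

lemma harris_recurrent_reach:
  assumes c: "0 < c" "\<And>t. s \<le> t \<Longrightarrow> c \<le> p t root root"
  shows "harris_recurrent reach Pr X"
proof -
  have hit: "AE \<omega> in Pr x. \<exists>t\<ge>0. X t \<omega> = root" if x: "x \<in> reach" for x
  proof -
    have xE: "x \<in> E" using x by (simp add: reach_def)
    interpret prob_space "Pr x" by (rule prob_Pr[OF xE])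
    have inter: "(\<Inter>n. avoid x n) \<in> sets (Pr x)" using avoid_sets[OF xE] by auto
    have "measure (Pr x) (\<Inter>n. avoid x n) \<le> measure (Pr x) (avoid x n)" for n
      by (intro finite_measure_mono avoid_sets xE) auto
    hence "measure (Pr x) (\<Inter>n. avoid x n) \<le> avoid_lim x"
      by (intro LIMSEQ_le_const[OF avoid_tendsto[OF xE]]) auto
    moreover have "avoid_lim x = 0" by (rule avoid_lim_eq_0[OF c x])
    ultimately have "measure (Pr x) (\<Inter>n. avoid x n) = 0" by (simp add: order_antisym)
    hence "AE \<omega> in Pr x. \<omega> \<notin> (\<Inter>n. avoid x n)"
      using inter by (intro AE_not_in) (auto simp: null_sets_def emeasure_eq_measure)
    moreover have "AE \<omega> in Pr x. \<omega> \<in> space (Pr x)" by simp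
    ultimately show ?thesis
    proof eventually_elim
      case (elim \<omega>)
      then obtain n where "\<omega> \<notin> avoid x n" by blast
      with elim obtain i where "X (real i) \<omega> = root" by (auto simp: avoid_def)
      thus ?case by (intro exI[of _ "real i"]) auto
    qed
  qed
  show ?thesis unfolding harris_recurrent_def
  proof (intro exI conjI allI impI ballI)
    let ?\<psi> = "return (count_space reach) root"
    interpret \<psi>: prob_space ?\<psi> by (rule prob_space_return) (simp add: root_reach)
    show "sigma_finite_measure ?\<psi>" ..
    show "space ?\<psi> = reach" "sets ?\<psi> = Pow reach" by simp_all
    show "0 < emeasure ?\<psi> reach" using root_reach by (simp add: emeasure_return)
    fix A x assume A: "A \<subseteq> reach" "0 < emeasure ?\<psi> A" and x: "x \<in> reach"
    have "root \<in> A" using A by (cases "root \<in> A") (auto simp: emeasure_return)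
    with hit[OF x] show "AE \<omega> in Pr x. \<exists>t\<ge>0. X t \<omega> \<in> A" by auto
  qed
qed

text \<open>A Krylov--Bogolyubov argument. Uniform averages over \<open>4 ^ k\<close> grid times of
  mesh \<open>1 / 2 ^ k\<close> cover a window of length \<open>2 ^ k\<close>, so a fixed dyadic
  shift raises their point masses by \<open>O(1 / 2 ^ k)\<close> at most. A pointwise limit may lose
  mass, but it keeps at least \<open>c\<close> at the root and can be normalised. Fatou's lemma then
  yields only subinvariance, which is invariance because both sides are probability laws.\<close>

lemma invariant_pmf_exists:
  assumes s: "0 \<le> s" and c: "0 < c" "\<And>t. s \<le> t \<Longrightarrow> c \<le> p t root root"
  shows "\<exists>\<pi>. set_pmf \<pi> \<subseteq> reach \<and> (\<forall>t\<ge>0. bind_pmf \<pi> (T t) = \<pi>)"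
proof -
  define tm where "tm k j = s + real j / 2 ^ k" for k j :: nat
  have tm: "0 \<le> tm k j" "s \<le> tm k j" for k j using s by (auto simp: tm_def)
  define m where "m k = bind_pmf (pmf_of_set {..<4 ^ k}) (\<lambda>j. T (tm k j) root)" for k :: nat
  have ne: "{..<4 ^ k} \<noteq> ({} :: nat set)" for k by (auto simp: lessThan_empty_iff)
  have pmf_m: "pmf (m k) y = (\<Sum>j<4^k. p (tm k j) root y) / 4 ^ k" for k y
    unfolding m_def pmf_bind using ne[of k]
    by (subst integral_pmf_of_set) (auto simp: pmf_T[OF root tm(1)])
  have set_m: "set_pmf (m k) \<subseteq> reach" for k
  proof
    fix y assume "y \<in> set_pmf (m k)"
    then obtain j where j: "y \<in> set_pmf (T (tm k j) root)" by (auto simp: m_def)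
    hence "0 < p (tm k j) root y" by (simp add: pmf_positive flip: pmf_T[OF root tm(1)])
    moreover have "y \<in> E" using j set_T[OF root tm(1)] by auto
    ultimately show "y \<in> reach" using tm(1) by (auto simp: reach_def)
  qed
  have pmf_m_out: "pmf (m k) y = 0" if "y \<notin> reach" for k y
    using set_m[of k] that by (auto simp: pmf_eq_0_set_pmf)
  \<comment> \<open>A diagonal subsequence along the countable state space.\<close>
  obtain \<sigma> where \<sigma>: "strict_mono \<sigma>" "\<And>y. y \<in> E \<Longrightarrow> \<exists>l. (\<lambda>k. pmf (m (\<sigma> k)) y) \<longlonglongrightarrow> l"
  proof (rule function_convergent_subsequence[OF countable_E, of "\<lambda>k y. pmf (m k) y" 1])
    show "norm (pmf (m n) y) \<le> 1" for n y by (simp add: pmf_le_1)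
  qed auto
  have "\<exists>l. (\<lambda>k. pmf (m (\<sigma> k)) y) \<longlonglongrightarrow> l" for y
  proof (cases "y \<in> E")
    case False
    hence "y \<notin> reach" by (simp add: reach_def)
    thus ?thesis by (auto simp: pmf_m_out)
  qed (use \<sigma> in auto)
  then obtain \<mu> where \<mu>: "\<And>y. (\<lambda>k. pmf (m (\<sigma> k)) y) \<longlonglongrightarrow> \<mu> y" by metis
  have \<mu>_nonneg: "0 \<le> \<mu> y" for y by (rule LIMSEQ_le_const[OF \<mu>]) auto
  have \<mu>_out: "\<mu> y = 0" if "y \<notin> reach" for y
    using LIMSEQ_unique[OF \<mu>[of y], of 0] by (simp add: pmf_m_out[OF that])
  have "c \<le> pmf (m k) root" for k
  proof -
    have "(\<Sum>j<(4::nat)^k. c) \<le> (\<Sum>j<4^k. p (tm k j) root root)"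
      by (intro sum_mono c tm)
    thus ?thesis by (simp add: pmf_m field_simps)
  qed
  hence \<mu>_root: "c \<le> \<mu> root" by (intro LIMSEQ_le_const[OF \<mu>]) auto

  \<comment> \<open>Applied with \<open>f = 1\<close> to bound the total mass of the limit, and with
    the masses \<open>pmf (T t x) y\<close> for subinvariance.\<close>
  have fatou: "(\<integral>\<^sup>+x. ennreal (\<mu> x) * f x \<partial>count_space UNIV) \<le> liminf (\<lambda>k. \<integral>\<^sup>+x. f x \<partial>m (\<sigma> k))"
    if f: "\<And>x. f x < \<top>" for f
  proof -
    have "(\<integral>\<^sup>+x. ennreal (\<mu> x) * f x \<partial>count_space UNIV) =
        (\<integral>\<^sup>+x. liminf (\<lambda>k. ennreal (pmf (m (\<sigma> k)) x) * f x) \<partial>count_space UNIV)"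
    proof (intro nn_integral_cong)
      fix x
      have "(\<lambda>k. ennreal (pmf (m (\<sigma> k)) x) * f x) \<longlonglongrightarrow> ennreal (\<mu> x) * f x"
        using ennreal_tendsto_cmult[OF f[of x] tendsto_ennrealI[OF \<mu>[of x]]] by (simp add: mult.commute)
      thus "ennreal (\<mu> x) * f x = liminf (\<lambda>k. ennreal (pmf (m (\<sigma> k)) x) * f x)"
        by (metis lim_imp_Liminf sequentially_bot)
    qed
    also have "\<dots> \<le> liminf (\<lambda>k. \<integral>\<^sup>+x. ennreal (pmf (m (\<sigma> k)) x) * f x \<partial>count_space UNIV)"
      by (rule nn_integral_liminf) auto
    finally show ?thesis by (simp add: nn_integral_measure_pmf)
  qed

  define Z where "Z = (\<integral>\<^sup>+x. ennreal (\<mu> x) \<partial>count_space UNIV)"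
  have "Z \<le> 1" using fatou[of "\<lambda>_. 1"] by (simp add: Z_def measure_pmf.emeasure_space_1[simplified] Liminf_const)
  have "ennreal c \<le> ennreal (\<mu> root)" using \<mu>_root by (rule ennreal_leI)
  also have "\<dots> \<le> Z"
    using nn_integral_ge_point[of root UNIV "\<lambda>x. ennreal (\<mu> x)"] by (simp add: Z_def)
  finally have "ennreal c \<le> Z" .
  define z where "z = enn2real Z"
  have Zz: "Z = ennreal z"
    using \<open>Z \<le> 1\<close> by (simp add: z_def ennreal_enn2real_if) (metis ennreal_one_less_top linorder_not_le)
  have z: "0 < z" using \<open>ennreal c \<le> Z\<close> c unfolding Zz by (simp add: ennreal_le_iff2)
  define \<pi> where "\<pi> = embed_pmf (\<lambda>x. \<mu> x / z)"
  have pmf_\<pi>: "pmf \<pi> x = \<mu> x / z" for x unfolding \<pi>_def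
  proof (rule pmf_embed_pmf)
    show "0 \<le> \<mu> x / z" for x using \<mu>_nonneg z by simp
    have "(\<integral>\<^sup>+x. ennreal (\<mu> x / z) \<partial>count_space UNIV) = (\<integral>\<^sup>+x. ennreal (\<mu> x) * ennreal (1 / z) \<partial>count_space UNIV)"
      using \<mu>_nonneg z by (intro nn_integral_cong) (simp flip: ennreal_mult'')
    also have "\<dots> = Z * ennreal (1 / z)" unfolding Z_def by (rule nn_integral_multc) auto
    also have "\<dots> = 1" using z unfolding Zz by (simp flip: ennreal_mult'')
    finally show "(\<integral>\<^sup>+x. ennreal (\<mu> x / z) \<partial>count_space UNIV) = 1" .
  qed
  have set_\<pi>: "set_pmf \<pi> \<subseteq> reach"
  proof
    fix x assume "x \<in> set_pmf \<pi>"
    hence "\<mu> x \<noteq> 0" by (auto simp: set_pmf_iff pmf_\<pi>)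
    thus "x \<in> reach" using \<mu>_out by blast
  qed

  have dyadic: "bind_pmf \<pi> (T (real l / 2 ^ i)) = \<pi>" for l i
  proof (rule ccontr)
    define t where "t = real l / 2 ^ i"
    have t: "0 \<le> t" by (simp add: t_def)
    assume "bind_pmf \<pi> (T (real l / 2 ^ i)) \<noteq> \<pi>"
    \<comment> \<open>Two different probability laws differ in each direction at some point, so an
      inequality in one direction everywhere forces equality.\<close>
    then obtain y where "pmf \<pi> y < pmf (bind_pmf \<pi> (T t)) y"
      using pmf_neq_exists_less[of \<pi> "bind_pmf \<pi> (T t)"] by (auto simp: t_def)
    moreover have "pmf (bind_pmf \<pi> (T t)) y \<le> pmf \<pi> y"
    proof -
      have step: "pmf (bind_pmf (m k) (T t)) y \<le> pmf (m k) y + real l / 2 ^ k" if k: "i \<le> k" for k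
      proof -
        \<comment> \<open>For \<open>i \<le> k\<close> the shift by \<open>t\<close> is a shift by
          exactly \<open>L\<close> grid steps.\<close>
        define L where "L = l * 2 ^ (k - i)"
        have "(2 :: real) ^ k = 2 ^ i * 2 ^ (k - i)" using k by (simp flip: power_add)
        hence "real L / 2 ^ k = t" by (simp add: L_def t_def)
        hence shift: "tm k j + t = tm k (j + L)" for j by (simp add: tm_def add_divide_distrib)
        have eq: "bind_pmf (m k) (T t) = bind_pmf (pmf_of_set {..<4 ^ k}) (\<lambda>j. T (tm k (j + L)) root)"
          unfolding m_def bind_assoc_pmf shift[symmetric] using T_add[OF root tm(1) t] by simp
        have "pmf (bind_pmf (m k) (T t)) y = (\<Sum>j<4^k. p (tm k (j + L)) root y) / 4 ^ k"
          unfolding eq pmf_bind using ne[of k] by (subst integral_pmf_of_set) (auto simp: pmf_T[OF root tm(1)])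
        also have "\<dots> \<le> ((\<Sum>j<4^k. p (tm k j) root y) + real L) / 4 ^ k"
          using p_bounds[OF root tm(1)] by (intro divide_right_mono sum_shift_le) auto
        also have "\<dots> = pmf (m k) y + real L / 4 ^ k" by (simp add: pmf_m add_divide_distrib)
        also have "real L / 4 ^ k = t / 2 ^ k"
        proof -
          have "(4 :: real) ^ k = 2 ^ k * 2 ^ k" by (simp flip: power_mult_distrib)
          thus ?thesis unfolding \<open>real L / 2 ^ k = t\<close>[symmetric] by simp
        qed
        also have "t / 2 ^ k \<le> real l / 2 ^ k"
          using mult_left_mono[of 1 "2 ^ i" "real l"] by (intro divide_right_mono) (simp_all add: t_def divide_le_eq)
        finally show ?thesis by simp
      qed
      have "ennreal (pmf (bind_pmf \<pi> (T t)) y) = (\<integral>\<^sup>+x. ennreal (\<mu> x) * ennreal (pmf (T t x) y) * ennreal (1 / z) \<partial>count_space UNIV)"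
        unfolding ennreal_pmf_bind nn_integral_measure_pmf pmf_\<pi>
        using \<mu>_nonneg z by (intro nn_integral_cong) (simp flip: ennreal_mult'')
      also have "\<dots> = (\<integral>\<^sup>+x. ennreal (\<mu> x) * ennreal (pmf (T t x) y) \<partial>count_space UNIV) * ennreal (1 / z)"
        by (rule nn_integral_multc) auto
      also have "\<dots> \<le> ennreal (\<mu> y) * ennreal (1 / z)"
      proof (rule mult_right_mono)
        have "(\<integral>\<^sup>+x. ennreal (\<mu> x) * ennreal (pmf (T t x) y) \<partial>count_space UNIV)
            \<le> liminf (\<lambda>k. \<integral>\<^sup>+x. ennreal (pmf (T t x) y) \<partial>m (\<sigma> k))"
          by (rule fatou) simp
        also have "\<dots> = liminf (\<lambda>k. ennreal (pmf (bind_pmf (m (\<sigma> k)) (T t)) y))"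
          by (simp add: ennreal_pmf_bind)
        also have "\<dots> \<le> liminf (\<lambda>k. ennreal (pmf (m (\<sigma> k)) y + real l / 2 ^ \<sigma> k))"
        proof (rule Liminf_mono)
          show "\<forall>\<^sub>F k in sequentially. ennreal (pmf (bind_pmf (m (\<sigma> k)) (T t)) y)
              \<le> ennreal (pmf (m (\<sigma> k)) y + real l / 2 ^ \<sigma> k)"
            using eventually_ge_at_top[of i]
            by eventually_elim (rule ennreal_leI, rule step, use seq_suble[OF \<sigma>(1)] le_trans in blast)
        qed
        also have "\<dots> = ennreal (\<mu> y)"
        proof -
          have "(\<lambda>k. real l * (1 / 2) ^ k) \<longlonglongrightarrow> real l * 0"
            by (intro tendsto_mult tendsto_const LIMSEQ_realpow_zero) auto
          from LIMSEQ_subseq_LIMSEQ[OF this \<sigma>(1)]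
          have "(\<lambda>k. real l / 2 ^ \<sigma> k) \<longlonglongrightarrow> 0"
            by (simp add: o_def power_one_over)
          from tendsto_add[OF \<mu>[of y] this]
          have "(\<lambda>k. ennreal (pmf (m (\<sigma> k)) y + real l / 2 ^ \<sigma> k)) \<longlonglongrightarrow> ennreal (\<mu> y)"
            by (intro tendsto_ennrealI) simp
          thus ?thesis by (simp add: lim_imp_Liminf)
        qed
        finally show "(\<integral>\<^sup>+x. ennreal (\<mu> x) * ennreal (pmf (T t x) y) \<partial>count_space UNIV) \<le> ennreal (\<mu> y)" .
      qed simp
      also have "\<dots> = ennreal (pmf \<pi> y)" using \<mu>_nonneg z by (simp add: pmf_\<pi> flip: ennreal_mult'')
      finally show ?thesis by simp
    qed
    ultimately show False by simp
  qed

  have "bind_pmf \<pi> (T t) = \<pi>" if t: "0 \<le> t" for t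
  proof (rule pmf_eqI)
    fix y
    \<comment> \<open>Dyadic approximation of \<open>t\<close> from below; continuity of the
      transition probabilities carries the invariance over.\<close>
    define d where "d k = real (nat \<lfloor>t * 2 ^ k\<rfloor>) / 2 ^ k" for k
    have d: "t - (1 / 2) ^ k \<le> d k" "d k \<le> t" "0 \<le> d k" for k
    proof -
      have "real (nat \<lfloor>t * 2 ^ k\<rfloor>) = of_int \<lfloor>t * 2 ^ k\<rfloor>"
        using t by (intro of_nat_nat) simp
      hence "t * 2 ^ k - 1 \<le> real (nat \<lfloor>t * 2 ^ k\<rfloor>)" and *: "real (nat \<lfloor>t * 2 ^ k\<rfloor>) \<le> t * 2 ^ k" by linarith+
      hence "(t * 2 ^ k - 1) / 2 ^ k \<le> d k" unfolding d_def by (intro divide_right_mono) auto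
      moreover have "(t * 2 ^ k - 1) / 2 ^ k = t - (1 / 2) ^ k" by (simp add: diff_divide_distrib power_one_over)
      ultimately show "t - (1 / 2) ^ k \<le> d k" by simp
      have "d k \<le> t * 2 ^ k / 2 ^ k" unfolding d_def by (rule divide_right_mono[OF *]) simp
      thus "d k \<le> t" by simp
      show "0 \<le> d k" by (simp add: d_def)
    qed
    have "(\<lambda>k. t - (1 / 2) ^ k) \<longlonglongrightarrow> t - 0"
      by (intro tendsto_diff tendsto_const LIMSEQ_realpow_zero) auto
    hence d_lim: "d \<longlonglongrightarrow> t"
      by (intro tendsto_sandwich[of "\<lambda>k. t - (1 / 2) ^ k" d _ "\<lambda>_. t"]) (use d in auto)
    show "pmf (bind_pmf \<pi> (T t)) y = pmf \<pi> y"
    proof (cases "y \<in> E")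
      case y: True
      have "(\<lambda>k. expect \<pi> (\<lambda>x. pmf (T (d k) x) y)) \<longlonglongrightarrow> expect \<pi> (\<lambda>x. pmf (T t x) y)"
      proof (rule integral_dominated_convergence[where w = "\<lambda>_. 1"])
        show "AE x in \<pi>. (\<lambda>k. pmf (T (d k) x) y) \<longlonglongrightarrow> pmf (T t x) y"
          unfolding AE_measure_pmf_iff
        proof
          fix x assume "x \<in> set_pmf \<pi>"
          hence x: "x \<in> E" using set_\<pi> by (auto simp: reach_def)
          have "continuous_on {0..} (\<lambda>s. p s x y)"
            unfolding continuous_on_eq_continuous_within
            using DERIV_continuous[OF p_deriv[OF x y]] by auto
          from continuous_on_tendsto_compose[OF this d_lim] t d
          show "(\<lambda>k. pmf (T (d k) x) y) \<longlonglongrightarrow> pmf (T t x) y" by (simp add: pmf_T[OF x])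
        qed
      qed (auto simp: pmf_le_1)
      hence "(\<lambda>k. pmf (bind_pmf \<pi> (T (d k))) y) \<longlonglongrightarrow> pmf (bind_pmf \<pi> (T t)) y" by (simp add: pmf_bind)
      moreover have "bind_pmf \<pi> (T (d k)) = \<pi>" for k unfolding d_def by (rule dyadic)
      ultimately show ?thesis by (simp add: LIMSEQ_const_iff)
    next
      case False
      have "y \<notin> set_pmf (bind_pmf \<pi> (T t))" "y \<notin> set_pmf \<pi>"
        using False set_\<pi> set_T[OF _ t] by (auto simp: reach_def)
      thus ?thesis unfolding set_pmf_iff by simp
    qed
  qed
  with set_\<pi> show ?thesis by blast
qed

lemma positive_recurrent_reach:
  assumes "0 \<le> s" "0 < c" "\<And>t. s \<le> t \<Longrightarrow> c \<le> p t root root"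
  shows "positive_harris_recurrent reach Pr X"
proof -
  obtain \<pi> where \<pi>: "set_pmf \<pi> \<subseteq> reach" "\<And>t. 0 \<le> t \<Longrightarrow> bind_pmf \<pi> (T t) = \<pi>"
    using invariant_pmf_exists[OF assms] by auto
  have "pmf \<pi> y = expect \<pi> (\<lambda>x. p t x y)" if "0 \<le> t" for t y
  proof -
    have "pmf \<pi> y = pmf (bind_pmf \<pi> (T t)) y" using \<pi>(2)[OF that] by simp
    also have "\<dots> = expect \<pi> (\<lambda>x. p t x y)"
      unfolding pmf_bind by (rule integral_cong_AE)
        (use \<pi>(1) pmf_T that in \<open>auto simp: AE_measure_pmf_iff reach_def\<close>)
    finally show ?thesis .
  qed
  thus ?thesis using harris_recurrent_reach[OF assms(2,3)] \<pi>(1)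
    unfolding positive_harris_recurrent_def by blast
qed

text \<open>By \<open>p_ge_mult\<close>, a vanishing \<open>p t root y\<close> makes
  \<open>p n x y\<close> vanish for every \<open>x\<close> in \<open>reach\<close>. Invariance and
  dominated convergence then give \<open>pmf \<pi> y = 0\<close> for a \<open>y\<close> in the
  support.\<close>

lemma positive_recurrent_not_null:
  assumes "positive_harris_recurrent reach Pr X"
    and lim: "\<And>y. y \<in> E \<Longrightarrow> ((\<lambda>t. p t root y) \<longlongrightarrow> 0) at_top"
  shows False
proof -
  obtain \<pi> where \<pi>: "set_pmf \<pi> \<subseteq> reach"
      "\<And>t y. 0 \<le> t \<Longrightarrow> y \<in> reach \<Longrightarrow> pmf \<pi> y = expect \<pi> (\<lambda>x. p t x y)"
    using assms(1) unfolding positive_harris_recurrent_def by blast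
  obtain y where y: "y \<in> set_pmf \<pi>" using set_pmf_not_empty[of \<pi>] by blast
  hence yr: "y \<in> reach" and yE: "y \<in> E" using \<pi>(1) by (auto simp: reach_def)
  have lim': "(\<lambda>n. p (real n) x y) \<longlonglongrightarrow> 0" if x: "x \<in> reach" for x
  proof -
    from x obtain s where s: "0 \<le> s" "0 < p s root x" and xE: "x \<in> E" by (auto simp: reach_def)
    have "filterlim (\<lambda>n. s + real n) at_top sequentially"
      by (rule filterlim_tendsto_add_at_top[OF tendsto_const filterlim_real_sequentially])
    from filterlim_compose[OF lim[OF yE] this]
    have "(\<lambda>n. p (s + real n) root y / p s root x) \<longlonglongrightarrow> 0"
      using tendsto_divide[OF _ tendsto_const, of _ 0 _ "p s root x"] s by fastforce
    thus ?thesis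
    proof (rule tendsto_sandwich[OF _ _ tendsto_const, rotated 2])
      show "\<forall>\<^sub>F n in sequentially. p (real n) x y \<le> p (s + real n) root y / p s root x"
        using p_ge_mult[OF root xE s(1), of "real _" y] s by (auto simp: field_simps)
    qed (use xE p_bounds in auto)
  qed
  have "(\<lambda>n. expect \<pi> (\<lambda>x. p (real n) x y)) \<longlonglongrightarrow> expect \<pi> (\<lambda>_. 0)"
  proof (rule integral_dominated_convergence[where w = "\<lambda>_. 1"])
    show "AE x in \<pi>. (\<lambda>n. p (real n) x y) \<longlonglongrightarrow> 0"
      unfolding AE_measure_pmf_iff using \<pi>(1) lim' by auto
    show "AE x in \<pi>. norm (p (real n) x y) \<le> 1" for n
      unfolding AE_measure_pmf_iff using \<pi>(1) p_bounds by (auto simp: reach_def subset_iff)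
  qed auto
  hence "(\<lambda>n. pmf \<pi> y) \<longlonglongrightarrow> 0" by (simp flip: \<pi>(2)[OF _ yr])
  hence "pmf \<pi> y = 0" by (simp add: LIMSEQ_const_iff)
  thus False using y by (simp add: set_pmf_iff)
qed

lemma positive_recurrent_iff:
  fixes \<phi> :: "'a \<Rightarrow> real"
  assumes \<phi>: "\<And>y. y \<in> E \<Longrightarrow> 0 < \<phi> y \<and> \<phi> y \<le> 1" "\<And>\<eta>. 0 < \<eta> \<Longrightarrow> finite {y \<in> E. \<eta> \<le> \<phi> y}"
    and ge: "\<And>t. 0 \<le> t \<Longrightarrow> l \<le> expect (T t root) \<phi>"
    and lim: "((\<lambda>t. expect (T t root) \<phi>) \<longlongrightarrow> l) at_top"
    and l: "0 \<le> l"
  shows "positive_harris_recurrent reach Pr X \<longleftrightarrow> 0 < l"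
proof
  have \<phi>': "0 \<le> \<phi> y \<and> \<phi> y \<le> 1" if "y \<in> E" for y using \<phi>(1)[OF that] by simp
  {
    assume "0 < l"
    from return_prob_bounded_below[OF \<phi>' \<phi>(2) this ge]
    obtain c s where "0 < c" "0 \<le> s" "\<And>t. s \<le> t \<Longrightarrow> c \<le> p t root root" by blast
    thus "positive_harris_recurrent reach Pr X" by (intro positive_recurrent_reach)
  next
    assume pos: "positive_harris_recurrent reach Pr X"
    show "0 < l"
    proof (rule ccontr)
      assume "\<not> 0 < l"
      hence l: "l = 0" using l by simp
      \<comment> \<open>Since \<open>\<phi> y > 0\<close>, the mass at \<open>y\<close> is at most
        the mean divided by \<open>\<phi> y\<close>.\<close>
      have "((\<lambda>t. p t root y) \<longlongrightarrow> 0) at_top" if y: "y \<in> E" for y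
      proof (rule tendsto_sandwich[OF _ _ tendsto_const])
        show "((\<lambda>t. expect (T t root) \<phi> / \<phi> y) \<longlongrightarrow> 0) at_top"
          using tendsto_divide[OF lim tendsto_const, of "\<phi> y"] \<phi>(1)[OF y] l by simp
        show "\<forall>\<^sub>F t in at_top. 0 \<le> p t root y"
          using eventually_ge_at_top[of 0] by eventually_elim (use p_bounds[OF root] in auto)
        show "\<forall>\<^sub>F t in at_top. p t root y \<le> expect (T t root) \<phi> / \<phi> y"
          using eventually_ge_at_top[of 0]
        proof eventually_elim
          case (elim t)
          have ae: "AE y in T t root. y \<in> E" using set_T[OF root elim] by (auto simp: AE_measure_pmf_iff)
          have "\<phi> y * p t root y = expect (T t root) (\<lambda>u. \<phi> y * indicator {y} u)"
            using elim by (simp add: measure_pmf_single pmf_T[OF root])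
          also have "\<dots> \<le> expect (T t root) \<phi>"
          proof (rule integral_mono_AE)
            show "AE u in T t root. \<phi> y * indicator {y} u \<le> \<phi> u"
              using ae by eventually_elim (use \<phi>' in \<open>auto simp: indicator_def\<close>)
            show "integrable (T t root) (\<lambda>u. \<phi> y * indicator {y} u)"
              using \<phi>'[OF y] by (intro measure_pmf.integrable_const_bound[where B = 1]) (auto simp: indicator_def)
            show "integrable (T t root) \<phi>"
              using ae \<phi>' by (intro measure_pmf.integrable_const_bound[where B = 1]) auto
          qed
          finally show ?case using \<phi>(1)[OF y] by (simp add: field_simps)
        qed
      qed
      from positive_recurrent_not_null[OF pos this] show False .
    qed
  }
qed

end

subsection \<open>Queueing networks\<close>

lemma has_sum_finite_sum:
  fixes f :: "'i \<Rightarrow> 'a \<Rightarrow> real"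
  assumes "finite I" "\<And>i. i \<in> I \<Longrightarrow> (f i has_sum s i) A"
  shows "((\<lambda>x. \<Sum>i\<in>I. f i x) has_sum (\<Sum>i\<in>I. s i)) A"
  using assms by (induction I) (auto intro: has_sum_add)

lemma pmf_has_sum_expectation:
  fixes g :: "'a \<Rightarrow> real"
  assumes "set_pmf q \<subseteq> A" "\<And>x. \<bar>g x\<bar> \<le> B"
  shows "((\<lambda>x. pmf q x * g x) has_sum expect q g) A"
proof -
  have abs: "Infinite_Set_Sum.abs_summable_on (\<lambda>x. pmf q x * g x) UNIV"
  proof (rule Infinite_Set_Sum.abs_summable_on_comparison_test)
    show "Infinite_Set_Sum.abs_summable_on (\<lambda>x. pmf q x * B) UNIV"
      by (intro abs_summable_on_cmult_left pmf_abs_summable)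
    show "norm (pmf q x * g x) \<le> norm (pmf q x * B)" for x
      using assms(2)[of x] by (simp add: abs_mult mult_left_mono)
  qed
  hence "(\<lambda>x. pmf q x * g x) summable_on UNIV"
    by (metis abs_summable_equivalent abs_summable_summable)
  from has_sum_infsum[OF this]
  have "((\<lambda>x. pmf q x * g x) has_sum expect q g) UNIV"
    by (simp add: pmf_expectation_eq_infsetsum infsetsum_infsum[OF abs])
  thus ?thesis
    by (rule has_sum_cong_neutral[THEN iffD1, rotated -1])
       (use assms(1) in \<open>auto simp: pmf_eq_0_set_pmf\<close>)
qed

lemma expectation_eq_const:
  assumes "\<And>x. x \<in> set_pmf q \<Longrightarrow> g x = (c :: real)"
  shows "expect q g = c"
proof -
  have "expect q g = expect q (\<lambda>_. c)"
    by (rule integral_cong_AE) (use assms in \<open>auto simp: AE_measure_pmf_iff\<close>)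
  thus ?thesis by simp
qed

lemma sum_fun_upd:
  fixes f :: "'k::finite \<Rightarrow> nat" and w :: "'k \<Rightarrow> real"
  shows "(\<Sum>j\<in>UNIV. real ((f(l := m)) j) * w j) = (\<Sum>j\<in>UNIV. real (f j) * w j) + (real m - real (f l)) * w l"
proof -
  have "(\<Sum>j\<in>UNIV. real ((f(l := m)) j) * w j) =
      (\<Sum>j\<in>UNIV. real (f j) * w j + (if j = l then (real m - real (f l)) * w l else 0))"
    by (intro sum.cong) (auto simp: algebra_simps)
  also have "\<dots> = (\<Sum>j\<in>UNIV. real (f j) * w j) + (real m - real (f l)) * w l"
    by (subst sum.distrib) simp
  finally show ?thesis .
qed

context multiclass_network begin

section \<open>Rates and weighted job counts\<close>

abbreviation "\<beta> k \<equiv> service_rate N $ k"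
abbreviation "rt k l \<equiv> routing N $ k $ l"
abbreviation "leave k \<equiv> 1 - (\<Sum>l\<in>UNIV. rt k l)"
abbreviation "max_rate \<theta> \<equiv> (\<Sum>k\<in>UNIV. \<theta> $ k) + (\<Sum>k\<in>UNIV. \<beta> k)"

abbreviation service_mean :: "('x \<Rightarrow> real) \<Rightarrow> 'x \<Rightarrow> 'k \<Rightarrow> real" where
  "service_mean g x k \<equiv> \<beta> k * effort N x k *
     ((\<Sum>l\<in>UNIV. rt k l * expect (transfer N k l x) g) + leave k * expect (depart N k x) g)"

definition total_rate :: "real^'k \<Rightarrow> 'x \<Rightarrow> real" where
  "total_rate \<theta> x = (\<Sum>k\<in>UNIV. \<theta> $ k) + (\<Sum>k\<in>UNIV. \<beta> k * effort N x k)"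

text \<open>Used with two weights: the mean number of services still needed, as a potential for
  emptying the network, and the constant one, for the number of jobs.\<close>

definition weighted_jobs :: "('k \<Rightarrow> real) \<Rightarrow> 'x \<Rightarrow> real" where
  "weighted_jobs w x = (\<Sum>k\<in>UNIV. real (jobs N x k) * w k)"

lemma weighted_jobs_arrive:
  "x \<in> configs N \<Longrightarrow> y \<in> set_pmf (arrive N k x) \<Longrightarrow> weighted_jobs w y = weighted_jobs w x + w k"
  using arrive_jobs[of x y k] by (simp add: weighted_jobs_def sum_fun_upd del: fun_upd_apply)

lemma weighted_jobs_depart:
  assumes "x \<in> configs N" "effort N x k > 0" "y \<in> set_pmf (depart N k x)"
  shows "weighted_jobs w y = weighted_jobs w x - w k"
  using depart_jobs[OF assms] effort_present[OF assms(1,2)]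
  by (simp add: weighted_jobs_def sum_fun_upd of_nat_diff del: fun_upd_apply)

lemma weighted_jobs_transfer:
  assumes "x \<in> configs N" "effort N x k > 0" "y \<in> set_pmf (transfer N k l x)"
  shows "weighted_jobs w y = weighted_jobs w x - w k + w l"
proof -
  define q where "q = (jobs N x)(k := jobs N x k - 1)"
  have "jobs N y = q(l := q l + 1)"
    using transfer_jobs[OF assms] by (simp add: q_def Let_def)
  hence "weighted_jobs w y = (\<Sum>j\<in>UNIV. real (q j) * w j) + w l"
    by (simp add: weighted_jobs_def sum_fun_upd del: fun_upd_apply)
  also have "(\<Sum>j\<in>UNIV. real (q j) * w j) = weighted_jobs w x - w k"
    unfolding q_def sum_fun_upd using effort_present[OF assms(1,2)]
    by (simp add: weighted_jobs_def of_nat_diff)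
  finally show ?thesis by simp
qed

lemma effort_le_1: "x \<in> configs N \<Longrightarrow> effort N x k \<le> 1"
proof -
  assume x: "x \<in> configs N"
  have "effort N x k \<le> (\<Sum>j | station N j = station N k. effort N x j)"
    using x effort_nonneg by (intro member_le_sum) auto
  thus ?thesis using effort_capacity[OF x, of "station N k"] by simp
qed

text \<open>With \<open>g\<close> constantly one this is the total rate; with the test function of
  \<open>overloaded_decay\<close> it is the gain term of the generator.\<close>

lemma event_rate_has_sum:
  assumes x: "x \<in> configs N" and g: "\<And>y. \<bar>g y\<bar> \<le> B"
  shows "((\<lambda>z. event_rate N \<theta> x z * g z) has_sum
    ((\<Sum>k\<in>UNIV. \<theta> $ k * expect (arrive N k x) g) +
     (\<Sum>k\<in>UNIV. service_mean g x k))) (configs N)"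
proof -
  have 1: "((\<lambda>z. \<theta> $ k * (pmf (arrive N k x) z * g z)) has_sum
      (\<theta> $ k * expect (arrive N k x) g)) (configs N)" for k
    by (intro has_sum_cmult_right pmf_has_sum_expectation[OF _ g]) (use arrive_jobs[OF x] in blast)
  have 2: "((\<lambda>z. \<beta> k * effort N x k *
        ((\<Sum>l\<in>UNIV. rt k l * (pmf (transfer N k l x) z * g z)) +
         leave k * (pmf (depart N k x) z * g z))) has_sum
      (service_mean g x k)) (configs N)" for k
  \<comment> \<open>At zero effort the laws \<open>transfer\<close> and \<open>depart\<close> are
    unconstrained and might leave \<open>configs\<close>; the vanishing factor removes these
    terms.\<close>
  proof (cases "effort N x k = 0")
    case False
    hence "effort N x k > 0" using effort_nonneg[OF x, of k] by simp
    hence "set_pmf (transfer N k l x) \<subseteq> configs N" "set_pmf (depart N k x) \<subseteq> configs N" for l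
      using transfer_jobs[OF x] depart_jobs[OF x] by blast+
    note hs = this[THEN pmf_has_sum_expectation[OF _ g]]
    show ?thesis
      by (intro has_sum_cmult_right has_sum_add has_sum_finite_sum finite hs)
  qed simp
  have "((\<lambda>z. (\<Sum>k\<in>UNIV. \<theta> $ k * (pmf (arrive N k x) z * g z)) +
     (\<Sum>k\<in>UNIV. \<beta> k * effort N x k *
        ((\<Sum>l\<in>UNIV. rt k l * (pmf (transfer N k l x) z * g z)) +
         leave k * (pmf (depart N k x) z * g z)))) has_sum
    ((\<Sum>k\<in>UNIV. \<theta> $ k * expect (arrive N k x) g) +
     (\<Sum>k\<in>UNIV. service_mean g x k))) (configs N)"
    by (intro has_sum_add has_sum_finite_sum finite 1 2)
  thus ?thesis
    by (simp add: event_rate_def distrib_right sum_distrib_right mult.assoc)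
qed

lemma event_rate_nonneg:
  assumes "0 \<le> \<theta>" "x \<in> configs N"
  shows "0 \<le> event_rate N \<theta> x z"
  unfolding event_rate_def using assms routing_nonneg routing_substochastic effort_nonneg service_rate_pos
  by (intro add_nonneg_nonneg sum_nonneg mult_nonneg_nonneg) (auto simp: less_eq_vec_def less_imp_le)

lemma event_rate_ge:
  assumes "0 \<le> \<theta>" "x \<in> configs N"
  shows "\<beta> k * effort N x k * (rt k l * pmf (transfer N k l x) z) \<le> event_rate N \<theta> x z"
    and "\<beta> k * effort N x k * (leave k * pmf (depart N k x) z) \<le> event_rate N \<theta> x z"
proof -
  define S where "S k = (\<Sum>l\<in>UNIV. rt k l * pmf (transfer N k l x) z)" for k
  define D where "D k = leave k * pmf (depart N k x) z" for k
  have S: "0 \<le> S k" for k unfolding S_def by (intro sum_nonneg mult_nonneg_nonneg routing_nonneg) auto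
  have D: "0 \<le> D k" for k unfolding D_def using routing_substochastic by (intro mult_nonneg_nonneg) auto
  have be: "0 \<le> \<beta> k * effort N x k" for k
    using service_rate_pos[of k] effort_nonneg[OF assms(2)] by simp
  have "\<beta> k * effort N x k * (S k + D k) \<le> (\<Sum>k\<in>UNIV. \<beta> k * effort N x k * (S k + D k))"
    using S D be by (intro member_le_sum) (auto intro!: mult_nonneg_nonneg)
  also have "\<dots> \<le> event_rate N \<theta> x z"
    unfolding event_rate_def S_def D_def using assms(1)
    by (simp add: less_eq_vec_def sum_nonneg)
  finally have *: "\<beta> k * effort N x k * (S k + D k) \<le> event_rate N \<theta> x z" .
  have "rt k l * pmf (transfer N k l x) z \<le> S k"
    unfolding S_def by (rule member_le_sum) (auto simp: routing_nonneg)
  hence "\<beta> k * effort N x k * (rt k l * pmf (transfer N k l x) z)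
      \<le> \<beta> k * effort N x k * (S k + D k)"
    using D[of k] be by (intro mult_left_mono) auto
  with * show "\<beta> k * effort N x k * (rt k l * pmf (transfer N k l x) z) \<le> event_rate N \<theta> x z"
    by simp
  have "\<beta> k * effort N x k * D k \<le> \<beta> k * effort N x k * (S k + D k)"
    using S[of k] be by (intro mult_left_mono) auto
  with * show "\<beta> k * effort N x k * (leave k * pmf (depart N k x) z) \<le> event_rate N \<theta> x z"
    unfolding D_def by simp
qed

lemma bounded_jump:
  assumes "0 \<le> \<theta>" and "queue_process N P X"
  shows "bounded_jump_process (configs N) (event_rate N \<theta>) (total_rate \<theta>)
     (max_rate \<theta>) (P \<theta>) X"
proof
  show "countable (configs N)" by (rule countable_configs)
  show "0 \<le> event_rate N \<theta> x z" if "x \<in> configs N" for x z by (rule event_rate_nonneg[OF assms(1) that])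
  fix x assume x: "x \<in> configs N"
  show "(event_rate N \<theta> x has_sum total_rate \<theta> x) (configs N)"
    using event_rate_has_sum[OF x, of "\<lambda>_. 1" 1 \<theta>] by (simp add: total_rate_def)
  show "total_rate \<theta> x \<le> max_rate \<theta>"
    unfolding total_rate_def
  proof (intro add_left_mono sum_mono)
    fix k
    show "\<beta> k * effort N x k \<le> \<beta> k"
      using effort_le_1[OF x, of k] service_rate_pos[of k] by (simp add: mult_le_cancel_left1)
  qed
next
  show "markov_jump_process (configs N) (\<lambda>x y. event_rate N \<theta> x y - (if x = y then total_rate \<theta> x else 0)) (P \<theta>) X"
    using assms unfolding queue_process_def generator_def[abs_def] total_rate_def by auto
qed

text \<open>The weights \<open>w = (I - R)\<^sup>-\<^sup>1 1\<close>: the mean number of services a class-\<open>k\<close> job still needs.\<close>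

lemma exit_weights:
  "\<exists>w :: 'k \<Rightarrow> real. (\<forall>k. 0 \<le> w k) \<and> (\<forall>k. w k = 1 + (\<Sum>l\<in>UNIV. rt k l * w l))"
proof -
  define A where "A = matrix_inv (mat 1 - routing N)"
  have "\<exists>A'. (mat 1 - routing N) ** A' = mat 1 \<and> A' ** (mat 1 - routing N) = mat 1"
    using open_network(1) by (simp add: invertible_def)
  hence inv: "(mat 1 - routing N) ** A = mat 1"
    unfolding A_def matrix_inv_def by (rule someI2_ex) auto
  define w where "w = A *v 1"
  have "(mat 1 - routing N) *v w = 1"
    unfolding w_def by (simp add: matrix_vector_mul_assoc inv)
  hence w1: "w - routing N *v w = 1" by (simp add: matrix_vector_mult_diff_rdistrib)
  have w_eq: "w $ k = 1 + (\<Sum>l\<in>UNIV. rt k l * w $ l)" for k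
  proof -
    have "(w - routing N *v w) $ k = 1" using w1 by simp
    thus ?thesis by (simp only: vector_minus_component matrix_vector_mult_def vec_lambda_beta)
  qed
  \<comment> \<open>The equation for \<open>w\<close> comes from the inverse; nonnegativity comes
    from the Neumann series, whose terms have nonnegative entries.\<close>
  have w_nonneg: "0 \<le> w $ k" for k
  proof -
    have pow: "0 \<le> mat_power (routing N) n $ k $ l" for n k l
    proof (induction n arbitrary: k l)
      case (Suc n)
      thus ?case by (auto simp: mat_power_def matrix_matrix_mult_def intro!: sum_nonneg mult_nonneg_nonneg routing_nonneg)
    qed (simp add: mat_power_def mat_def)
    have "0 \<le> A $ k $ l" for l
    proof -
      have "(\<lambda>n. (\<Sum>i<n. mat_power (routing N) i) $ k $ l) \<longlonglongrightarrow> A $ k $ l"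
        using open_network(2) unfolding sums_def A_def by (intro tendsto_vec_nth)
      thus ?thesis by (rule LIMSEQ_le_const) (auto intro!: sum_nonneg pow simp: sum_component)
    qed
    thus ?thesis by (auto simp: w_def matrix_vector_mult_def intro!: sum_nonneg)
  qed
  show ?thesis using w_nonneg w_eq by (intro exI[of _ "\<lambda>k. w $ k"] conjI allI)
qed

text \<open>The weights of \<open>exit_weights\<close> give a nonnegative potential that some event
  of positive rate lowers by at least one. If jobs of the served class can leave, a departure
  removes \<open>w k \<ge> 1\<close>; otherwise the mean of \<open>w\<close> over the successor
  classes is \<open>w k - 1\<close>, so some successor is at most that. Induction on an integer
  bound of the potential ends in the empty configuration.\<close>

lemma empty_accessible:
  assumes \<theta>: "0 \<le> \<theta>" and P: "queue_process N P X" and x: "x \<in> configs N"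
  shows "\<exists>t\<ge>0. 0 < trans_prob (P \<theta>) X t x (empty_config N)"
proof -
  interpret bounded_jump_process "configs N" "event_rate N \<theta>" "total_rate \<theta>"
     "max_rate \<theta>" "P \<theta>" X
    by (rule bounded_jump[OF \<theta> P])
  obtain w :: "'k \<Rightarrow> real" where *: "\<forall>k. 0 \<le> w k" "\<forall>k. w k = 1 + (\<Sum>l\<in>UNIV. rt k l * w l)"
    using exit_weights by (elim exE conjE)
  note w = *[rule_format]
  have W: "0 \<le> weighted_jobs w x" for x
    unfolding weighted_jobs_def using w(1) by (intro sum_nonneg) auto
  have step: "\<exists>z\<in>configs N. 0 < event_rate N \<theta> x z \<and> weighted_jobs w z \<le> weighted_jobs w x - 1"
    if x: "x \<in> configs N" "x \<noteq> empty_config N" for x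
  proof -
    obtain k where k: "effort N x k > 0" using no_standstill[OF x] by blast
    have be: "0 < \<beta> k * effort N x k" using k service_rate_pos[of k] by simp
    show ?thesis
    proof (cases "(\<Sum>l\<in>UNIV. rt k l) < 1")
      case True
      obtain z where z: "z \<in> set_pmf (depart N k x)" using set_pmf_not_empty[of "depart N k x"] by blast
      have "0 \<le> (\<Sum>l\<in>UNIV. rt k l * w l)"
        by (intro sum_nonneg mult_nonneg_nonneg routing_nonneg w(1))
      hence "1 \<le> w k" using w(2)[of k] by simp
      moreover have "0 < \<beta> k * effort N x k * (leave k * pmf (depart N k x) z)"
        using True be z by (simp add: pmf_positive)
      ultimately show ?thesis
        using event_rate_ge(2)[OF \<theta> x(1), of k z] weighted_jobs_depart[OF x(1) k z, of w] depart_jobs[OF x(1) k z]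
        by (intro bexI[of _ z]) auto
    next
      case False
      hence R: "(\<Sum>l\<in>UNIV. rt k l) = 1" using routing_substochastic[of k] by simp
      have "\<exists>l. 0 < rt k l \<and> w l \<le> w k - 1"
      proof (rule ccontr)
        assume "\<not> ?thesis"
        hence gt: "w k - 1 < w l" if "0 < rt k l" for l using that by force
        have nn: "0 \<le> rt k l * (w l - (w k - 1))" for l
          using gt[of l] routing_nonneg[of k l] by (cases "rt k l = 0") auto
        have "(\<Sum>l\<in>UNIV. rt k l * (w l - (w k - 1))) = 0"
          using w(2)[of k] R by (simp add: right_diff_distrib sum_subtractf flip: sum_distrib_right)
        hence "rt k l * (w l - (w k - 1)) = 0" for l
          using nn by (subst (asm) sum_nonneg_eq_0_iff) auto
        hence "rt k l = 0" for l using gt[of l] routing_nonneg[of k l]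
          by (metis diff_gt_0_iff_gt less_irrefl mult_eq_0_iff order_le_less)
        thus False using R by simp
      qed
      then obtain l where l: "0 < rt k l" "w l \<le> w k - 1" by blast
      obtain z where z: "z \<in> set_pmf (transfer N k l x)" using set_pmf_not_empty[of "transfer N k l x"] by blast
      have "0 < \<beta> k * effort N x k * (rt k l * pmf (transfer N k l x) z)"
        using l be z by (simp add: pmf_positive)
      thus ?thesis
        using event_rate_ge(1)[OF \<theta> x(1), of k l z] weighted_jobs_transfer[OF x(1) k z, of w] transfer_jobs[OF x(1) k z] l
        by (intro bexI[of _ z]) auto
    qed
  qed
  have "weighted_jobs w x \<le> real n \<Longrightarrow> \<exists>t\<ge>0. 0 < p t x (empty_config N)" if "x \<in> configs N" for n x
    using that
  proof (induction n arbitrary: x)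
    case 0
    have "x = empty_config N"
    proof (rule ccontr)
      assume "x \<noteq> empty_config N"
      then obtain z where "weighted_jobs w z \<le> weighted_jobs w x - 1" using step 0 by blast
      thus False using W[of z] 0 by simp
    qed
    thus ?case using p_diag_pos[OF empty_in_configs, of 0] by auto
  next
    case (Suc n)
    show ?case
    proof (cases "x = empty_config N")
      case True
      thus ?thesis using p_diag_pos[OF empty_in_configs, of 0] by auto
    next
      case False
      then obtain z where z: "z \<in> configs N" "0 < event_rate N \<theta> x z" "weighted_jobs w z \<le> weighted_jobs w x - 1"
        using step Suc.prems by blast
      then obtain t where "0 \<le> t" "0 < p t z (empty_config N)" using Suc.IH[of z] Suc.prems by auto
      thus ?thesis using rate_pos_accessible[OF Suc.prems(2) z(1) empty_in_configs z(2)] by blast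
    qed
  qed
  from this[OF x, of "nat \<lceil>weighted_jobs w x\<rceil>"] show ?thesis by (simp add: real_nat_ceiling_ge)
qed

lemma rooted_jump:
  assumes "0 \<le> \<theta>" and "queue_process N P X"
  shows "rooted_jump_process (configs N) (event_rate N \<theta>) (total_rate \<theta>)
     (max_rate \<theta>) (P \<theta>) X (empty_config N)"
  using bounded_jump[OF assms] empty_accessible[OF assms] empty_in_configs
  by (auto simp: rooted_jump_process_def rooted_jump_process_axioms_def)

text \<open>An arrival halves \<open>u\<close>, a transfer preserves it and a departure doubles it.
  Class \<open>k\<close> thus loses \<open>\<theta> $ k * u x / 2\<close> through arrivals and gains
  at most \<open>\<beta> k * u x\<close> through services, which explains the factor 2 in the load
  condition.\<close>

lemma overloaded_decay:
  assumes \<theta>: "0 \<le> \<theta>" and P: "queue_process N P X" and y: "y \<in> configs N"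
    and load: "2 * (\<Sum>k\<in>UNIV. \<beta> k) < (\<Sum>k\<in>UNIV. \<theta> $ k)"
  shows "((\<lambda>t. trans_prob (P \<theta>) X t (empty_config N) y) \<longlongrightarrow> 0) at_top"
proof -
  interpret bounded_jump_process "configs N" "event_rate N \<theta>" "total_rate \<theta>"
     "max_rate \<theta>" "P \<theta>" X
    by (rule bounded_jump[OF \<theta> P])
  define u where "u x = (1/2 :: real) powr weighted_jobs (\<lambda>_. 1) x" for x
  define c where "c = (\<Sum>k\<in>UNIV. \<theta> $ k) / 2 - (\<Sum>k\<in>UNIV. \<beta> k)"
  have c: "0 < c" using load by (simp add: c_def)
  have W: "0 \<le> weighted_jobs (\<lambda>_. 1) x" for x unfolding weighted_jobs_def by (intro sum_nonneg) auto
  have u: "0 < u x" "u x \<le> 1" for x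
    using W[of x] powr_mono'[of 0 "weighted_jobs (\<lambda>_. 1) x" "1/2"] by (auto simp: u_def)
  have decay: "(\<Sum>\<^sub>\<infinity>w\<in>configs N. event_rate N \<theta> x w * u w) - total_rate \<theta> x * u x \<le> - c * u x"
    if x: "x \<in> configs N" for x
  proof -
    have arr: "expect (arrive N k x) u = u x / 2" for k
      by (rule expectation_eq_const)
         (simp add: u_def weighted_jobs_arrive[OF x] powr_add)
    have tra: "expect (transfer N k l x) u = u x" if "effort N x k > 0" for k l
      by (rule expectation_eq_const) (simp add: u_def weighted_jobs_transfer[OF x that])
    have dep: "expect (depart N k x) u = 2 * u x" if "effort N x k > 0" for k
      by (rule expectation_eq_const) (simp add: u_def weighted_jobs_depart[OF x that] powr_diff)
    have "(\<Sum>\<^sub>\<infinity>w\<in>configs N. event_rate N \<theta> x w * u w) =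
      (\<Sum>k\<in>UNIV. \<theta> $ k * expect (arrive N k x) u) +
       (\<Sum>k\<in>UNIV. service_mean u x k)"
      by (rule infsumI, rule event_rate_has_sum[OF x, of u 1]) (use u in \<open>simp add: less_imp_le\<close>)
    also have "(\<Sum>k\<in>UNIV. \<theta> $ k * expect (arrive N k x) u) = (\<Sum>k\<in>UNIV. \<theta> $ k) * (u x / 2)"
      unfolding arr by (simp only: sum_distrib_right)
    also have "(\<Sum>k\<in>UNIV. service_mean u x k) \<le>
       (\<Sum>k\<in>UNIV. \<beta> k * effort N x k * u x + \<beta> k * u x)"
    proof (rule sum_mono)
      fix k
      define R where "R = (\<Sum>l\<in>UNIV. rt k l)"
      have R: "0 \<le> R" unfolding R_def by (intro sum_nonneg routing_nonneg)
      show "service_mean u x k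
        \<le> \<beta> k * effort N x k * u x + \<beta> k * u x"
      proof (cases "effort N x k = 0")
        case True
        thus ?thesis using service_rate_pos[of k] u(1)[of x] by simp
      next
        case False
        hence e: "effort N x k > 0" using effort_nonneg[OF x, of k] by simp
        \<comment> \<open>The first summand is cancelled by the loss term \<open>total_rate\<close>;
          the second is the excess due to departures.\<close>
        have "\<beta> k * effort N x k * (R * u x + (1 - R) * (2 * u x)) =
          \<beta> k * effort N x k * u x + \<beta> k * u x * (effort N x k * (1 - R))"
          by (simp add: algebra_simps)
        also have "\<beta> k * u x * (effort N x k * (1 - R)) \<le> \<beta> k * u x * 1"
        proof (rule mult_left_mono)
          have "effort N x k * (1 - R) \<le> effort N x k * 1" using e R by (intro mult_left_mono) auto
          thus "effort N x k * (1 - R) \<le> 1" using effort_le_1[OF x, of k] by simp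
          show "0 \<le> \<beta> k * u x" using service_rate_pos[of k] u(1)[of x] by simp
        qed
        finally show ?thesis
          by (simp add: tra[OF e] dep[OF e] R_def flip: sum_distrib_right)
      qed
    qed
    also have "\<dots> = (\<Sum>k\<in>UNIV. \<beta> k * effort N x k) * u x + (\<Sum>k\<in>UNIV. \<beta> k) * u x"
      by (simp add: sum.distrib sum_distrib_right)
    finally show ?thesis by (simp add: total_rate_def c_def algebra_simps)
  qed
  have bound: "trans_prob (P \<theta>) X t (empty_config N) y \<le> exp (- c * t) * u (empty_config N) / u y" if "0 \<le> t" for t
    using p_le_exp_decay[of u 1 c, OF _ _ decay empty_in_configs y that] u(1)[of y] u
    by (simp add: field_simps less_imp_le)
  show ?thesis
  proof (rule tendsto_sandwich[OF _ _ tendsto_const])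
    show "\<forall>\<^sub>F t in at_top. 0 \<le> trans_prob (P \<theta>) X t (empty_config N) y"
      using eventually_ge_at_top[of 0] by eventually_elim (use p_bounds[OF empty_in_configs] in auto)
    show "\<forall>\<^sub>F t in at_top. trans_prob (P \<theta>) X t (empty_config N) y \<le> exp (- c * t) * u (empty_config N) / u y"
      using eventually_ge_at_top[of 0] by eventually_elim (rule bound)
    have "((\<lambda>t. exp (- c * t)) \<longlongrightarrow> 0) at_top"
      using c by (intro filterlim_compose[OF exp_at_bot] filterlim_tendsto_neg_mult_at_bot[OF tendsto_const]) (auto simp: filterlim_ident)
    thus "((\<lambda>t. exp (- c * t) * u (empty_config N) / u y) \<longlongrightarrow> 0) at_top"
      by (auto intro!: tendsto_divide_zero tendsto_mult_left_zero)
  qed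
qed

text \<open>Without arrivals the total rate at the empty configuration is zero, since no effort is
  spent there. This fixes the value of the limit function at the start of the ray.\<close>

lemma no_arrivals_stay_empty:
  assumes P: "queue_process N P X" and t: "0 \<le> t"
  shows "trans_prob (P 0) X t (empty_config N) (empty_config N) = 1"
proof -
  interpret bounded_jump_process "configs N" "event_rate N 0" "total_rate 0"
     "max_rate (0 :: real^'k)" "P 0" X
    by (rule bounded_jump[OF _ P]) simp
  have "effort N (empty_config N) k = 0" for k
    using effort_present[OF empty_in_configs, of k] effort_nonneg[OF empty_in_configs, of k]
      jobs_zero_iff[OF empty_in_configs] by force
  hence r: "event_rate N 0 (empty_config N) z = 0" "total_rate 0 (empty_config N) = 0" for z
    by (simp_all add: event_rate_def total_rate_def)
  have "exp (- 0 * t) * p 0 (empty_config N) (empty_config N) \<le> p t (empty_config N) (empty_config N)"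
    by (rule exp_lower_bound_within[OF t p_deriv[OF empty_in_configs empty_in_configs]]) (auto simp: r)
  thus ?thesis using p_bounds(2)[OF empty_in_configs t, of "empty_config N"]
    by (simp add: p_0[OF empty_in_configs])
qed

end

subsection \<open>Monotone rays\<close>

locale monotone_ray = multiclass_network N
  for N :: "('x, 'k::finite, 'i::finite) network" +
  fixes P :: "real^'k \<Rightarrow> 'x \<Rightarrow> 'w measure" and X :: "real \<Rightarrow> 'w \<Rightarrow> 'x"
    and \<phi> :: "'x \<Rightarrow> real" and v :: "real^'k"
  assumes process: "queue_process N P X"
    and direction: "0 \<le> v" "norm v = 1"
    and phi_range: "\<And>c. c \<in> configs N \<Longrightarrow> 0 < \<phi> c \<and> \<phi> c \<le> 1"
    and phi_vanishes: "vanishes_at_infinity (configs N) \<phi>"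
    and phi_empty: "\<phi> (empty_config N) = 1"
    and M1: "condition_M1 N P X \<phi> (ray v)"
    and M2: "condition_M2 N P X \<phi> (ray v)"
begin

abbreviation mean where "mean \<equiv> mean_at_ray N P X \<phi> v"
abbreviation mlim where "mlim \<equiv> mean_limit_ray N P X \<phi> v"
abbreviation stable where "stable r \<equiv> r *\<^sub>R v \<in> stable_region N P X (ray v)"
abbreviation rstar where "rstar \<equiv> r_star N P X v"

section \<open>Order along the ray, means at fixed times and stability\<close>

lemma scale_nonneg: "0 \<le> r \<Longrightarrow> 0 \<le> r *\<^sub>R v"
  using direction by (simp add: less_eq_vec_def)

lemma scale_ray: "0 \<le> r \<Longrightarrow> r *\<^sub>R v \<in> ray v"
  by (auto simp: ray_def)

lemma scale_mono: "r \<le> r' \<Longrightarrow> r *\<^sub>R v \<le> r' *\<^sub>R v"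
  using direction by (auto simp: less_eq_vec_def mult_right_mono)

lemma scale_strict_mono: "r < r' \<Longrightarrow> r *\<^sub>R v < r' *\<^sub>R v"
  using scale_mono[of r r'] direction(2) by (auto simp: order.strict_iff_order)

lemma sum_direction_pos: "0 < (\<Sum>k\<in>UNIV. v $ k)"
proof -
  have "v \<noteq> 0" using direction(2) by auto
  hence "\<exists>k. v $ k \<noteq> 0" by (simp add: vec_eq_iff)
  then obtain k where "0 < v $ k" using direction(1) by (auto simp: less_eq_vec_def order.strict_iff_order)
  thus ?thesis using direction(1) by (intro sum_pos2[of UNIV k]) (auto simp: less_eq_vec_def)
qed

lemma phi_finite: "0 < \<eta> \<Longrightarrow> finite {y \<in> configs N. \<eta> \<le> \<phi> y}"
  using phi_vanishes by (simp add: vanishes_at_infinity_def)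

context
  fixes r :: real assumes r: "0 \<le> r"
begin

interpretation rooted_jump_process "configs N" "event_rate N (r *\<^sub>R v)" "total_rate (r *\<^sub>R v)"
     "max_rate (r *\<^sub>R v)" "P (r *\<^sub>R v)" X "empty_config N"
  by (rule rooted_jump[OF scale_nonneg[OF r] process])

lemma mean_expectation: "0 \<le> t \<Longrightarrow> mean t r = expect (T t (empty_config N)) \<phi>"
  by (simp add: mean_at_ray_def mean_at_def expectation_T[OF empty_in_configs])

lemma AE_T: "0 \<le> t \<Longrightarrow> AE y in T t (empty_config N). y \<in> configs N"
  using set_T[OF empty_in_configs] by (auto simp: AE_measure_pmf_iff)

lemma integrable_phi:
  assumes "0 \<le> t"
  shows "integrable (T t (empty_config N)) \<phi>"
proof (rule measure_pmf.integrable_const_bound[where B = 1])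
  show "AE y in T t (empty_config N). norm (\<phi> y) \<le> 1"
    using AE_T[OF assms] by eventually_elim (use phi_range in \<open>auto simp: less_imp_le abs_of_pos\<close>)
qed simp

lemma mean_bounds:
  assumes "0 \<le> t"
  shows "0 \<le> mean t r" "mean t r \<le> 1"
proof -
  show "0 \<le> mean t r" unfolding mean_expectation[OF assms]
    by (rule integral_nonneg_AE) (use AE_T[OF assms] phi_range in \<open>auto elim!: eventually_mono intro: less_imp_le\<close>)
  have "mean t r \<le> expect (T t (empty_config N)) (\<lambda>_. 1)" unfolding mean_expectation[OF assms]
    by (rule integral_mono_AE) (use AE_T[OF assms] integrable_phi[OF assms] phi_range in \<open>auto elim!: eventually_mono\<close>)
  thus "mean t r \<le> 1" by simp
qed

lemma sampling_distr_measure: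
  assumes "0 \<le> t"
  shows "sampling_distr N P X \<phi> v t r = distr (measure_pmf (T t (empty_config N))) borel \<phi>"
proof -
  have "distr (measure_pmf (T t (empty_config N))) borel \<phi> =
      distr (P (r *\<^sub>R v) (empty_config N)) borel (\<phi> \<circ> X t)"
    unfolding measure_pmf_T[OF empty_in_configs assms]
    by (rule distr_distr) (use X_measurable_UNIV[OF empty_in_configs assms] in auto)
  thus ?thesis using r by (simp add: sampling_distr_def o_def)
qed

lemma mean_mono:
  assumes "0 \<le> s" "s \<le> t" "r \<le> r'"
  shows "mean t r' \<le> mean s r"
  using M1 assms r scale_ray[of r] scale_ray[of r'] scale_mono[of r r']
  unfolding condition_M1_def mean_at_ray_def by auto

lemma mean_tendsto: "((\<lambda>t. mean t r) \<longlongrightarrow> mlim r) at_top"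
  and mlim_le_mean: "0 \<le> t \<Longrightarrow> mlim r \<le> mean t r"
proof -
  \<comment> \<open>By (M1) the mean decreases in time, so its infimum is its limit.\<close>
  define l where "l = (INF t\<in>{0..}. mean t r)"
  have bdd: "bdd_below ((\<lambda>t. mean t r) ` {0..})"
    using mean_bounds by (auto intro!: bdd_belowI[of _ 0])
  have le: "l \<le> mean t r" if "0 \<le> t" for t
    unfolding l_def using that by (intro cINF_lower bdd) auto
  have lim: "((\<lambda>t. mean t r) \<longlongrightarrow> l) at_top"
  proof (rule decreasing_tendsto)
    show "\<forall>\<^sub>F t in at_top. l \<le> mean t r"
      using eventually_ge_at_top[of 0] by eventually_elim (rule le)
    fix y assume "l < y"
    then obtain s where s: "0 \<le> s" "mean s r < y"
      unfolding l_def using cINF_less_iff[OF _ bdd, of y] by auto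
    show "\<forall>\<^sub>F t in at_top. mean t r < y"
      using eventually_ge_at_top[of s]
      by eventually_elim (use s mean_mono[of s _ r] in force)
  qed
  have "mlim r = l"
    unfolding mean_limit_ray_def mean_limit_def
    using lim[unfolded mean_at_ray_def] by (intro tendsto_Lim) auto
  with lim le show "((\<lambda>t. mean t r) \<longlongrightarrow> mlim r) at_top" "0 \<le> t \<Longrightarrow> mlim r \<le> mean t r" by simp_all
qed

lemma mlim_nonneg: "0 \<le> mlim r"
  by (rule tendsto_lowerbound[OF mean_tendsto])
     (auto intro: eventually_mono[OF eventually_ge_at_top[of 0]] mean_bounds)

lemma expectation_tendsto: "((\<lambda>t. expect (T t (empty_config N)) \<phi>) \<longlongrightarrow> mlim r) at_top"
  by (rule Lim_transform_eventually[OF mean_tendsto])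
     (auto intro!: eventually_mono[OF eventually_ge_at_top[of 0]] mean_expectation)

text \<open>All later uses of stability go through this equivalence, which turns statements about
  recurrence into statements about a real function.\<close>

lemma stable_iff: "stable r \<longleftrightarrow> 0 < mlim r"
proof -
  have "accessible N P X (r *\<^sub>R v) = reach" by (simp add: accessible_def reach_def)
  thus ?thesis
    using positive_recurrent_iff[OF phi_range phi_finite _ expectation_tendsto mlim_nonneg]
      mlim_le_mean mean_expectation scale_ray[OF r]
    by (simp add: stable_region_def)
qed

lemma mlim_overloaded:
  assumes "2 * (\<Sum>k\<in>UNIV. \<beta> k) < r * (\<Sum>k\<in>UNIV. v $ k)"
  shows "mlim r = 0"
proof -
  have "2 * (\<Sum>k\<in>UNIV. \<beta> k) < (\<Sum>k\<in>UNIV. (r *\<^sub>R v) $ k)"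
    using assms by (simp add: sum_distrib_left)
  note decay = overloaded_decay[OF scale_nonneg[OF r] process _ this]
  have "((\<lambda>t. expect (T t (empty_config N)) \<phi>) \<longlongrightarrow> 0) at_top"
    by (rule expectation_tendsto_0[OF empty_in_configs _ phi_finite decay])
       (use phi_range in \<open>auto intro: less_imp_le\<close>)
  with expectation_tendsto show ?thesis
    by (intro tendsto_unique[OF trivial_limit_at_top_linorder])
qed

end

section \<open>Shape of the limit function\<close>

lemma mlim_0: "mlim 0 = 1"
proof -
  interpret rooted_jump_process "configs N" "event_rate N 0" "total_rate 0"
     "max_rate (0 :: real^'k)" "P 0" X "empty_config N"
    by (rule rooted_jump[OF _ process]) simp
  have "mean t 0 = 1" if t: "0 \<le> t" for t
  proof -
    have "pmf (T t (empty_config N)) (empty_config N) = 1"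
      by (simp add: pmf_T[OF empty_in_configs t] no_arrivals_stay_empty[OF process t])
    hence "AE y in T t (empty_config N). y \<in> {empty_config N}"
      by (intro measure_pmf.AE_prob_1) (simp add: measure_pmf_single)
    hence "expect (T t (empty_config N)) \<phi> = expect (T t (empty_config N)) (\<lambda>_. 1)"
      by (intro integral_cong_AE) (auto simp: phi_empty elim!: eventually_mono)
    thus ?thesis
      by (simp add: mean_at_ray_def mean_at_def expectation_T[OF empty_in_configs t])
  qed
  hence "((\<lambda>t. mean t 0) \<longlongrightarrow> 1) at_top"
    by (intro tendsto_eventually eventually_mono[OF eventually_ge_at_top[of 0]]) auto
  with mean_tendsto[of 0] show ?thesis by (intro tendsto_unique[OF trivial_limit_at_top_linorder]) auto
qed

lemma mlim_antimono: "0 \<le> r \<Longrightarrow> r \<le> r' \<Longrightarrow> mlim r' \<le> mlim r"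
  by (rule tendsto_le[OF trivial_limit_at_top_linorder mean_tendsto mean_tendsto])
     (auto intro!: eventually_mono[OF eventually_ge_at_top[of 0]] mean_mono)

text \<open>(M2) gives strictness on the stable part only; positivity at the larger argument places
  both arguments there.\<close>

lemma mlim_strict: "0 \<le> r \<Longrightarrow> r < r' \<Longrightarrow> 0 < mlim r' \<Longrightarrow> mlim r' < mlim r"
proof -
  assume r: "0 \<le> r" "r < r'" "0 < mlim r'"
  have "0 < mlim r" using mlim_antimono[of r r'] r by simp
  hence "stable r" "stable r'" using r by (simp_all add: stable_iff)
  thus ?thesis using M2 scale_strict_mono[OF r(2)]
    unfolding condition_M2_def mean_limit_ray_def by blast
qed

lemma mlim_continuous: "continuous_on {0..} mlim"
proof -
  have "continuous_on (ray v) (mean_limit N P X \<phi>)" using M2 by (simp add: condition_M2_def)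
  thus ?thesis unfolding mean_limit_ray_def[abs_def]
    by (rule continuous_on_compose2) (auto intro!: continuous_intros scale_ray)
qed

lemma mlim_attains:
  assumes "0 < y" "y < 1"
  obtains r where "0 < r" "mlim r = y"
proof -
  \<comment> \<open>At \<open>R\<close> the total arrival rate exceeds the overload threshold, twice
    the sum of the service rates, by one; the intermediate value theorem applies on
    \<open>{0..R}\<close>.\<close>
  define R where "R = (2 * (\<Sum>k\<in>UNIV. \<beta> k) + 1) / (\<Sum>k\<in>UNIV. v $ k)"
  have R: "0 \<le> R" unfolding R_def using sum_direction_pos service_rate_pos
    by (intro divide_nonneg_pos add_nonneg_nonneg mult_nonneg_nonneg sum_nonneg) (auto intro: less_imp_le)
  have "mlim R = 0"
    by (rule mlim_overloaded[OF R]) (use sum_direction_pos in \<open>simp add: R_def\<close>)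
  then obtain r where "0 \<le> r" "mlim r = y"
    using IVT2'[of mlim R y 0] assms mlim_0 R continuous_on_subset[OF mlim_continuous, of "{0..R}"] by auto
  have "r \<noteq> 0" using assms mlim_0 \<open>mlim r = y\<close> by auto
  with \<open>0 \<le> r\<close> have "0 < r" by simp
  thus ?thesis using \<open>mlim r = y\<close> by (rule that)
qed

lemma stable_bounded: "bdd_above {r. 0 \<le> r \<and> stable r}"
proof -
  define R where "R = (2 * (\<Sum>k\<in>UNIV. \<beta> k) + 1) / (\<Sum>k\<in>UNIV. v $ k)"
  have "r \<le> R" if "0 \<le> r" "stable r" for r
  proof (rule ccontr)
    assume "\<not> r \<le> R"
    hence "2 * (\<Sum>k\<in>UNIV. \<beta> k) + 1 < r * (\<Sum>k\<in>UNIV. v $ k)"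
      using sum_direction_pos by (simp add: R_def pos_divide_less_eq not_le)
    hence "mlim r = 0" using that(1) by (intro mlim_overloaded) auto
    thus False using that stable_iff by simp
  qed
  thus ?thesis unfolding bdd_above_def by blast
qed

text \<open>Stability is an open condition on the ray: half the value of the limit is attained
  further out, at a point that is still stable.\<close>

lemma less_rstar: "0 \<le> r \<Longrightarrow> 0 < mlim r \<Longrightarrow> r < rstar"
proof -
  assume r: "0 \<le> r" "0 < mlim r"
  have "mlim r \<le> 1" using mlim_antimono[of 0 r] r mlim_0 by simp
  then obtain r' where r': "0 < r'" "mlim r' = mlim r / 2" using mlim_attains[of "mlim r / 2"] r by auto
  have "r < r'" using mlim_antimono[of r' r] r r' by (intro not_le_imp_less notI) auto
  also have "r' \<le> rstar" unfolding r_star_def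
    by (rule cSup_upper) (use r r' stable_bounded in \<open>auto simp: stable_iff\<close>)
  finally show ?thesis .
qed

lemma r_root:
  assumes "0 < \<epsilon>" "\<epsilon> < 1"
  defines "\<rho> \<equiv> r_root N P X \<phi> v \<epsilon>"
  shows "0 < \<rho>" "\<rho> < rstar" "mlim \<rho> = \<epsilon>"
    and "0 \<le> r \<Longrightarrow> r < \<rho> \<Longrightarrow> \<epsilon> < mlim r"
    and "\<rho> < r \<Longrightarrow> mlim r < \<epsilon>"
proof -
  obtain r0 where r0: "0 < r0" "mlim r0 = \<epsilon>" using mlim_attains assms(1,2) by blast
  have "r0 < rstar" using r0 assms by (intro less_rstar) auto
  have uniq: "r = r0" if "0 < r" "mlim r = \<epsilon>" for r
    using mlim_strict[of r r0] mlim_strict[of r0 r] r0 that assms by (cases r r0 rule: linorder_cases) auto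
  have "\<rho> = r0" unfolding \<rho>_def r_root_def
  proof (rule the_equality)
    show "r0 \<in> {0<..<rstar} \<and> mlim r0 = \<epsilon>" using r0 \<open>r0 < rstar\<close> by simp
    show "r = r0" if "r \<in> {0<..<rstar} \<and> mlim r = \<epsilon>" for r
      using that by (intro uniq) simp_all
  qed
  with r0 \<open>r0 < rstar\<close> show *: "0 < \<rho>" "\<rho> < rstar" "mlim \<rho> = \<epsilon>" by simp_all
  show "0 \<le> r \<Longrightarrow> r < \<rho> \<Longrightarrow> \<epsilon> < mlim r"
    using mlim_strict[of r \<rho>] * assms by simp
  \<comment> \<open>Strict decrease is known only where the limit is positive; where it is zero,
    \<open>0 < \<epsilon>\<close> settles the claim.\<close>
  show "mlim r < \<epsilon>" if "\<rho> < r"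
    using mlim_strict[of \<rho> r] * assms that mlim_nonneg[of r] by (cases "mlim r = 0") auto
qed

section \<open>Sampling distributions along the ray\<close>

lemma sampling_distr_neg: "y < 0 \<Longrightarrow> sampling_distr N P X \<phi> v t y = sampling_distr N P X \<phi> v t 0"
  by (simp add: sampling_distr_def)

lemma sampling_distr:
  assumes "0 \<le> t"
  shows prob_space_sampling: "prob_space (sampling_distr N P X \<phi> v t y)"
    and sets_sampling: "sets (sampling_distr N P X \<phi> v t y) = sets borel"
    and AE_sampling: "AE s in sampling_distr N P X \<phi> v t y. 0 \<le> s \<and> s \<le> 1"
    and mean_sampling: "(LINT s|sampling_distr N P X \<phi> v t y. s) = mean t (max 0 y)"
proof -
  have eq: "sampling_distr N P X \<phi> v t y = sampling_distr N P X \<phi> v t (max 0 y)"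
    using sampling_distr_neg[of y t] by (cases "y < 0") auto
  define r where "r = max 0 y"
  have r: "0 \<le> r" by (simp add: r_def)
  interpret rooted_jump_process "configs N" "event_rate N (r *\<^sub>R v)" "total_rate (r *\<^sub>R v)"
     "max_rate (r *\<^sub>R v)" "P (r *\<^sub>R v)" X "empty_config N"
    by (rule rooted_jump[OF scale_nonneg[OF r] process])
  have m: "\<phi> \<in> borel_measurable (measure_pmf (T t (empty_config N)))" by simp
  note e = eq[folded r_def] sampling_distr_measure[OF r assms]
  show "prob_space (sampling_distr N P X \<phi> v t y)"
    unfolding e by (rule measure_pmf.prob_space_distr[OF m])
  show "sets (sampling_distr N P X \<phi> v t y) = sets borel" unfolding e by simp
  show "AE s in sampling_distr N P X \<phi> v t y. 0 \<le> s \<and> s \<le> 1"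
    unfolding e using AE_T[OF r assms]
    by (subst AE_distr_iff[OF m]) (use phi_range in \<open>auto elim!: eventually_mono intro: less_imp_le\<close>)
  show "(LINT s|sampling_distr N P X \<phi> v t y. s) = mean t (max 0 y)"
    unfolding e using mean_expectation[OF r assms] by (subst integral_distr[OF m]) (auto simp: r_def)
qed

end

subsection \<open>The Robbins--Monro scheme\<close>

text \<open>Subtracting the noise sums leaves \<open>y\<close>, driven by the drift alone. While
  \<open>x\<close> is above \<open>\<rho> + \<delta>\<close>, \<open>y\<close> falls by at least
  \<open>c * a n\<close>, so divergence of the step sums forces \<open>x\<close> below that level at
  some time. From then on a step taken below the level raises \<open>y\<close> by less than
  \<open>\<delta>\<close>, and a step taken above it does not raise \<open>y\<close>; the noise sums
  stay within \<open>\<delta> / 2\<close> of their limit. This accounts for the constants 3 and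
  4.\<close>

lemma robbins_monro_upper:
  fixes x a d e :: "nat \<Rightarrow> real"
  assumes step: "\<And>n. x (Suc n) = x n + a n * d n + e n"
    and a: "\<And>n. 0 < a n" "a \<longlonglongrightarrow> 0" "filterlim (\<lambda>n. \<Sum>i<n. a i) at_top sequentially"
    and d: "\<And>n. d n \<le> 1" and e: "summable e"
    and \<delta>: "0 < \<delta>" and c: "0 < c" "\<And>n. N \<le> n \<Longrightarrow> \<rho> + \<delta> \<le> x n \<Longrightarrow> d n \<le> - c"
  shows "\<forall>\<^sub>F n in sequentially. x n \<le> \<rho> + 4 * \<delta>"
proof -
  define s where "s n = (\<Sum>i<n. e i)" for n
  define S where "S = suminf e"
  define y where "y n = x n - s n" for n
  have y_Suc: "y (Suc n) = y n + a n * d n" for n by (simp add: y_def s_def step)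
  have "s \<longlonglongrightarrow> S" unfolding s_def S_def using e by (rule summable_LIMSEQ)
  hence "\<forall>\<^sub>F n in sequentially. \<bar>s n - S\<bar> < \<delta> / 2"
    using tendstoD[of s S sequentially "\<delta> / 2"] \<delta> by (simp add: dist_real_def)
  moreover have "\<forall>\<^sub>F n in sequentially. a n < \<delta>" using a(2) \<delta> by (rule order_tendstoD)
  ultimately have "\<forall>\<^sub>F n in sequentially. \<bar>s n - S\<bar> < \<delta> / 2 \<and> a n < \<delta> \<and> N \<le> n"
    using eventually_ge_at_top[of N] by eventually_elim auto
  then obtain N1 where N1: "\<bar>s n - S\<bar> < \<delta> / 2" "a n < \<delta>" "N \<le> n" if "N1 \<le> n" for n
    unfolding eventually_sequentially by blast
  have "\<exists>n1\<ge>N1. x n1 < \<rho> + \<delta>"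
  proof (rule ccontr)
    assume "\<not> ?thesis"
    hence ge: "\<rho> + \<delta> \<le> x n" if "N1 \<le> n" for n using that by force
    have dec: "y (N1 + m) \<le> y N1 + c * (\<Sum>i<N1. a i) - c * (\<Sum>i<N1 + m. a i)" for m
    proof (induction m)
      case (Suc m)
      have "a (N1 + m) * d (N1 + m) \<le> a (N1 + m) * (- c)"
        using c(2)[of "N1 + m"] N1(3)[of "N1 + m"] ge[of "N1 + m"] a(1)[of "N1 + m"] by (intro mult_left_mono) auto
      thus ?case using Suc y_Suc[of "N1 + m"] by (simp add: algebra_simps)
    qed simp
    obtain n where n: "\<And>k. n \<le> k \<Longrightarrow> (y N1 + c * (\<Sum>i<N1. a i) - (\<rho> - S)) / c \<le> (\<Sum>i<k. a i)"
      using a(3) unfolding filterlim_at_top eventually_sequentially by blast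
    have "y N1 + c * (\<Sum>i<N1. a i) - (\<rho> - S) \<le> c * (\<Sum>i<N1+n. a i)"
      using n[of "N1 + n"] c(1) by (simp add: pos_divide_le_eq mult.commute)
    hence "y (N1 + n) \<le> \<rho> - S" using dec[of n] by linarith
    moreover have "\<rho> + \<delta> \<le> y (N1 + n) + s (N1 + n)" using ge[of "N1 + n"] by (simp add: y_def)
    ultimately show False using N1(1)[of "N1 + n"] \<delta> by simp
  qed
  then obtain n1 where n1: "N1 \<le> n1" "x n1 < \<rho> + \<delta>" by blast
  have y_le: "y n \<le> \<rho> + 3 * \<delta> - S" if "n1 \<le> n" for n
    using that
  proof (induction rule: dec_induct)
    case base
    show ?case using n1 N1(1)[of n1] \<delta> by (simp add: y_def abs_if split: if_splits)
  next
    case (step n)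
    have n: "N1 \<le> n" using step n1 by simp
    show ?case
    proof (cases "\<rho> + \<delta> \<le> x n")
      case True
      have "d n \<le> 0" using c(2)[OF N1(3)[OF n] True] c(1) by simp
      hence "a n * d n \<le> 0" using a(1)[of n] by (simp add: mult_le_0_iff)
      thus ?thesis using step y_Suc[of n] by simp
    next
      case False
      have "a n * d n \<le> a n * 1" using d a(1)[of n] by (intro mult_left_mono) auto
      moreover have "S - \<delta> / 2 < s n" using N1(1)[OF n] abs_ge_minus_self[of "s n - S"] by linarith
      ultimately show ?thesis using False N1(2)[OF n] y_Suc[of n] y_def[of n] \<delta> by linarith
    qed
  qed
  have s_less: "s n < S + \<delta> / 2" if "n1 \<le> n" for n
    using N1(1)[OF order_trans[OF n1(1) that]] abs_ge_self[of "s n - S"] by linarith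
  have "x n \<le> \<rho> + 4 * \<delta>" if "n1 \<le> n" for n
    using y_le[OF that] s_less[OF that] \<delta> y_def[of n] by linarith
  thus ?thesis unfolding eventually_sequentially by blast
qed

lemma robbins_monro_converges:
  fixes x a d e :: "nat \<Rightarrow> real"
  assumes step: "\<And>n. x (Suc n) = x n + a n * d n + e n"
    and a: "\<And>n. 0 < a n" "a \<longlonglongrightarrow> 0" "filterlim (\<lambda>n. \<Sum>i<n. a i) at_top sequentially"
    and d: "\<And>n. \<bar>d n\<bar> \<le> 1" and e: "summable e"
    and drift: "\<And>\<delta>. 0 < \<delta> \<Longrightarrow> \<exists>c>0. \<exists>N. \<forall>n\<ge>N. (\<rho> + \<delta> \<le> x n \<longrightarrow> d n \<le> - c) \<and> (x n \<le> \<rho> - \<delta> \<longrightarrow> c \<le> d n)"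
  shows "x \<longlonglongrightarrow> \<rho>"
proof (rule tendstoI)
  fix \<eta> :: real assume \<eta>: "0 < \<eta>"
  define \<delta> where "\<delta> = \<eta> / 5"
  have \<delta>: "0 < \<delta>" "4 * \<delta> < \<eta>" using \<eta> by (auto simp: \<delta>_def)
  obtain c N where c: "0 < c" and N: "\<And>n. N \<le> n \<Longrightarrow> \<rho> + \<delta> \<le> x n \<Longrightarrow> d n \<le> - c"
      "\<And>n. N \<le> n \<Longrightarrow> x n \<le> \<rho> - \<delta> \<Longrightarrow> c \<le> d n"
    using drift[OF \<delta>(1)] by blast
  have "\<forall>\<^sub>F n in sequentially. x n \<le> \<rho> + 4 * \<delta>"
    by (rule robbins_monro_upper[OF step a _ e \<delta>(1) c N(1)]) (use d in \<open>auto simp: abs_le_iff\<close>)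
  moreover have "\<forall>\<^sub>F n in sequentially. - x n \<le> - \<rho> + 4 * \<delta>"
  proof (rule robbins_monro_upper[OF _ a _ summable_minus[OF e] \<delta>(1) c])
    show "- x (Suc n) = - x n + a n * (- d n) + - e n" for n by (simp add: step)
    show "- d n \<le> 1" for n using d[of n] by (simp add: abs_le_iff)
    show "- d n \<le> - c" if "N \<le> n" "- \<rho> + \<delta> \<le> - x n" for n using N(2)[of n] that by simp
  qed
  ultimately show "\<forall>\<^sub>F n in sequentially. dist (x n) \<rho> < \<eta>"
    by eventually_elim (use \<delta> in \<open>auto simp: dist_real_def abs_less_iff\<close>)
qed

text \<open>
  The increments are switched off once \<open>|\<Sum>D|\<close> has exceeded \<open>\<lambda>\<close>. The stopped sum \<open>T\<close> has orthogonal
  increments and exceeds \<open>\<lambda>\<close> as soon as some partial sum does, so Chebyshev's inequality for \<open>T\<close>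
  is a maximal inequality.
\<close>

lemma orthogonal_maximal_inequality:
  fixes D :: "nat \<Rightarrow> 'a \<Rightarrow> real"
  assumes M: "prob_space M" and F: "\<And>n. subalgebra M (F n)"
    and meas: "\<And>i n. i < n \<Longrightarrow> D i \<in> borel_measurable (F n)"
    and bound: "\<And>n \<omega>. \<omega> \<in> space M \<Longrightarrow> \<bar>D n \<omega>\<bar> \<le> b n"
    and orth: "\<And>n h C. h \<in> borel_measurable (F n) \<Longrightarrow> (\<And>\<omega>. \<omega> \<in> space M \<Longrightarrow> \<bar>h \<omega>\<bar> \<le> C) \<Longrightarrow>
       (LINT \<omega>|M. D n \<omega> * h \<omega>) = 0"
    and l: "0 < l"
  shows "measure M {\<omega> \<in> space M. \<exists>j\<in>{k..k+m}. l < \<bar>\<Sum>i=k..<j. D i \<omega>\<bar>} \<le> (\<Sum>i=k..<k+m. (b i)\<^sup>2) / l\<^sup>2"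
proof -
  interpret prob_space M by fact
  define S where "S j \<omega> = (\<Sum>i=k..<j. D i \<omega>)" for j \<omega>
  define I where "I n \<omega> = (if \<forall>j\<in>{k..n}. \<bar>S j \<omega>\<bar> \<le> l then 1 else 0 :: real)" for n \<omega>
  define T where "T n \<omega> = (\<Sum>i=k..<n. I i \<omega> * D i \<omega>)" for n \<omega>
  have spaceF: "space (F n) = space M" for n using F[of n] by (simp add: subalgebra_def)
  have S_meas: "S j \<in> borel_measurable (F n)" if "j \<le> n" for j n
    unfolding S_def by (intro borel_measurable_sum meas) (use that in auto)
  have I_meas: "I i \<in> borel_measurable (F n)" if "i \<le> n" for i n
  proof -
    have "{\<omega> \<in> space (F n). \<forall>j\<in>{k..i}. \<bar>S j \<omega>\<bar> \<le> l} \<in> sets (F n)"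
    proof (rule sets.sets_Collect_finite_All)
      fix j assume "j \<in> {k..i}"
      hence [measurable]: "S j \<in> borel_measurable (F n)" using that by (intro S_meas) auto
      show "{\<omega> \<in> space (F n). \<bar>S j \<omega>\<bar> \<le> l} \<in> sets (F n)" by measurable
    qed auto
    thus ?thesis unfolding I_def by (intro measurable_If) auto
  qed
  have T_meas: "T n \<in> borel_measurable (F n)" for n
    unfolding T_def by (intro borel_measurable_sum borel_measurable_times I_meas meas) auto
  have to_M: "f \<in> borel_measurable M" if "f \<in> borel_measurable (F n)" for f :: "'a \<Rightarrow> real" and n
    by (rule measurable_from_subalg[OF F that])
  have I_bound: "\<bar>I n \<omega>\<bar> \<le> 1" "I n \<omega> * I n \<omega> = I n \<omega>" for n \<omega> by (auto simp: I_def)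
  have T_bound: "\<bar>T n \<omega>\<bar> \<le> (\<Sum>i=k..<n. b i)" if "\<omega> \<in> space M" for n \<omega>
  proof -
    have "\<bar>T n \<omega>\<bar> \<le> (\<Sum>i=k..<n. \<bar>I i \<omega> * D i \<omega>\<bar>)" unfolding T_def by (rule sum_abs)
    also have "\<dots> \<le> (\<Sum>i=k..<n. b i)"
    proof (rule sum_mono)
      fix i
      show "\<bar>I i \<omega> * D i \<omega>\<bar> \<le> b i"
        using bound[OF that, of i] I_def[of i \<omega>] by (auto split: if_splits)
    qed
    finally show ?thesis .
  qed
  have T_square: "(T n \<omega>)\<^sup>2 \<le> (\<Sum>i=k..<n. b i)\<^sup>2" if "\<omega> \<in> space M" for n \<omega>
    using power_mono[OF T_bound[OF that, of n], of 2] by simp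
  have second: "(LINT \<omega>|M. (T (k + m) \<omega>)\<^sup>2) \<le> (\<Sum>i=k..<k+m. (b i)\<^sup>2)" for m
  proof (induction m)
    case 0
    show ?case by (simp add: T_def)
  next
    case (Suc m)
    let ?n = "k + m"
    have D_meas: "D ?n \<in> borel_measurable M" by (rule to_M[OF meas[of ?n "Suc ?n"]]) simp
    note m [measurable] = D_meas to_M[OF T_meas[of ?n]] to_M[OF I_meas[of ?n ?n, OF order_refl]]
    have TI: "\<bar>I ?n \<omega> * T ?n \<omega>\<bar> \<le> (\<Sum>i=k..<?n. b i)" if "\<omega> \<in> space M" for \<omega>
      using T_bound[OF that, of ?n] by (auto simp: I_def)
    have D_square: "(D ?n \<omega>)\<^sup>2 \<le> (b ?n)\<^sup>2" if "\<omega> \<in> space M" for \<omega>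
      using power_mono[OF bound[OF that, of ?n], of 2] by simp
    have int1: "integrable M (\<lambda>\<omega>. (T ?n \<omega>)\<^sup>2)"
      using T_square by (intro integrable_const_bound[where B = "(\<Sum>i=k..<?n. b i)\<^sup>2"]) (auto intro!: AE_I2)
    have int2: "integrable M (\<lambda>\<omega>. D ?n \<omega> * (I ?n \<omega> * T ?n \<omega>))"
    proof (rule integrable_const_bound[where B = "b ?n * (\<Sum>i=k..<?n. b i)"])
      show "AE \<omega> in M. norm (D ?n \<omega> * (I ?n \<omega> * T ?n \<omega>)) \<le> b ?n * (\<Sum>i=k..<?n. b i)"
        using bound TI by (intro AE_I2) (force simp: abs_mult[of "D _ _"] intro: mult_mono)
    qed measurable
    have int3: "integrable M (\<lambda>\<omega>. I ?n \<omega> * (D ?n \<omega>)\<^sup>2)"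
    proof (rule integrable_const_bound[where B = "(b ?n)\<^sup>2"])
      show "AE \<omega> in M. norm (I ?n \<omega> * (D ?n \<omega>)\<^sup>2) \<le> (b ?n)\<^sup>2"
        using D_square by (intro AE_I2) (auto simp: I_def)
    qed measurable
    have "(T (k + Suc m) \<omega>)\<^sup>2 = (T ?n \<omega>)\<^sup>2 + 2 * (D ?n \<omega> * (I ?n \<omega> * T ?n \<omega>)) + I ?n \<omega> * (D ?n \<omega>)\<^sup>2" for \<omega>
      using I_bound(2)[of ?n \<omega>] by (auto simp: T_def I_def power2_eq_square algebra_simps)
    hence "(LINT \<omega>|M. (T (k + Suc m) \<omega>)\<^sup>2) =
       (LINT \<omega>|M. (T ?n \<omega>)\<^sup>2) + 2 * (LINT \<omega>|M. D ?n \<omega> * (I ?n \<omega> * T ?n \<omega>)) + (LINT \<omega>|M. I ?n \<omega> * (D ?n \<omega>)\<^sup>2)"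
      using int1 int2 int3 by simp
    \<comment> \<open>The product of \<open>I ?n\<close> and \<open>T ?n\<close> is bounded and
      measurable for \<open>F ?n\<close>, so the cross term vanishes.\<close>
    also have "(LINT \<omega>|M. D ?n \<omega> * (I ?n \<omega> * T ?n \<omega>)) = 0"
      by (rule orth[OF _ TI]) (intro borel_measurable_times I_meas T_meas order_refl)
    also have "(LINT \<omega>|M. I ?n \<omega> * (D ?n \<omega>)\<^sup>2) \<le> (LINT \<omega>|M. (b ?n)\<^sup>2)"
      using D_square by (intro integral_mono int3) (auto simp: I_def)
    finally show ?case using Suc by (simp add: prob_space)
  qed
  have dich: "(if \<forall>j\<in>{k..k+m}. \<bar>S j \<omega>\<bar> \<le> l then T (k + m) \<omega> = S (k + m) \<omega> else l < \<bar>T (k + m) \<omega>\<bar>)" for m \<omega>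
  proof (induction m)
    case 0
    show ?case using l by (simp add: S_def T_def)
  next
    case (Suc m)
    have T_Suc: "T (k + Suc m) \<omega> = T (k + m) \<omega> + I (k + m) \<omega> * D (k + m) \<omega>"
      and S_Suc: "S (k + Suc m) \<omega> = S (k + m) \<omega> + D (k + m) \<omega>" by (simp_all add: T_def S_def)
    have set: "{k..k + Suc m} = insert (k + Suc m) {k..k+m}" by auto
    show ?case
    proof (cases "\<forall>j\<in>{k..k+m}. \<bar>S j \<omega>\<bar> \<le> l")
      case True
      hence "I (k + m) \<omega> = 1" "T (k + m) \<omega> = S (k + m) \<omega>" using Suc by (simp_all add: I_def)
      hence "T (k + Suc m) \<omega> = S (k + Suc m) \<omega>" using T_Suc S_Suc by simp
      thus ?thesis using True unfolding set by auto
    next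
      case False
      hence "I (k + m) \<omega> = 0" "l < \<bar>T (k + m) \<omega>\<bar>" using Suc by (auto simp: I_def)
      thus ?thesis using False T_Suc unfolding set by auto
    qed
  qed
  let ?A = "{\<omega> \<in> space M. \<exists>j\<in>{k..k+m}. l < \<bar>S j \<omega>\<bar>}"
  have A: "?A \<in> sets M"
  proof (rule sets.sets_Collect_finite_Ex)
    fix j assume "j \<in> {k..k+m}"
    hence [measurable]: "S j \<in> borel_measurable M" using to_M[OF S_meas[of j j]] by simp
    show "{\<omega> \<in> space M. l < \<bar>S j \<omega>\<bar>} \<in> sets M" by measurable
  qed auto
  have "l\<^sup>2 * measure M ?A = (LINT \<omega>|M. l\<^sup>2 * indicator ?A \<omega>)"
    using A by simp
  also have "\<dots> \<le> (LINT \<omega>|M. (T (k + m) \<omega>)\<^sup>2)"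
  proof (rule integral_mono)
    show "integrable M (\<lambda>\<omega>. l\<^sup>2 * indicator ?A \<omega>)" using A by (intro integrable_mult_right) (simp add: integrable_indicator_iff less_top[symmetric])
    show "integrable M (\<lambda>\<omega>. (T (k + m) \<omega>)\<^sup>2)"
      using T_square to_M[OF T_meas[of "k + m"]]
      by (intro integrable_const_bound[where B = "(\<Sum>i=k..<k+m. b i)\<^sup>2"]) (auto intro!: AE_I2)
    show "l\<^sup>2 * indicator ?A \<omega> \<le> (T (k + m) \<omega>)\<^sup>2" for \<omega>
    proof (cases "\<omega> \<in> ?A")
      case True
      hence "\<not> (\<forall>j\<in>{k..k+m}. \<bar>S j \<omega>\<bar> \<le> l)" by force
      hence "l < \<bar>T (k + m) \<omega>\<bar>" using dich[of m \<omega>] by (simp split: if_splits)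
      hence "l\<^sup>2 \<le> (T (k + m) \<omega>)\<^sup>2" using l by (simp add: abs_le_square_iff[symmetric])
      thus ?thesis using True by simp
    qed simp
  qed
  also have "\<dots> \<le> (\<Sum>i=k..<k+m. (b i)\<^sup>2)" by (rule second)
  finally show ?thesis using l by (simp add: S_def pos_le_divide_eq mult.commute)
qed

text \<open>The maximal inequality bounds, uniformly in the horizon \<open>m\<close>, the chance
  that a block sum starting at \<open>k\<close> exceeds \<open>l\<close> by
  \<open>tail k / l\<^sup>2\<close>. As the tail vanishes, almost surely some \<open>k\<close> has
  all its block sums below \<open>l\<close>; the values \<open>l = 1 / (q + 1)\<close> give Cauchy's
  criterion.\<close>

lemma orthogonal_series_summable:
  fixes D :: "nat \<Rightarrow> 'a \<Rightarrow> real"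
  assumes M: "prob_space M" and F: "\<And>n. subalgebra M (F n)"
    and meas: "\<And>i n. i < n \<Longrightarrow> D i \<in> borel_measurable (F n)"
    and bound: "\<And>n \<omega>. \<omega> \<in> space M \<Longrightarrow> \<bar>D n \<omega>\<bar> \<le> b n"
    and b: "summable (\<lambda>n. (b n)\<^sup>2)"
    and orth: "\<And>n h C. h \<in> borel_measurable (F n) \<Longrightarrow> (\<And>\<omega>. \<omega> \<in> space M \<Longrightarrow> \<bar>h \<omega>\<bar> \<le> C) \<Longrightarrow>
       (LINT \<omega>|M. D n \<omega> * h \<omega>) = 0"
  shows "AE \<omega> in M. summable (\<lambda>n. D n \<omega>)"
proof -
  interpret prob_space M by fact
  define tail where "tail k = (\<Sum>i. (b (i + k))\<^sup>2)" for k
  have tail: "tail \<longlonglongrightarrow> 0"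
    unfolding tail_def using suminf_exist_split2[OF b] by simp
  define bad where "bad l k m = {\<omega> \<in> space M. \<exists>j\<in>{k..k+m}. l < \<bar>\<Sum>i=k..<j. D i \<omega>\<bar>}" for l k m
  have D_meas: "D n \<in> borel_measurable M" for n by (rule measurable_from_subalg[OF F meas[of n "Suc n"]]) simp
  have bad_sets: "bad l k m \<in> sets M" for l k m unfolding bad_def
  proof (rule sets.sets_Collect_finite_Ex)
    fix j
    have [measurable]: "(\<lambda>\<omega>. \<Sum>i=k..<j. D i \<omega>) \<in> borel_measurable M" by (intro borel_measurable_sum D_meas)
    show "{\<omega> \<in> space M. l < \<bar>\<Sum>i=k..<j. D i \<omega>\<bar>} \<in> sets M" by measurable
  qed auto
  have bad_le: "measure M (bad l k m) \<le> tail k / l\<^sup>2" if "0 < l" for l k m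
  proof -
    have "measure M (bad l k m) \<le> (\<Sum>i=k..<k+m. (b i)\<^sup>2) / l\<^sup>2" unfolding bad_def
      by (rule orthogonal_maximal_inequality[OF M F meas bound orth that])
    also have "(\<Sum>i=k..<k+m. (b i)\<^sup>2) = (\<Sum>i<m. (b (i + k))\<^sup>2)"
      using sum.shift_bounds_nat_ivl[of "\<lambda>i. (b i)\<^sup>2" 0 k m] by (simp add: lessThan_atLeast0 add.commute)
    also have "\<dots> \<le> tail k" unfolding tail_def
      by (rule sum_le_suminf) (use summable_ignore_initial_segment[OF b, of k] in auto)
    finally show ?thesis by (simp add: divide_right_mono)
  qed
  have ae: "AE \<omega> in M. \<exists>k. \<forall>j\<ge>k. \<bar>\<Sum>i=k..<j. D i \<omega>\<bar> \<le> l" if l: "0 < l" for l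
  proof -
    have Un: "measure M (\<Union>m. bad l k m) \<le> tail k / l\<^sup>2" for k
    proof (rule LIMSEQ_le_const2)
      show "(\<lambda>m. measure M (bad l k m)) \<longlonglongrightarrow> measure M (\<Union>m. bad l k m)"
      proof (rule finite_Lim_measure_incseq)
        show "incseq (bad l k)" by (rule incseq_SucI) (force simp: bad_def)
      qed (use bad_sets in auto)
    qed (use bad_le[OF l] in auto)
    have inter: "(\<Inter>k. \<Union>m. bad l k m) \<in> sets M" using bad_sets by auto
    have "measure M (\<Inter>k. \<Union>m. bad l k m) \<le> tail k / l\<^sup>2" for k
      using bad_sets by (intro order_trans[OF finite_measure_mono Un]) auto
    moreover have "(\<lambda>k. tail k / l\<^sup>2) \<longlonglongrightarrow> 0" using tail by (rule tendsto_divide_zero)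
    ultimately have "measure M (\<Inter>k. \<Union>m. bad l k m) \<le> 0" by (intro LIMSEQ_le_const) auto
    hence "measure M (\<Inter>k. \<Union>m. bad l k m) = 0" by (simp add: order_antisym)
    hence "AE \<omega> in M. \<omega> \<notin> (\<Inter>k. \<Union>m. bad l k m)"
      using inter by (intro AE_not_in) (auto simp: null_sets_def emeasure_eq_measure)
    moreover have "AE \<omega> in M. \<omega> \<in> space M" by simp
    ultimately show ?thesis
    proof eventually_elim
      case (elim \<omega>)
      then obtain k where k: "\<omega> \<notin> bad l k m" for m by auto
      have "\<bar>\<Sum>i=k..<j. D i \<omega>\<bar> \<le> l" if "k \<le> j" for j
        using k[of "j - k"] that elim(2) by (force simp: bad_def)
      thus ?case by blast
    qed
  qed
  have "AE \<omega> in M. \<forall>q::nat. \<exists>k. \<forall>j\<ge>k. \<bar>\<Sum>i=k..<j. D i \<omega>\<bar> \<le> 1 / real (Suc q)"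
    unfolding AE_all_countable by (intro allI ae) simp
  thus ?thesis
  proof eventually_elim
    case (elim \<omega>)
    show ?case unfolding summable_Cauchy
    proof (intro allI impI)
      fix \<eta> :: real assume "0 < \<eta>"
      then obtain q where q: "1 / real (Suc q) < \<eta> / 2" using nat_approx_posE[of "\<eta> / 2"] by auto
      obtain k where k: "\<And>j. k \<le> j \<Longrightarrow> \<bar>\<Sum>i=k..<j. D i \<omega>\<bar> \<le> 1 / real (Suc q)" using elim by blast
      have "norm (\<Sum>i=m..<n. D i \<omega>) < \<eta>" if "k \<le> m" for m n
      proof (cases "m \<le> n")
        case True
        have "(\<Sum>i=k..<m. D i \<omega>) + (\<Sum>i=m..<n. D i \<omega>) = (\<Sum>i=k..<n. D i \<omega>)"
          by (rule sum.atLeastLessThan_concat[OF that True])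
        thus ?thesis using k[OF that] k[of n] q True that by (simp add: abs_le_iff abs_less_iff)
      qed (use \<open>0 < \<eta>\<close> in simp)
      thus "\<exists>N. \<forall>m\<ge>N. \<forall>n. norm (\<Sum>i=m..<n. D i \<omega>) < \<eta>" by blast
    qed
  qed
qed

section \<open>Conditional means from conditional laws\<close>

lemma layer_sum_approx:
  fixes s :: real
  assumes s: "0 \<le> s" "s \<le> 1" and m: "0 < m"
  shows "\<bar>s - (\<Sum>j=1..m. indicator {real j / real m..} s) / real m\<bar> \<le> 1 / real m"
proof -
  \<comment> \<open>Counting the levels \<open>j / m\<close> up to \<open>s\<close> rounds
    \<open>s\<close> down to a multiple of \<open>1 / m\<close>.\<close>
  define q where "q = nat \<lfloor>real m * s\<rfloor>"
  have q: "real q \<le> real m * s" "real m * s < real q + 1" using s by (auto simp: q_def)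
  have "real m * s \<le> real m * 1" using s by (intro mult_left_mono) auto
  hence "q \<le> m" using q by simp
  have "indicator {real j / real m..} s = (if j \<le> q then 1 else 0 :: real)" for j
  proof -
    have "real j / real m \<le> s \<longleftrightarrow> real j \<le> real m * s" using m by (simp add: pos_divide_le_eq mult.commute)
    also have "\<dots> \<longleftrightarrow> j \<le> q" using q by linarith
    finally show ?thesis by (simp add: indicator_def)
  qed
  hence "(\<Sum>j=1..m. indicator {real j / real m..} s) = (\<Sum>j=1..m. if j \<le> q then 1 else 0 :: real)" by simp
  also have "\<dots> = (\<Sum>j\<in>{1..q}. 1 :: real)"
    using \<open>q \<le> m\<close> by (intro sum.mono_neutral_cong_right) auto
  finally have "(\<Sum>j=1..m. indicator {real j / real m..} s) = real q" by simp
  moreover have "\<bar>s - real q / real m\<bar> \<le> 1 / real m"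
  proof -
    have "real q / real m \<le> s" using q(1) m by (simp add: pos_divide_le_eq mult.commute)
    moreover have "s \<le> (real q + 1) / real m" using q(2) m by (simp add: pos_le_divide_eq mult.commute)
    ultimately show ?thesis by (simp add: abs_le_iff add_divide_distrib)
  qed
  ultimately show ?thesis by simp
qed

lemma layer_sum_expectation:
  assumes K: "prob_space K" "sets K = sets borel" and ae: "AE s in K. 0 \<le> s \<and> s \<le> (1 :: real)" and m: "0 < m"
  shows "\<bar>(LINT s|K. s) - (\<Sum>j=1..m. measure K {real j / real m..}) / real m\<bar> \<le> 1 / real m"
proof -
  interpret prob_space K by fact
  have [measurable_cong]: "sets K = sets borel" by fact
  have [simp]: "{real j / real m..} \<in> sets K" for j unfolding K(2) by simp
  have ind: "integrable K (\<lambda>s. indicator {real j / real m..} s :: real)" for j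
    by (intro integrable_const_bound[where B = 1]) (auto simp: indicator_def)
  have id: "integrable K (\<lambda>s. s)"
    by (rule integrable_const_bound[where B = 1], rule eventually_mono[OF ae]) auto
  have sp: "space K = UNIV" using sets_eq_imp_space_eq[OF K(2)] by simp
  let ?L = "\<lambda>s. (\<Sum>j=1..m. indicator {real j / real m..} s) / real m"
  have int: "integrable K ?L" by (intro Bochner_Integration.integrable_divide Bochner_Integration.integrable_sum ind)
  have L: "(LINT s|K. ?L s) = (\<Sum>j=1..m. measure K {real j / real m..}) / real m"
    using ind by (simp add: sp)
  have "(LINT s|K. s) - (\<Sum>j=1..m. measure K {real j / real m..}) / real m = (LINT s|K. s - ?L s)"
    unfolding L[symmetric] by (rule Bochner_Integration.integral_diff[symmetric, OF id int])
  moreover have "\<bar>LINT s|K. s - ?L s\<bar> \<le> (LINT s|K. \<bar>s - ?L s\<bar>)" by (rule integral_abs_bound)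
  moreover have "(LINT s|K. \<bar>s - ?L s\<bar>) \<le> (LINT s|K. 1 / real m)"
  proof (rule integral_mono_AE)
    show "AE s in K. \<bar>s - ?L s\<bar> \<le> 1 / real m"
      using ae by eventually_elim (rule layer_sum_approx, use m in auto)
  qed (use id int in auto)
  moreover have "(LINT s|K. 1 / real m) = 1 / real m" by (simp add: prob_space)
  ultimately show ?thesis by linarith
qed

text \<open>The complement of the unit interval has mass zero under every kernel, so the conditional
  probability that \<open>Z\<close> lies there vanishes, and with it the unconditional one.\<close>

lemma conditional_distr_unit_interval:
  assumes M: "prob_space M" and F: "subalgebra M F" and Z: "Z \<in> borel_measurable M"
    and cond: "has_conditional_distr M F Z \<kappa>"
    and K: "\<And>\<omega>. prob_space (\<kappa> \<omega>)" "\<And>\<omega>. sets (\<kappa> \<omega>) = sets borel" "\<And>\<omega>. AE s in \<kappa> \<omega>. 0 \<le> s \<and> s \<le> 1"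
  shows "AE \<omega> in M. 0 \<le> Z \<omega> \<and> Z \<omega> \<le> 1"
proof -
  interpret prob_space M by fact
  interpret finite_measure_subalgebra M F by unfold_locales (rule F)
  have [measurable]: "Z \<in> borel_measurable M" by fact
  define B where "B = - {0..1::real}"
  have B [measurable]: "B \<in> sets borel" by (simp add: B_def)
  have "measure (\<kappa> \<omega>) B = 0" for \<omega>
  proof -
    interpret K: prob_space "\<kappa> \<omega>" by (rule K)
    have "AE s in \<kappa> \<omega>. s \<notin> B" using K(3)[of \<omega>] by eventually_elim (simp add: B_def)
    moreover have "B \<in> sets (\<kappa> \<omega>)" using B K(2) by simp
    ultimately show ?thesis by (simp add: K.prob_eq_0)
  qed
  hence ae: "AE \<omega> in M. real_cond_exp M F (\<lambda>\<omega>. indicator B (Z \<omega>)) \<omega> = 0"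
    using bspec[OF cond[unfolded has_conditional_distr_def] B] by simp
  have int: "integrable M (\<lambda>\<omega>. indicator B (Z \<omega>) :: real)"
    by (intro integrable_const_bound[where B = 1]) (auto simp: indicator_def)
  have "(LINT \<omega>|M. indicator B (Z \<omega>) :: real) = (LINT \<omega>|M. real_cond_exp M F (\<lambda>\<omega>. indicator B (Z \<omega>)) \<omega>)"
    using real_cond_exp_int(2)[OF int] by simp
  also have "\<dots> = 0" using integral_cong_AE[OF _ _ ae] by simp
  finally have "AE \<omega> in M. indicator B (Z \<omega>) = (0 :: real)"
    using integral_nonneg_eq_0_iff_AE[OF int] by auto
  thus ?thesis by eventually_elim (auto simp: B_def indicator_def split: if_splits)
qed

text \<open>\<open>has_conditional_distr\<close> is one almost sure identity per Borel set. Finitely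
  many of them, for the sets \<open>{j / m..}\<close>, match the layer sums of \<open>Z\<close> with
  those of the kernel; each approximates its mean within \<open>1 / m\<close>. Hence the two
  integrals differ by at most \<open>2 * C / m\<close> for every \<open>m\<close>.\<close>

lemma integral_conditional_mean:
  assumes M: "prob_space M" and F: "subalgebra M F" and Z: "Z \<in> borel_measurable M"
    and cond: "has_conditional_distr M F Z \<kappa>"
    and K: "\<And>\<omega>. prob_space (\<kappa> \<omega>)" "\<And>\<omega>. sets (\<kappa> \<omega>) = sets borel" "\<And>\<omega>. AE s in \<kappa> \<omega>. 0 \<le> s \<and> s \<le> 1"
    and \<mu>: "\<And>\<omega>. (LINT s|\<kappa> \<omega>. s) = \<mu> \<omega>" "\<mu> \<in> borel_measurable M"
    and h: "h \<in> borel_measurable F" "\<And>\<omega>. \<omega> \<in> space M \<Longrightarrow> \<bar>h \<omega>\<bar> \<le> C"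
  shows "(LINT \<omega>|M. Z \<omega> * h \<omega>) = (LINT \<omega>|M. \<mu> \<omega> * h \<omega>)"
proof -
  interpret prob_space M by fact
  interpret finite_measure_subalgebra M F by unfold_locales (rule F)
  note Z_ae = conditional_distr_unit_interval[OF M F Z cond K]
  note [measurable] = Z \<mu>(2)
  have hM [measurable]: "h \<in> borel_measurable M" by (rule measurable_from_subalg[OF F h(1)])
  have \<mu>_bound: "0 \<le> \<mu> \<omega> \<and> \<mu> \<omega> \<le> 1" for \<omega>
  proof -
    interpret K: prob_space "\<kappa> \<omega>" by (rule K)
    have "(\<lambda>s. s) \<in> borel_measurable (\<kappa> \<omega>)" by (simp add: measurable_cong_sets[OF K(2) refl])
    hence int: "integrable (\<kappa> \<omega>) (\<lambda>s. s)"
      by (intro K.integrable_const_bound[where B = 1] eventually_mono[OF K(3)[of \<omega>]]) auto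
    have "(LINT s|\<kappa> \<omega>. s) \<le> (LINT s|\<kappa> \<omega>. 1)"
      by (rule integral_mono_AE[OF int]) (auto intro: eventually_mono[OF K(3)[of \<omega>]])
    moreover have "0 \<le> (LINT s|\<kappa> \<omega>. s)"
      by (rule integral_nonneg_AE) (auto intro: eventually_mono[OF K(3)[of \<omega>]])
    ultimately show ?thesis by (simp add: \<mu> K.prob_space)
  qed
  have C: "0 \<le> C" using h(2) not_empty by (metis abs_ge_zero ex_in_conv order_trans)
  have close: "\<bar>(LINT \<omega>|M. Z \<omega> * h \<omega>) - (LINT \<omega>|M. \<mu> \<omega> * h \<omega>)\<bar> \<le> 2 * C / real m" if m: "0 < m" for m
  proof -
    define G where "G j \<omega> = (indicator {real j / real m..} (Z \<omega>) :: real)" for j \<omega>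
    define H where "H j = real_cond_exp M F (G j)" for j
    have [measurable]: "G j \<in> borel_measurable M" for j unfolding G_def by measurable
    have H_meas [measurable]: "H j \<in> borel_measurable M" for j
      unfolding H_def by (rule borel_measurable_cond_exp2)
    have int_Zh: "integrable M (\<lambda>\<omega>. Z \<omega> * h \<omega>)" "integrable M (\<lambda>\<omega>. \<mu> \<omega> * h \<omega>)"
    proof -
      have "AE \<omega> in M. norm (Z \<omega> * h \<omega>) \<le> 1 * C"
        using Z_ae AE_space by eventually_elim (unfold norm_mult, rule mult_mono, use h(2) in auto)
      thus "integrable M (\<lambda>\<omega>. Z \<omega> * h \<omega>)" by (rule integrable_const_bound) measurable
      have "AE \<omega> in M. norm (\<mu> \<omega> * h \<omega>) \<le> 1 * C"
        using AE_space by eventually_elim (unfold norm_mult, rule mult_mono, use h(2) \<mu>_bound in auto)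
      thus "integrable M (\<lambda>\<omega>. \<mu> \<omega> * h \<omega>)" by (rule integrable_const_bound) measurable
    qed
    have int_hG: "integrable M (\<lambda>\<omega>. h \<omega> * G j \<omega>)" for j
    proof (rule integrable_const_bound[where B = C])
      show "AE \<omega> in M. norm (h \<omega> * G j \<omega>) \<le> C"
        using AE_space by eventually_elim (use h(2) C in \<open>auto simp: G_def indicator_def\<close>)
    qed measurable
    note ce = real_cond_exp_intg[OF int_hG h(1), folded H_def]
    have int_hH: "integrable M (\<lambda>\<omega>. h \<omega> * H j \<omega>)" for j by (rule ce(1)) measurable
    have eq: "(LINT \<omega>|M. h \<omega> * H j \<omega>) = (LINT \<omega>|M. h \<omega> * G j \<omega>)" for j by (rule ce(2)) measurable
    define A where "A \<omega> = (\<Sum>j=1..m. h \<omega> * G j \<omega>) / real m" for \<omega>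
    define B where "B \<omega> = (\<Sum>j=1..m. h \<omega> * H j \<omega>) / real m" for \<omega>
    have intA: "integrable M A" and intB: "integrable M B"
      unfolding A_def B_def by (intro Bochner_Integration.integrable_divide Bochner_Integration.integrable_sum int_hG int_hH)+
    have AB: "(LINT \<omega>|M. A \<omega>) = (LINT \<omega>|M. B \<omega>)"
      unfolding A_def B_def using int_hG int_hH by (simp add: eq)
    have 1: "\<bar>LINT \<omega>|M. Z \<omega> * h \<omega> - A \<omega>\<bar> \<le> C / real m"
    proof -
      have "\<bar>LINT \<omega>|M. Z \<omega> * h \<omega> - A \<omega>\<bar> \<le> (LINT \<omega>|M. \<bar>Z \<omega> * h \<omega> - A \<omega>\<bar>)" by (rule integral_abs_bound)
      also have "\<dots> \<le> (LINT \<omega>|M. C / real m)"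
      proof (rule integral_mono_AE)
        show "AE \<omega> in M. \<bar>Z \<omega> * h \<omega> - A \<omega>\<bar> \<le> C / real m"
          using Z_ae AE_space
        proof eventually_elim
          case (elim \<omega>)
          have "Z \<omega> * h \<omega> - A \<omega> = h \<omega> * (Z \<omega> - (\<Sum>j=1..m. G j \<omega>) / real m)"
            by (simp add: A_def right_diff_distrib sum_distrib_left)
          also have "\<bar>\<dots>\<bar> \<le> C * (1 / real m)"
            unfolding abs_mult G_def using elim h(2)[of \<omega>] C m
            by (intro mult_mono layer_sum_approx) auto
          finally show ?case by simp
        qed
      qed (use int_Zh intA in auto)
      finally show ?thesis by (simp add: prob_space)
    qed
    have H_ae: "AE \<omega> in M. \<forall>j\<in>{1..m}. H j \<omega> = measure (\<kappa> \<omega>) {real j / real m..}"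
    proof (subst AE_ball_countable, simp, intro ballI)
      fix j
      show "AE \<omega> in M. H j \<omega> = measure (\<kappa> \<omega>) {real j / real m..}"
        unfolding H_def G_def using cond unfolding has_conditional_distr_def by auto
    qed
    have 2: "\<bar>LINT \<omega>|M. \<mu> \<omega> * h \<omega> - B \<omega>\<bar> \<le> C / real m"
    proof -
      have "\<bar>LINT \<omega>|M. \<mu> \<omega> * h \<omega> - B \<omega>\<bar> \<le> (LINT \<omega>|M. \<bar>\<mu> \<omega> * h \<omega> - B \<omega>\<bar>)" by (rule integral_abs_bound)
      also have "\<dots> \<le> (LINT \<omega>|M. C / real m)"
      proof (rule integral_mono_AE)
        show "AE \<omega> in M. \<bar>\<mu> \<omega> * h \<omega> - B \<omega>\<bar> \<le> C / real m"
          using H_ae AE_space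
        proof eventually_elim
          case (elim \<omega>)
          have "\<mu> \<omega> * h \<omega> - B \<omega> = h \<omega> * (\<mu> \<omega> - (\<Sum>j=1..m. H j \<omega>) / real m)"
            by (simp add: B_def right_diff_distrib sum_distrib_left)
          also have "(\<Sum>j=1..m. H j \<omega>) = (\<Sum>j=1..m. measure (\<kappa> \<omega>) {real j / real m..})"
            using elim by (intro sum.cong) auto
          also have "\<bar>h \<omega> * (\<mu> \<omega> - \<dots> / real m)\<bar> \<le> C * (1 / real m)"
            unfolding abs_mult \<mu>(1)[symmetric] using elim h(2)[of \<omega>] C m
            by (intro mult_mono layer_sum_expectation K) auto
          finally show ?case by simp
        qed
      qed (use int_Zh intB in auto)
      finally show ?thesis by (simp add: prob_space)
    qed
    have "(LINT \<omega>|M. Z \<omega> * h \<omega> - A \<omega>) = (LINT \<omega>|M. Z \<omega> * h \<omega>) - (LINT \<omega>|M. A \<omega>)"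
      "(LINT \<omega>|M. \<mu> \<omega> * h \<omega> - B \<omega>) = (LINT \<omega>|M. \<mu> \<omega> * h \<omega>) - (LINT \<omega>|M. B \<omega>)"
      using int_Zh intA intB by simp_all
    thus ?thesis using 1 2 AB by (simp add: abs_le_iff)
  qed
  have "(\<lambda>m. 2 * C / real (Suc m)) \<longlonglongrightarrow> 0"
    using tendsto_mult_right_zero[OF LIMSEQ_inverse_real_of_nat, of "2 * C"] by (simp add: divide_inverse)
  moreover have "\<bar>(LINT \<omega>|M. Z \<omega> * h \<omega>) - (LINT \<omega>|M. \<mu> \<omega> * h \<omega>)\<bar> \<le> 2 * C / real (Suc m)" for m
    by (rule close) simp
  ultimately have "\<bar>(LINT \<omega>|M. Z \<omega> * h \<omega>) - (LINT \<omega>|M. \<mu> \<omega> * h \<omega>)\<bar> \<le> 0"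
    by (intro LIMSEQ_le_const) auto
  thus ?thesis by simp
qed

text \<open>\<open>f n\<close> is the regression function of the \<open>n\<close>-th sample. The
  conditional laws enter only through the range \<open>z_unit\<close> and through
  \<open>z_mean\<close>, tested against bounded functions of the history.\<close>

locale stochastic_approximation = prob_space M
  for M :: "'a measure" +
  fixes x z :: "nat \<Rightarrow> 'a \<Rightarrow> real" and a :: "nat \<Rightarrow> real" and \<epsilon> x0 :: real
    and f :: "nat \<Rightarrow> real \<Rightarrow> real"
  assumes step_pos: "\<And>n. n \<ge> 1 \<Longrightarrow> 0 < a n"
    and eps: "0 < \<epsilon>" "\<epsilon> < 1"
    and f_meas [measurable]: "\<And>n. n \<ge> 1 \<Longrightarrow> f n \<in> borel_measurable borel"
    and f_bounds: "\<And>n y. n \<ge> 1 \<Longrightarrow> 0 \<le> f n y \<and> f n y \<le> 1"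
    and z_meas: "\<And>n. n \<ge> 1 \<Longrightarrow> z n \<in> borel_measurable M"
    and x_init: "\<And>\<omega>. \<omega> \<in> space M \<Longrightarrow> x 0 \<omega> = x0"
    and x_step: "\<And>n \<omega>. n \<ge> 1 \<Longrightarrow> \<omega> \<in> space M \<Longrightarrow> x n \<omega> = x (n - 1) \<omega> + a n * (z n \<omega> - \<epsilon>)"
    and z_unit: "\<And>n. n \<ge> 1 \<Longrightarrow> AE \<omega> in M. 0 \<le> z n \<omega> \<and> z n \<omega> \<le> 1"
    and z_mean: "\<And>n h C. n \<ge> 1 \<Longrightarrow> h \<in> borel_measurable (history M x n) \<Longrightarrow>
      (\<And>\<omega>. \<omega> \<in> space M \<Longrightarrow> \<bar>h \<omega>\<bar> \<le> C) \<Longrightarrow>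
      (LINT \<omega>|M. z n \<omega> * h \<omega>) = (LINT \<omega>|M. f n (x (n - 1) \<omega>) * h \<omega>)"

section \<open>Histories and measurability of the iterates\<close>

lemma space_history: "space (history M x n) = space M"
  by (simp add: history_def)

lemma history_component: "i < n \<Longrightarrow> x i \<in> borel_measurable (history M x n)"
proof -
  assume i: "i < n"
  have "(\<lambda>\<omega>. \<lambda>i\<in>{..<n}. x i \<omega>) \<in> measurable (history M x n) (Pi\<^sub>M {..<n} (\<lambda>_. borel))"
    unfolding history_def by (rule measurable_vimage_algebra1) (auto simp: space_PiM)
  from measurable_compose[OF this measurable_component_singleton[of i "{..<n}"]] i
  show ?thesis by simp
qed

lemma subalgebra_history:
  assumes "\<And>i. i < n \<Longrightarrow> x i \<in> borel_measurable M"
  shows "subalgebra M (history M x n)"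
proof -
  have "(\<lambda>\<omega>. \<lambda>i\<in>{..<n}. x i \<omega>) \<in> measurable M (Pi\<^sub>M {..<n} (\<lambda>_. borel))"
    by (rule measurable_restrict) (use assms in auto)
  hence "sets (history M x n) \<subseteq> sets M"
    unfolding history_def by (auto simp: sets_vimage_algebra2 space_PiM measurable_sets)
  thus ?thesis by (simp add: subalgebra_def space_history)
qed

lemma recursion_measurable:
  fixes x z :: "nat \<Rightarrow> 'a \<Rightarrow> real"
  assumes z: "\<And>n. n \<ge> 1 \<Longrightarrow> z n \<in> borel_measurable M"
    and x_init: "\<And>\<omega>. \<omega> \<in> space M \<Longrightarrow> x 0 \<omega> = (x0 :: real)"
    and x_step: "\<And>n \<omega>. n \<ge> 1 \<Longrightarrow> \<omega> \<in> space M \<Longrightarrow> x n \<omega> = x (n - 1) \<omega> + a n * (z n \<omega> - \<epsilon>)"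
  shows "x n \<in> borel_measurable M"
proof (induction n)
  case 0
  show ?case by (subst measurable_cong[of M _ "\<lambda>_. x0"]) (auto simp: x_init)
next
  case (Suc n)
  note [measurable] = Suc z[of "Suc n", simplified]
  show ?case using x_step[of "Suc n"] by (subst measurable_cong[of M _ "\<lambda>\<omega>. x n \<omega> + a (Suc n) * (z (Suc n) \<omega> - \<epsilon>)"]) auto
qed

context stochastic_approximation begin

lemma x_meas [measurable]: "x n \<in> borel_measurable M"
  by (rule recursion_measurable[OF z_meas x_init x_step])

lemma subalg: "subalgebra M (history M x n)"
  by (rule subalgebra_history) simp

text \<open>
  The samples lie in the unit interval almost surely only. Clamping gives increments that are
  bounded everywhere and still functions of the history.
\<close>

definition noise :: "nat \<Rightarrow> 'a \<Rightarrow> real" where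
  "noise i \<omega> = a (Suc i) * (max 0 (min 1 ((x (Suc i) \<omega> - x i \<omega>) / a (Suc i) + \<epsilon>)) - f (Suc i) (x i \<omega>))"

lemma sample_eq: "\<omega> \<in> space M \<Longrightarrow> (x (Suc i) \<omega> - x i \<omega>) / a (Suc i) + \<epsilon> = z (Suc i) \<omega>"
  using x_step[of "Suc i" \<omega>] step_pos[of "Suc i"] by simp

lemma noise_eq: "\<omega> \<in> space M \<Longrightarrow> noise i \<omega> = a (Suc i) * (max 0 (min 1 (z (Suc i) \<omega>)) - f (Suc i) (x i \<omega>))"
  unfolding noise_def by (simp only: sample_eq)

lemma noise_bound: "\<bar>noise i \<omega>\<bar> \<le> a (Suc i)"
proof -
  have "\<bar>max 0 (min 1 s) - y\<bar> \<le> 1" if "0 \<le> y \<and> y \<le> 1" for s y :: real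
    using that by (auto simp: max_def min_def abs_le_iff)
  thus ?thesis unfolding noise_def abs_mult using step_pos[of "Suc i"] f_bounds[of "Suc i" "x i \<omega>"]
    by (simp add: mult_le_cancel_left1)
qed

lemma noise_meas: "i < n \<Longrightarrow> noise i \<in> borel_measurable (history M x (Suc n))"
proof -
  assume i: "i < n"
  have [measurable]: "x i \<in> borel_measurable (history M x (Suc n))" "x (Suc i) \<in> borel_measurable (history M x (Suc n))"
    using i by (auto intro: history_component)
  have [measurable]: "f (Suc i) \<in> borel_measurable borel" by (rule f_meas) simp
  show ?thesis unfolding noise_def[abs_def] by measurable
qed

text \<open>\<open>history M x (Suc n)\<close> is generated by \<open>x 0\<close> to
  \<open>x n\<close>, whereas \<open>noise n\<close> is the fluctuation of the step to
  \<open>x (Suc n)\<close>. Almost surely the clamp is the identity, so \<open>z_mean\<close>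
  applies.\<close>

lemma noise_orthogonal:
  assumes h: "h \<in> borel_measurable (history M x (Suc n))" "\<And>\<omega>. \<omega> \<in> space M \<Longrightarrow> \<bar>h \<omega>\<bar> \<le> C"
  shows "(LINT \<omega>|M. noise n \<omega> * h \<omega>) = 0"
proof -
  have [measurable]: "h \<in> borel_measurable M" by (rule measurable_from_subalg[OF subalg h(1)])
  have [measurable]: "z (Suc n) \<in> borel_measurable M" by (rule z_meas) simp
  have [measurable]: "f (Suc n) \<in> borel_measurable borel" by (rule f_meas) simp
  have [measurable]: "noise n \<in> borel_measurable M"
    unfolding noise_def[abs_def] by measurable
  have z1: "AE \<omega> in M. 0 \<le> z (Suc n) \<omega> \<and> z (Suc n) \<omega> \<le> 1" by (rule z_unit) simp
  have "AE \<omega> in M. norm (z (Suc n) \<omega> * h \<omega>) \<le> 1 * C"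
    using z1 AE_space by eventually_elim (unfold norm_mult, rule mult_mono, use h(2) in auto)
  hence int1: "integrable M (\<lambda>\<omega>. z (Suc n) \<omega> * h \<omega>)" by (rule integrable_const_bound) measurable
  have "AE \<omega> in M. norm (f (Suc n) (x n \<omega>) * h \<omega>) \<le> 1 * C"
    using AE_space by eventually_elim (unfold norm_mult, rule mult_mono, use h(2) f_bounds[of "Suc n"] in auto)
  hence int2: "integrable M (\<lambda>\<omega>. f (Suc n) (x n \<omega>) * h \<omega>)" by (rule integrable_const_bound) measurable
  have "(LINT \<omega>|M. noise n \<omega> * h \<omega>) =
      (LINT \<omega>|M. a (Suc n) * (z (Suc n) \<omega> * h \<omega> - f (Suc n) (x n \<omega>) * h \<omega>))"
  proof (rule integral_cong_AE)
    show "AE \<omega> in M. noise n \<omega> * h \<omega> = a (Suc n) * (z (Suc n) \<omega> * h \<omega> - f (Suc n) (x n \<omega>) * h \<omega>)"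
      using z1 AE_space
    proof eventually_elim
      case (elim \<omega>)
      hence "max 0 (min 1 (z (Suc n) \<omega>)) = z (Suc n) \<omega>" by auto
      thus ?case using elim by (simp only: noise_eq) (simp add: algebra_simps)
    qed
  qed measurable
  also have "\<dots> = a (Suc n) * ((LINT \<omega>|M. z (Suc n) \<omega> * h \<omega>) - (LINT \<omega>|M. f (Suc n) (x n \<omega>) * h \<omega>))"
    using int1 int2 by simp
  also have "(LINT \<omega>|M. z (Suc n) \<omega> * h \<omega>) = (LINT \<omega>|M. f (Suc n) (x n \<omega>) * h \<omega>)"
    using z_mean[of "Suc n" h C] h by simp
  finally show ?thesis by simp
qed

theorem converges_AE:
  assumes lim: "a \<longlonglongrightarrow> 0" and div: "filterlim (\<lambda>n. \<Sum>i=1..n. a i) at_top sequentially"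
    and sq: "summable (\<lambda>n. (a (Suc n))\<^sup>2)"
    and drift: "\<And>\<delta>. 0 < \<delta> \<Longrightarrow> \<exists>c>0. \<exists>N. \<forall>n\<ge>N. \<forall>y. (\<rho> + \<delta> \<le> y \<longrightarrow> f n y - \<epsilon> \<le> - c) \<and> (y \<le> \<rho> - \<delta> \<longrightarrow> c \<le> f n y - \<epsilon>)"
  shows "AE \<omega> in M. (\<lambda>n. x n \<omega>) \<longlonglongrightarrow> \<rho>"
proof -
  have "AE \<omega> in M. summable (\<lambda>n. noise n \<omega>)"
    by (rule orthogonal_series_summable[OF prob_space_axioms, of "\<lambda>n. history M x (Suc n)" _ "\<lambda>n. a (Suc n)"])
       (auto intro: subalg noise_meas noise_bound sq noise_orthogonal)
  moreover have "AE \<omega> in M. \<forall>n. 0 \<le> z (Suc n) \<omega> \<and> z (Suc n) \<omega> \<le> 1"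
    unfolding AE_all_countable by (intro allI z_unit) simp
  ultimately show ?thesis using AE_space
  proof eventually_elim
    case (elim \<omega>)
    show ?case
    proof (rule robbins_monro_converges)
      show "x (Suc n) \<omega> = x n \<omega> + a (Suc n) * (f (Suc n) (x n \<omega>) - \<epsilon>) + noise n \<omega>" for n
      proof -
        have "max 0 (min 1 (z (Suc n) \<omega>)) = z (Suc n) \<omega>" using elim(2) by auto
        thus ?thesis using x_step[of "Suc n" \<omega>] elim(3) by (simp only: noise_eq) (simp add: algebra_simps)
      qed
      show "0 < a (Suc n)" for n by (rule step_pos) simp
      show "(\<lambda>n. a (Suc n)) \<longlonglongrightarrow> 0" by (rule LIMSEQ_Suc[OF lim])
      have "(\<Sum>i=1..n. a i) = (\<Sum>i<n. a (Suc i))" for n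
        by (simp add: sum.atLeast1_atMost_eq)
      with div show "filterlim (\<lambda>n. \<Sum>i<n. a (Suc i)) at_top sequentially" by simp
      show "\<bar>f (Suc n) (x n \<omega>) - \<epsilon>\<bar> \<le> 1" for n
        using f_bounds[of "Suc n" "x n \<omega>"] eps by (auto simp: abs_le_iff)
      show "summable (\<lambda>n. noise n \<omega>)" by (rule elim)
      fix \<delta> :: real assume "0 < \<delta>"
      from drift[OF this] obtain c N where "0 < c" and N:
        "\<And>n y. N \<le> n \<Longrightarrow> (\<rho> + \<delta> \<le> y \<longrightarrow> f n y - \<epsilon> \<le> - c) \<and> (y \<le> \<rho> - \<delta> \<longrightarrow> c \<le> f n y - \<epsilon>)"
        by blast
      thus "\<exists>c>0. \<exists>N. \<forall>n\<ge>N. (\<rho> + \<delta> \<le> x n \<omega> \<longrightarrow> f (Suc n) (x n \<omega>) - \<epsilon> \<le> - c) \<and>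
          (x n \<omega> \<le> \<rho> - \<delta> \<longrightarrow> c \<le> f (Suc n) (x n \<omega>) - \<epsilon>)"
        by (intro exI[of _ c] conjI exI[of _ N] allI impI) (auto dest: N[OF le_SucI])
    qed
  qed
qed

end

subsection \<open>Rate of convergence\<close>

text \<open>The weighted inequality between geometric and arithmetic mean for \<open>1 + s\<close>
  and 1.\<close>

lemma Bernoulli_powr_le:
  fixes p s :: real
  assumes "0 \<le> s" "0 \<le> p" "p \<le> 1"
  shows "(1 + s) powr p \<le> 1 + p * s"
  using Youngs_inequality_0[of p "1 - p" "1 + s" 1] assms by (simp add: algebra_simps)

text \<open>\<open>C / \<theta>\<close> is the fixed point of the affine recursion: the right side
  is a convex combination of it and the previous value.\<close>

lemma recursion_bounded:
  fixes u a :: "nat \<Rightarrow> real"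
  assumes rec: "\<And>n. n0 < n \<Longrightarrow> u n \<le> (1 - \<theta> * a n) * u (n - 1) + C * a n"
    and a: "\<And>n. n0 < n \<Longrightarrow> 0 \<le> a n \<and> \<theta> * a n \<le> 1" and \<theta>: "0 < \<theta>" and n: "n0 \<le> n"
  shows "u n \<le> max (u n0) (C / \<theta>)"
  using n
proof (induction rule: dec_induct)
  case (step n)
  define U where "U = max (u n0) (C / \<theta>)"
  have "u (Suc n) \<le> (1 - \<theta> * a (Suc n)) * u n + C * a (Suc n)" using rec[of "Suc n"] step by simp
  also have "(1 - \<theta> * a (Suc n)) * u n \<le> (1 - \<theta> * a (Suc n)) * U"
    using a[of "Suc n"] step by (intro mult_left_mono) (auto simp: U_def)
  also have "C * a (Suc n) \<le> (\<theta> * U) * a (Suc n)"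
  proof (rule mult_right_mono)
    have "C / \<theta> \<le> U" by (simp add: U_def)
    thus "C \<le> \<theta> * U" using \<theta> by (simp add: pos_divide_le_eq mult.commute)
  qed (use a[of "Suc n"] step in auto)
  finally show ?case by (simp add: U_def[symmetric] algebra_simps)
qed simp

text \<open>
  Rescaling by \<open>n\<^sup>p\<close> costs a factor \<open>1 + p/(n-1)\<close>. Since \<open>w \<le> 1\<close>, this is at most \<open>1 + (p + o(1)) a\<^sub>n / c\<close>,
  which the contraction \<open>1 - q a\<^sub>n\<close> absorbs because \<open>p < q c\<close>.
\<close>

lemma scaled_recursion_bounded:
  fixes a :: "nat \<Rightarrow> real"
  assumes w: "w \<le> 1" "0 < w" and p: "0 \<le> p" "p \<le> 1" and c: "0 < c" "p < q * c"
    and a: "\<And>n. 1 \<le> n \<Longrightarrow> a n = c * real n powr - w"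
  obtains N \<theta> where "1 \<le> N" "0 < \<theta>" "\<And>n0 n v. N \<le> n0 \<Longrightarrow> (\<And>n. 0 \<le> v n) \<Longrightarrow>
     (\<And>n. n0 < n \<Longrightarrow> v n \<le> (1 - q * a n) * v (n - 1) + C * a n * real n powr - p) \<Longrightarrow> n0 \<le> n \<Longrightarrow>
     real n powr p * v n \<le> max (real n0 powr p * v n0) (C / \<theta>)"
proof -
  \<comment> \<open>Half of the gap \<open>q - p / c\<close>; the other half absorbs the difference
    between \<open>1 / (n - 1)\<close> and \<open>1 / n\<close>.\<close>
  define \<theta> where "\<theta> = (q - p / c) / 2"
  have \<theta>: "0 < \<theta>" "q - p / c = 2 * \<theta>" using c by (auto simp: \<theta>_def pos_divide_less_eq)
  have q: "0 < q" using p c by (metis le_less_trans zero_less_mult_pos2)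
  have a_lim: "a \<longlonglongrightarrow> 0"
  proof (rule Lim_transform_eventually)
    have "(\<lambda>n. real n powr - w) \<longlonglongrightarrow> 0"
      using w by (intro tendsto_neg_powr filterlim_real_sequentially) auto
    thus "(\<lambda>n. c * real n powr - w) \<longlonglongrightarrow> 0" by (rule tendsto_mult_right_zero)
    show "\<forall>\<^sub>F n in sequentially. c * real n powr - w = a n"
      using eventually_ge_at_top[of 1] by eventually_elim (simp add: a)
  qed
  have "\<forall>\<^sub>F n in sequentially. a n < 1 / q" "\<forall>\<^sub>F n in sequentially. a n < 1 / \<theta>"
    using q \<theta> by (auto intro!: order_tendstoD(2)[OF a_lim])
  moreover have "(\<lambda>n. 1 / (real n - 1)) \<longlonglongrightarrow> 0"
    by real_asymp
  hence "\<forall>\<^sub>F n in sequentially. p * (1 / (real n - 1)) < \<theta> * c"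
    using \<theta> c by (intro order_tendstoD(2)[OF tendsto_mult_right_zero]) auto
  ultimately have "\<forall>\<^sub>F n in sequentially. a n < 1 / q \<and> a n < 1 / \<theta> \<and> p * (1 / (real n - 1)) < \<theta> * c \<and> 2 \<le> n"
    using eventually_ge_at_top[of 2] by eventually_elim auto
  then obtain N where N: "\<And>n. N \<le> n \<Longrightarrow> a n < 1 / q \<and> a n < 1 / \<theta> \<and> p * (1 / (real n - 1)) < \<theta> * c \<and> 2 \<le> n"
    unfolding eventually_sequentially by blast
  show ?thesis
  proof (rule that[of "max N 1" \<theta>])
    fix n0 n :: nat and v :: "nat \<Rightarrow> real"
    assume n0: "max N 1 \<le> n0" and v: "\<And>n. 0 \<le> v n" and n: "n0 \<le> n"
      and rec: "\<And>n. n0 < n \<Longrightarrow> v n \<le> (1 - q * a n) * v (n - 1) + C * a n * real n powr - p"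
    define u where "u n = real n powr p * v n" for n
    have "u n \<le> max (u n0) (C / \<theta>)"
    proof (rule recursion_bounded[OF _ _ \<theta>(1) n, of u a])
      fix n assume n: "n0 < n"
      hence nN: "N \<le> n" and n1: "1 \<le> n" using n0 by auto
      note * = N[OF nN]
      have an: "0 < a n" using a[OF n1] c n1 by simp
      show "0 \<le> a n \<and> \<theta> * a n \<le> 1" using an * \<theta> by (auto simp: field_simps)
      have qa: "q * a n \<le> 1" using * q by (auto simp: field_simps)
      have n2: "2 \<le> real n" using * by simp
      have ratio: "real n powr p * (1 - q * a n) \<le> real (n - 1) powr p * (1 - \<theta> * a n)"
      proof -
        have "real n = real (n - 1) * (1 + 1 / (real n - 1))" using n2 by (simp add: of_nat_diff field_simps)
        hence "real n powr p = real (n - 1) powr p * (1 + 1 / (real n - 1)) powr p"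
          by (metis of_nat_0_le_iff powr_mult)
        also have "\<dots> \<le> real (n - 1) powr p * (1 + p * (1 / (real n - 1)))"
          using n2 p by (intro mult_left_mono Bernoulli_powr_le) auto
        finally have "real n powr p * (1 - q * a n) \<le> real (n - 1) powr p * (1 + p * (1 / (real n - 1))) * (1 - q * a n)"
          using qa by (intro mult_right_mono) auto
        also have "\<dots> \<le> real (n - 1) powr p * (1 - \<theta> * a n)"
          unfolding mult.assoc
        proof (rule mult_left_mono)
          have "1 / (real n - 1) = 1 / real n + 1 / (real n - 1) * (1 / real n)" using n2 by (simp add: field_simps)
          hence "p * (1 / (real n - 1)) = p * (1 / real n) + p * (1 / (real n - 1)) * (1 / real n)"
            by (metis distrib_left mult.assoc)
          also have "\<dots> \<le> p * (1 / real n) + \<theta> * c * (1 / real n)"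
            using * by (intro add_left_mono mult_right_mono) auto
          also have "\<dots> = (p + \<theta> * c) * (1 / real n)" by (simp add: algebra_simps)
          also have "\<dots> \<le> (p + \<theta> * c) * (a n / c)"
          proof (rule mult_left_mono)
            \<comment> \<open>Because \<open>w \<le> 1\<close>, the rescaling cost
              \<open>1 / n\<close> is at most \<open>a n / c\<close>.\<close>
            have "real n powr - 1 \<le> real n powr - w" using n2 w by (intro powr_mono) auto
            thus "1 / real n \<le> a n / c" using c n2 by (simp add: a[OF n1] powr_minus_divide)
          qed (use p \<theta> c in auto)
          also have "\<dots> = (p / c + \<theta>) * a n" using c by (simp add: field_simps)
          also have "\<dots> = (q - \<theta>) * a n" using \<theta>(2) by simp
          finally have P: "p * (1 / (real n - 1)) \<le> (q - \<theta>) * a n" .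
          have "0 \<le> p * (1 / (real n - 1)) * (q * a n)" using p n2 q an by (intro mult_nonneg_nonneg) auto
          with P show "(1 + p * (1 / (real n - 1))) * (1 - q * a n) \<le> 1 - \<theta> * a n"
            by (simp only: algebra_simps)
        qed simp
        finally show ?thesis .
      qed
      have "u n \<le> real n powr p * ((1 - q * a n) * v (n - 1) + C * a n * real n powr - p)"
        unfolding u_def using rec n by (intro mult_left_mono) auto
      also have "\<dots> = real n powr p * (1 - q * a n) * v (n - 1) + C * a n * (real n powr p * real n powr - p)"
        by (simp add: algebra_simps)
      also have "real n powr p * real n powr - p = 1" using n2 by (simp flip: powr_add)
      also have "real n powr p * (1 - q * a n) * v (n - 1) \<le> real (n - 1) powr p * (1 - \<theta> * a n) * v (n - 1)"
        by (rule mult_right_mono[OF ratio]) (use v in auto)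
      finally show "u n \<le> (1 - \<theta> * a n) * u (n - 1) + C * a n" by (simp add: u_def mult_ac)
    qed
    thus "real n powr p * v n \<le> max (real n0 powr p * v n0) (C / \<theta>)" by (simp add: u_def)
  qed (use \<theta> in auto)
qed

section \<open>Second moments near the root and tightness\<close>

context stochastic_approximation begin

text \<open>A crude bound for the finitely many indices before the localisation starts.\<close>

lemma x_bounded: "AE \<omega> in M. \<bar>x n \<omega> - \<rho>\<bar> \<le> \<bar>x0 - \<rho>\<bar> + (\<Sum>i=1..n. a i)"
proof (induction n)
  case 0
  show ?case using AE_space by eventually_elim (simp add: x_init)
next
  case (Suc n)
  have "AE \<omega> in M. 0 \<le> z (Suc n) \<omega> \<and> z (Suc n) \<omega> \<le> 1" by (rule z_unit) simp
  with Suc AE_space show ?case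
  proof eventually_elim
    case (elim \<omega>)
    have "\<bar>z (Suc n) \<omega> - \<epsilon>\<bar> \<le> 1" using elim eps by (auto simp: abs_le_iff)
    hence "\<bar>a (Suc n) * (z (Suc n) \<omega> - \<epsilon>)\<bar> \<le> a (Suc n)"
      using step_pos[of "Suc n"] by (simp add: abs_mult mult_le_cancel_left1)
    moreover have "x (Suc n) \<omega> - \<rho> = (x n \<omega> - \<rho>) + a (Suc n) * (z (Suc n) \<omega> - \<epsilon>)"
      using x_step[of "Suc n" \<omega>] elim by simp
    ultimately have "\<bar>x (Suc n) \<omega> - \<rho>\<bar> \<le> \<bar>x n \<omega> - \<rho>\<bar> + a (Suc n)"
      by (metis abs_triangle_ineq add_left_mono order_trans)
    with elim show ?case by simp
  qed
qed

text \<open>Drift information is available only near \<open>\<rho>\<close>. Requiring closeness on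
  the whole stretch from \<open>n0\<close> to \<open>n\<close> makes the events decrease in
  \<open>n\<close> and keeps them in the history of the next step.\<close>

definition near :: "real \<Rightarrow> real \<Rightarrow> nat \<Rightarrow> nat \<Rightarrow> 'a set" where
  "near \<rho> \<eta> n0 n = {\<omega> \<in> space M. \<forall>k\<in>{n0..n}. \<bar>x k \<omega> - \<rho>\<bar> \<le> \<eta>}"

lemma near_sets: "near \<rho> \<eta> n0 n \<in> sets (history M x (Suc n))"
  unfolding near_def space_history[of M x "Suc n", symmetric]
proof (rule sets.sets_Collect_finite_All)
  fix k assume "k \<in> {n0..n}"
  hence [measurable]: "x k \<in> borel_measurable (history M x (Suc n))" by (intro history_component) auto
  show "{\<omega> \<in> space (history M x (Suc n)). \<bar>x k \<omega> - \<rho>\<bar> \<le> \<eta>} \<in> sets (history M x (Suc n))" by measurable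
qed auto

lemma near_sets_M [measurable]: "near \<rho> \<eta> n0 n \<in> sets M"
  using near_sets subalg[of "Suc n"] by (auto simp: subalgebra_def)

definition local_error :: "real \<Rightarrow> real \<Rightarrow> nat \<Rightarrow> nat \<Rightarrow> real" where
  "local_error \<rho> \<eta> n0 n = (LINT \<omega>|M. (x n \<omega> - \<rho>)\<^sup>2 * indicator (near \<rho> \<eta> n0 n) \<omega>)"

lemma local_integrable:
  assumes "n0 \<le> n"
  shows "integrable M (\<lambda>\<omega>. (x n \<omega> - \<rho>)\<^sup>2 * indicator (near \<rho> \<eta> n0 n) \<omega>)"
proof (rule integrable_const_bound[where B = "\<eta>\<^sup>2"])
  show "AE \<omega> in M. norm ((x n \<omega> - \<rho>)\<^sup>2 * indicator (near \<rho> \<eta> n0 n) \<omega>) \<le> \<eta>\<^sup>2"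
  proof (rule AE_I2)
    fix \<omega>
    show "norm ((x n \<omega> - \<rho>)\<^sup>2 * indicator (near \<rho> \<eta> n0 n) \<omega>) \<le> \<eta>\<^sup>2"
    proof (cases "\<omega> \<in> near \<rho> \<eta> n0 n")
      case True
      hence "\<bar>x n \<omega> - \<rho>\<bar> \<le> \<eta>" using assms by (auto simp: near_def)
      from power_mono[OF this, of 2] show ?thesis using True by simp
    qed simp
  qed
qed measurable

text \<open>The square is expanded on \<open>near \<rho> \<eta> n0 n\<close>, which contains the
  next such event. The test function \<open>h\<close> replaces the sample by its conditional mean,
  and \<open>2 * b * e \<le> d * e\<^sup>2 + b\<^sup>2 / d\<close> trades the bias for a loss
  \<open>d\<close> in the contraction rate.\<close>

lemma local_error_step:
  assumes n: "n0 \<le> n"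
    and drift: "\<And>y. \<bar>y - \<rho>\<bar> \<le> \<eta> \<Longrightarrow> (y - \<rho>) * (f (Suc n) y - \<epsilon>) \<le> - m * (y - \<rho>)\<^sup>2 + b * \<bar>y - \<rho>\<bar>"
    and d: "0 < d"
  shows "local_error \<rho> \<eta> n0 (Suc n) \<le> (1 - (2 * m - d) * a (Suc n)) * local_error \<rho> \<eta> n0 n
    + a (Suc n) * b\<^sup>2 / d + (a (Suc n))\<^sup>2"
proof -
  define I where "I \<omega> = (indicator (near \<rho> \<eta> n0 n) \<omega> :: real)" for \<omega>
  define h where "h \<omega> = (x n \<omega> - \<rho>) * I \<omega>" for \<omega>
  let ?a = "a (Suc n)" and ?z = "z (Suc n)"
  have a: "0 < ?a" by (rule step_pos) simp
  have [measurable]: "?z \<in> borel_measurable M" by (rule z_meas) simp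
  have [measurable]: "f (Suc n) \<in> borel_measurable borel" by (rule f_meas) simp
  have [measurable]: "I \<in> borel_measurable M" unfolding I_def[abs_def] by measurable
  have [measurable]: "h \<in> borel_measurable M" unfolding h_def[abs_def] by measurable
  have h_hist: "h \<in> borel_measurable (history M x (Suc n))"
  proof -
    have [measurable]: "x n \<in> borel_measurable (history M x (Suc n))" by (rule history_component) simp
    have [measurable]: "near \<rho> \<eta> n0 n \<in> sets (history M x (Suc n))" by (rule near_sets)
    show ?thesis unfolding h_def[abs_def] I_def by measurable
  qed
  have in_near: "\<bar>x n \<omega> - \<rho>\<bar> \<le> \<eta>" if "I \<omega> \<noteq> 0" for \<omega>
    using that n by (auto simp: I_def near_def indicator_def split: if_splits)
  have h_bound: "\<bar>h \<omega>\<bar> \<le> \<bar>\<eta>\<bar>" for \<omega>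
    using in_near[of \<omega>] by (cases "I \<omega> = 0") (auto simp: h_def I_def indicator_def split: if_splits)
  have z1: "AE \<omega> in M. 0 \<le> ?z \<omega> \<and> ?z \<omega> \<le> 1" by (rule z_unit) simp
  have int_sq: "integrable M (\<lambda>\<omega>. (x n \<omega> - \<rho>)\<^sup>2 * I \<omega>)"
    unfolding I_def by (rule local_integrable[OF n])
  have int_h: "integrable M h"
    by (rule integrable_const_bound[where B = "\<bar>\<eta>\<bar>"]) (auto simp: h_bound)
  have "AE \<omega> in M. norm (?z \<omega> * h \<omega>) \<le> 1 * \<bar>\<eta>\<bar>"
    using z1 by eventually_elim (unfold norm_mult, rule mult_mono, use h_bound in auto)
  hence int_zh: "integrable M (\<lambda>\<omega>. ?z \<omega> * h \<omega>)" by (rule integrable_const_bound) measurable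
  have "AE \<omega> in M. norm (f (Suc n) (x n \<omega>) * h \<omega>) \<le> 1 * \<bar>\<eta>\<bar>"
    by (rule AE_I2, unfold norm_mult, rule mult_mono) (use h_bound f_bounds[of "Suc n"] in auto)
  hence int_fh: "integrable M (\<lambda>\<omega>. f (Suc n) (x n \<omega>) * h \<omega>)" by (rule integrable_const_bound) measurable
  have mean: "(LINT \<omega>|M. ?z \<omega> * h \<omega>) = (LINT \<omega>|M. f (Suc n) (x n \<omega>) * h \<omega>)"
    using z_mean[OF _ h_hist h_bound] by simp
  have "local_error \<rho> \<eta> n0 (Suc n) \<le>
    (LINT \<omega>|M. (x n \<omega> - \<rho>)\<^sup>2 * I \<omega> + 2 * ?a * (?z \<omega> * h \<omega> - \<epsilon> * h \<omega>) + ?a\<^sup>2)"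
    unfolding local_error_def
  proof (rule integral_mono_AE)
    show "integrable M (\<lambda>\<omega>. (x (Suc n) \<omega> - \<rho>)\<^sup>2 * indicator (near \<rho> \<eta> n0 (Suc n)) \<omega>)"
      by (rule local_integrable) (use n in simp)
    show "integrable M (\<lambda>\<omega>. (x n \<omega> - \<rho>)\<^sup>2 * I \<omega> + 2 * ?a * (?z \<omega> * h \<omega> - \<epsilon> * h \<omega>) + ?a\<^sup>2)"
      using int_sq int_zh int_h by simp
    show "AE \<omega> in M. (x (Suc n) \<omega> - \<rho>)\<^sup>2 * indicator (near \<rho> \<eta> n0 (Suc n)) \<omega>
      \<le> (x n \<omega> - \<rho>)\<^sup>2 * I \<omega> + 2 * ?a * (?z \<omega> * h \<omega> - \<epsilon> * h \<omega>) + ?a\<^sup>2"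
      using z1 AE_space
    proof eventually_elim
      case (elim \<omega>)
      have sub: "indicator (near \<rho> \<eta> n0 (Suc n)) \<omega> \<le> I \<omega>"
        by (auto simp: I_def near_def indicator_def)
      have x: "x (Suc n) \<omega> - \<rho> = (x n \<omega> - \<rho>) + ?a * (?z \<omega> - \<epsilon>)"
        using x_step[of "Suc n" \<omega>] elim by simp
      have "(?z \<omega> - \<epsilon>)\<^sup>2 \<le> 1"
        using power_mono[of "\<bar>?z \<omega> - \<epsilon>\<bar>" 1 2] elim eps by (simp add: abs_le_iff)
      hence zz: "?a\<^sup>2 * (?z \<omega> - \<epsilon>)\<^sup>2 * I \<omega> \<le> ?a\<^sup>2 * 1 * 1"
        by (intro mult_mono) (auto simp: I_def indicator_def)
      have "(x (Suc n) \<omega> - \<rho>)\<^sup>2 * indicator (near \<rho> \<eta> n0 (Suc n)) \<omega> \<le> (x (Suc n) \<omega> - \<rho>)\<^sup>2 * I \<omega>"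
        using sub by (intro mult_left_mono) auto
      also have "\<dots> = (x n \<omega> - \<rho>)\<^sup>2 * I \<omega> + 2 * ?a * (?z \<omega> * h \<omega> - \<epsilon> * h \<omega>) + ?a\<^sup>2 * (?z \<omega> - \<epsilon>)\<^sup>2 * I \<omega>"
        unfolding x h_def by (simp add: power2_eq_square algebra_simps)
      finally show ?case using zz by simp
    qed
  qed
  also have "\<dots> = local_error \<rho> \<eta> n0 n + 2 * ?a * ((LINT \<omega>|M. ?z \<omega> * h \<omega>) - \<epsilon> * (LINT \<omega>|M. h \<omega>)) + ?a\<^sup>2"
    using int_sq int_zh int_h by (simp add: prob_space local_error_def I_def[symmetric])
  also have "(LINT \<omega>|M. ?z \<omega> * h \<omega>) - \<epsilon> * (LINT \<omega>|M. h \<omega>) = (LINT \<omega>|M. f (Suc n) (x n \<omega>) * h \<omega> - \<epsilon> * h \<omega>)"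
    unfolding mean using int_fh int_h by simp
  also have "\<dots> \<le> (LINT \<omega>|M. (- m + d / 2) * ((x n \<omega> - \<rho>)\<^sup>2 * I \<omega>) + b\<^sup>2 / (2 * d))"
  proof (rule integral_mono)
    show "integrable M (\<lambda>\<omega>. f (Suc n) (x n \<omega>) * h \<omega> - \<epsilon> * h \<omega>)" using int_fh int_h by simp
    show "integrable M (\<lambda>\<omega>. (- m + d / 2) * ((x n \<omega> - \<rho>)\<^sup>2 * I \<omega>) + b\<^sup>2 / (2 * d))"
      by (intro Bochner_Integration.integrable_add integrable_mult_right int_sq integrable_const)
    fix \<omega>
    show "f (Suc n) (x n \<omega>) * h \<omega> - \<epsilon> * h \<omega> \<le> (- m + d / 2) * ((x n \<omega> - \<rho>)\<^sup>2 * I \<omega>) + b\<^sup>2 / (2 * d)"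
    proof (cases "I \<omega> = 0")
      case True
      thus ?thesis using d by (simp add: h_def)
    next
      case False
      hence I: "I \<omega> = 1" by (auto simp: I_def indicator_def split: if_splits)
      define e where "e = \<bar>x n \<omega> - \<rho>\<bar>"
      have e2: "(x n \<omega> - \<rho>)\<^sup>2 = e\<^sup>2" by (simp add: e_def)
      have "0 \<le> (d * e - b)\<^sup>2" by simp
      hence "2 * d * (b * e) \<le> d\<^sup>2 * e\<^sup>2 + b\<^sup>2" by (simp add: power2_diff power_mult_distrib algebra_simps)
      hence "b * e \<le> (d\<^sup>2 * e\<^sup>2 + b\<^sup>2) / (2 * d)" using d by (simp add: pos_le_divide_eq algebra_simps)
      also have "\<dots> = d / 2 * e\<^sup>2 + b\<^sup>2 / (2 * d)" using d by (simp add: field_simps power2_eq_square)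
      finally have amgm: "b * e \<le> d / 2 * e\<^sup>2 + b\<^sup>2 / (2 * d)" .
      have "f (Suc n) (x n \<omega>) * h \<omega> - \<epsilon> * h \<omega> = (x n \<omega> - \<rho>) * (f (Suc n) (x n \<omega>) - \<epsilon>)"
        by (simp add: h_def I algebra_simps)
      also have "\<dots> \<le> - m * e\<^sup>2 + b * e"
        using drift[OF in_near[OF False]] by (simp add: e2 e_def[symmetric])
      finally show ?thesis using amgm by (simp add: I e2 algebra_simps)
    qed
  qed
  also have "\<dots> = (- m + d / 2) * local_error \<rho> \<eta> n0 n + b\<^sup>2 / (2 * d)"
    using int_sq by (simp add: prob_space local_error_def I_def[symmetric])
  finally have "local_error \<rho> \<eta> n0 (Suc n) \<le> local_error \<rho> \<eta> n0 n
      + 2 * ?a * ((- m + d / 2) * local_error \<rho> \<eta> n0 n + b\<^sup>2 / (2 * d)) + ?a\<^sup>2"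
    using a by simp
  also have "\<dots> = (1 - (2 * m - d) * ?a) * local_error \<rho> \<eta> n0 n + ?a * b\<^sup>2 / d + ?a\<^sup>2"
    using d by (simp add: field_simps)
  finally show ?thesis .
qed

text \<open>By almost sure convergence, the events that all iterates from \<open>k\<close> on are
  close increase to a set of full measure. Each lies in the corresponding \<open>near\<close> event
  for every \<open>n\<close>, which makes \<open>n0\<close> independent of \<open>n\<close>.\<close>

lemma prob_near:
  assumes conv: "AE \<omega> in M. (\<lambda>n. x n \<omega>) \<longlonglongrightarrow> \<rho>" and \<eta>: "0 < \<eta>" and "0 < e"
  shows "\<exists>n0\<ge>N. \<forall>n\<ge>n0. 1 - e < prob (near \<rho> \<eta> n0 n)"
proof -
  define good where "good k = {\<omega> \<in> space M. \<forall>n\<ge>k. \<bar>x n \<omega> - \<rho>\<bar> \<le> \<eta>}" for k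
  have good_sets: "good k \<in> sets M" for k unfolding good_def by measurable
  have "AE \<omega> in M. \<omega> \<in> (\<Union>k. good k)"
    using conv AE_space
  proof eventually_elim
    case (elim \<omega>)
    have "\<forall>\<^sub>F n in sequentially. dist (x n \<omega>) \<rho> < \<eta>" using elim(1) \<eta> by (rule tendstoD)
    thus ?case using elim(2) unfolding eventually_sequentially good_def by (force simp: dist_real_def)
  qed
  hence "prob (\<Union>k. good k) = 1" using good_sets by (subst prob_eq_1) auto
  moreover have "(\<lambda>k. prob (good k)) \<longlonglongrightarrow> prob (\<Union>k. good k)"
    by (rule finite_Lim_measure_incseq) (use good_sets in \<open>auto simp: incseq_def good_def\<close>)
  ultimately have "\<forall>\<^sub>F k in sequentially. 1 - e < prob (good k)"
    using \<open>0 < e\<close> by (intro order_tendstoD(1)) auto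
  then obtain k where k: "\<And>n. k \<le> n \<Longrightarrow> 1 - e < prob (good n)" unfolding eventually_sequentially by blast
  have "1 - e < prob (near \<rho> \<eta> (max k N) n)" for n
  proof -
    have "1 - e < prob (good (max k N))" by (rule k) simp
    also have "\<dots> \<le> prob (near \<rho> \<eta> (max k N) n)"
      by (rule finite_measure_mono) (auto simp: good_def near_def)
    finally show ?thesis .
  qed
  thus ?thesis by (intro exI[of _ "max k N"]) auto
qed

text \<open>On the paths that stay near the root from \<open>n0\<close> on, the recursion bounds the
  rescaled second moment, and Chebyshev's inequality uses half of the allowed probability
  \<open>e\<close>; the remaining paths use the other half. Indices up to \<open>n0\<close> are
  bounded almost surely.\<close>

theorem rescaled_error_tight:
  assumes conv: "AE \<omega> in M. (\<lambda>n. x n \<omega>) \<longlonglongrightarrow> \<rho>"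
    and w: "1 / 2 < w" "w \<le> 1" and a: "\<And>n. 1 \<le> n \<Longrightarrow> a n = c * real n powr - w"
    and c: "0 < c" "w - 1 / 2 < m * c" and \<eta>: "0 < \<eta>" and K: "0 \<le> K"
    and drift: "\<And>n y. n1 \<le> n \<Longrightarrow> \<bar>y - \<rho>\<bar> \<le> \<eta> \<Longrightarrow>
      (y - \<rho>) * (f n y - \<epsilon>) \<le> - m * (y - \<rho>)\<^sup>2 + K * real n powr - (w - 1 / 2) * \<bar>y - \<rho>\<bar>"
  shows "tight (\<lambda>n. distr M borel (\<lambda>\<omega>. real n powr (w - 1 / 2) * (x n \<omega> - \<rho>)))"
proof -
  define p where "p = 2 * w - 1"
  \<comment> \<open>With this choice \<open>(2 * m - d) * c\<close> equals
    \<open>m * c + (w - 1 / 2)\<close>, which exceeds \<open>p = 2 * w - 1\<close> because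
    \<open>m * c > w - 1 / 2\<close>.\<close>
  define d where "d = m - (w - 1 / 2) / c"
  have d: "0 < d" using c by (simp add: d_def pos_divide_less_eq)
  have "(2 * m - d) * c = m * c + (w - 1 / 2)"
    using c by (simp add: d_def distrib_right)
  hence pq: "p < (2 * m - d) * c"
    using c by (simp add: p_def)
  define C where "C = K\<^sup>2 / d + c"
  have C: "0 \<le> C" using d c by (simp add: C_def)
  obtain N \<theta> where bound: "\<And>n0 n v. N \<le> n0 \<Longrightarrow> (\<And>n. 0 \<le> v n) \<Longrightarrow>
     (\<And>n. n0 < n \<Longrightarrow> v n \<le> (1 - (2 * m - d) * a n) * v (n - 1) + C * a n * real n powr - p) \<Longrightarrow> n0 \<le> n \<Longrightarrow>
     real n powr p * v n \<le> max (real n0 powr p * v n0) (C / \<theta>)"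
    by (rule scaled_recursion_bounded[of w p c "2 * m - d" a C]) (use w c pq a in \<open>auto simp: p_def\<close>)
  define Y where "Y n \<omega> = real n powr (w - 1 / 2) * (x n \<omega> - \<rho>)" for n \<omega>
  have [measurable]: "Y n \<in> borel_measurable M" for n unfolding Y_def[abs_def] by measurable
  have local: "\<exists>U. \<forall>n\<ge>n0. real n powr p * local_error \<rho> \<eta> n0 n \<le> U" if n0: "max N n1 \<le> n0" for n0
  proof -
    have step: "local_error \<rho> \<eta> n0 n \<le> (1 - (2 * m - d) * a n) * local_error \<rho> \<eta> n0 (n - 1) + C * a n * real n powr - p"
      if n: "n0 < n" for n
    proof -
      obtain l where l: "n = Suc l" using n by (cases n) auto
      have n_pos: "1 \<le> n" using n by simp
      define b where "b = K * real n powr - (w - 1 / 2)"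
      have "local_error \<rho> \<eta> n0 n \<le> (1 - (2 * m - d) * a n) * local_error \<rho> \<eta> n0 (n - 1) + a n * b\<^sup>2 / d + (a n)\<^sup>2"
        using local_error_step[of n0 l \<rho> \<eta> m b d] drift[of n] n n0 d by (simp add: l b_def)
      also have "b\<^sup>2 = K\<^sup>2 * real n powr - p"
      proof -
        have "(real n powr - (w - 1 / 2))\<^sup>2 = real n powr - p"
          using n_pos by (simp add: p_def power2_eq_square flip: powr_add)
        thus ?thesis by (simp add: b_def power_mult_distrib)
      qed
      \<comment> \<open>Since \<open>2 * w - 1 \<le> w\<close>, the variance of a step decays at
        least as fast as \<open>a n\<close> times the squared bias rate
        \<open>n powr - p\<close>.\<close>
      also have "(a n)\<^sup>2 \<le> a n * (c * real n powr - p)"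
      proof -
        have "real n powr - w \<le> real n powr - p" using n_pos w by (intro powr_mono) (auto simp: p_def)
        hence "a n \<le> c * real n powr - p" using c by (simp add: a[OF n_pos])
        thus ?thesis using step_pos[OF n_pos] by (simp add: power2_eq_square)
      qed
      finally show ?thesis by (simp add: C_def algebra_simps)
    qed
    have nonneg: "0 \<le> local_error \<rho> \<eta> n0 n" for n
      unfolding local_error_def by (intro Bochner_Integration.integral_nonneg) auto
    have "N \<le> n0" using n0 by simp
    from bound[OF this nonneg step] show ?thesis by blast
  qed
  show ?thesis unfolding tight_def Y_def[symmetric]
  proof (intro conjI allI impI)
    show "real_distribution (distr M borel (Y n))" for n
      by (rule real_distribution_distr) measurable
    fix e :: real assume e: "0 < e"
    then obtain n0 where n0: "max N n1 \<le> n0" and near: "\<And>n. n0 \<le> n \<Longrightarrow> 1 - e / 2 < prob (near \<rho> \<eta> n0 n)"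
      using prob_near[OF conv \<eta>, of "e / 2" "max N n1"] by auto
    obtain U where U: "\<forall>n\<ge>n0. real n powr p * local_error \<rho> \<eta> n0 n \<le> U" using local[OF n0] by (elim exE)
    define G where "G n = real n powr (w - 1 / 2) * (\<bar>x0 - \<rho>\<bar> + (\<Sum>i=1..n. a i))" for n
    \<comment> \<open>Above this level Chebyshev's inequality leaves probability less than
      \<open>e / 2\<close>.\<close>
    define r where "r = sqrt (2 * \<bar>U\<bar> / e)"
    have r: "0 \<le> r" "r\<^sup>2 = 2 * \<bar>U\<bar> / e" using e by (simp_all add: r_def)
    define S where "S = insert r (G ` {..n0})"
    define B where "B = Max S + 1"
    have S: "s < B" if "s \<in> S" for s
    proof -
      have "finite S" by (simp add: S_def)
      from Max_ge[OF this that] show ?thesis by (simp add: B_def)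
    qed
    have "r < B" by (rule S) (simp add: S_def)
    hence B_pos: "0 < B" using r by simp
    have BU: "2 * \<bar>U\<bar> / e < B\<^sup>2"
      using power_strict_mono[OF \<open>r < B\<close> r(1), of 2] by (simp add: r(2))
    have GB: "G n < B" if "n \<le> n0" for n
      by (rule S) (use that in \<open>simp add: S_def\<close>)
    have "1 - e < prob {\<omega> \<in> space M. \<bar>Y n \<omega>\<bar> < B}" for n
    proof (cases "n \<le> n0")
      case True
      have "AE \<omega> in M. \<bar>Y n \<omega>\<bar> < B"
        using x_bounded[of n \<rho>]
      proof eventually_elim
        case (elim \<omega>)
        have "\<bar>Y n \<omega>\<bar> \<le> G n" unfolding Y_def G_def using elim by (simp add: abs_mult mult_left_mono)
        thus ?case using GB[OF True] by simp
      qed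
      hence "prob {\<omega> \<in> space M. \<bar>Y n \<omega>\<bar> < B} = 1" by (subst prob_Collect_eq_1) auto
      thus ?thesis using e by simp
    next
      case False
      hence n: "n0 \<le> n" by simp
      define A where "A = near \<rho> \<eta> n0 n"
      define D where "D = {\<omega> \<in> space M. B \<le> \<bar>Y n \<omega>\<bar>}"
      have [measurable]: "A \<in> sets M" "D \<in> sets M" unfolding A_def D_def by measurable
      have "B\<^sup>2 * prob (A \<inter> D) = (LINT \<omega>|M. B\<^sup>2 * indicator (A \<inter> D) \<omega>)" by simp
      also have "\<dots> \<le> (LINT \<omega>|M. real n powr p * ((x n \<omega> - \<rho>)\<^sup>2 * indicator A \<omega>))"
      proof (rule integral_mono)
        show "integrable M (\<lambda>\<omega>. B\<^sup>2 * indicator (A \<inter> D) \<omega>)"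
          by (intro integrable_mult_right integrable_real_indicator) (auto simp: emeasure_eq_measure)
        show "integrable M (\<lambda>\<omega>. real n powr p * ((x n \<omega> - \<rho>)\<^sup>2 * indicator A \<omega>))"
          unfolding A_def by (intro integrable_mult_right local_integrable n)
        fix \<omega>
        show "B\<^sup>2 * indicator (A \<inter> D) \<omega> \<le> real n powr p * ((x n \<omega> - \<rho>)\<^sup>2 * indicator A \<omega>)"
        proof (cases "\<omega> \<in> A \<inter> D")
          case True
          hence "B \<le> \<bar>Y n \<omega>\<bar>" by (simp add: D_def)
          hence "B\<^sup>2 \<le> (Y n \<omega>)\<^sup>2" using power_mono[of B "\<bar>Y n \<omega>\<bar>" 2] B_pos by simp
          also have "(Y n \<omega>)\<^sup>2 = real n powr p * (x n \<omega> - \<rho>)\<^sup>2"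
          proof -
            have "(real n powr (w - 1 / 2))\<^sup>2 = real n powr p"
              by (simp add: p_def power2_eq_square flip: powr_add)
            thus ?thesis by (simp add: Y_def power_mult_distrib)
          qed
          finally show ?thesis using True by simp
        qed simp
      qed
      also have "\<dots> = real n powr p * local_error \<rho> \<eta> n0 n" by (simp add: local_error_def A_def)
      also have "\<dots> \<le> U" by (rule U[rule_format, OF n])
      also have "U < B\<^sup>2 * (e / 2)" using BU e by (simp add: pos_divide_less_eq abs_less_iff)
      finally have "prob (A \<inter> D) < e / 2" using B_pos by simp
      moreover have "prob A \<le> prob (A \<inter> D) + prob (A - D)"
      proof -
        have "prob A = prob ((A \<inter> D) \<union> (A - D))" by (rule arg_cong[of _ _ prob]) auto
        also have "\<dots> \<le> prob (A \<inter> D) + prob (A - D)" by (rule measure_Un_le) auto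
        finally show ?thesis .
      qed
      moreover have "prob (A - D) \<le> prob {\<omega> \<in> space M. \<bar>Y n \<omega>\<bar> < B}"
        by (rule finite_measure_mono) (auto simp: A_def D_def near_def)
      ultimately show ?thesis using near[OF n] unfolding A_def by linarith
    qed
    moreover have "prob {\<omega> \<in> space M. \<bar>Y n \<omega>\<bar> < B} \<le> measure (distr M borel (Y n)) {- B<..B}" for n
    proof -
      have "measure (distr M borel (Y n)) {- B<..B} = prob (Y n -` {- B<..B} \<inter> space M)"
        by (rule measure_distr) auto
      thus ?thesis by (auto intro!: finite_measure_mono simp: abs_less_iff)
    qed
    ultimately show "\<exists>a b. a < b \<and> (\<forall>n. 1 - e < measure (distr M borel (Y n)) {a<..b})"
      using B_pos by (intro exI[of _ "- B"] exI[of _ B]) (auto intro: less_le_trans)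
  qed
qed

end

section \<open>Derivative of the limit function and conclusion\<close>

lemma abs_diff_le_1: "0 \<le> u \<Longrightarrow> u \<le> 1 \<Longrightarrow> 0 \<le> w \<Longrightarrow> w \<le> 1 \<Longrightarrow> \<bar>u - w\<bar> \<le> (1 :: real)"
  by simp

text \<open>Integer times reduce this to the theorem on sequences with uniformly convergent
  derivatives. The uniform limit \<open>g\<close> turns out to be \<open>deriv f\<close>, so the
  conclusion is stated without it.\<close>

lemma uniform_limit_deriv:
  fixes F :: "real \<Rightarrow> real \<Rightarrow> real"
  assumes "\<forall>s\<ge>0. F s differentiable_on {a<..<b}"
    and unif: "uniform_limit {a<..<b} (\<lambda>s. deriv (F s)) g at_top"
    and lim: "\<And>r. r \<in> {a<..<b} \<Longrightarrow> ((\<lambda>s. F s r) \<longlongrightarrow> f r) at_top"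
    and x: "x \<in> {a<..<b}"
  shows "(f has_real_derivative deriv f x) (at x)"
proof -
  define S where "S = {a<..<b}"
  have S: "open S" "convex S" "x \<in> S" using x by (auto simp: S_def)
  have seq: "(\<lambda>n. F (real n) r) \<longlonglongrightarrow> f r" if "r \<in> S" for r
    using filterlim_compose[OF lim filterlim_real_sequentially] that by (simp add: S_def)
  have der: "(F (real n) has_derivative (\<lambda>h. deriv (F (real n)) r * h)) (at r within S)" if "r \<in> S" for n r
  proof -
    have "F (real n) differentiable_on S" using assms(1) by (simp add: S_def)
    hence "F (real n) differentiable at r"
      using S(1) that by (simp add: differentiable_on_eq_differentiable_at)
    hence "(F (real n) has_real_derivative deriv (F (real n)) r) (at r)"
      by (simp add: DERIV_deriv_iff_real_differentiable)
    hence "(F (real n) has_derivative (\<lambda>h. deriv (F (real n)) r * h)) (at r)"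
      by (simp add: has_field_derivative_def)
    thus ?thesis by (rule has_derivative_at_withinI)
  qed
  have nle: "\<forall>\<^sub>F n in sequentially. \<forall>r\<in>S. \<forall>h. norm (deriv (F (real n)) r * h - g r * h) \<le> e * norm h"
    if e: "0 < e" for e
  proof -
    have "\<forall>\<^sub>F s in at_top. \<forall>r\<in>S. dist (deriv (F s) r) (g r) < e"
      using uniform_limitD[OF unif e] by (simp add: S_def)
    hence "\<forall>\<^sub>F n in sequentially. \<forall>r\<in>S. dist (deriv (F (real n)) r) (g r) < e"
      by (rule eventually_compose_filterlim[OF _ filterlim_real_sequentially])
    thus ?thesis
    proof eventually_elim
      case (elim n)
      show ?case
      proof (intro ballI allI)
        fix r h assume "r \<in> S"
        have "norm (deriv (F (real n)) r * h - g r * h) = \<bar>deriv (F (real n)) r - g r\<bar> * \<bar>h\<bar>"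
          by (simp add: abs_mult flip: left_diff_distrib)
        also have "\<dots> \<le> e * \<bar>h\<bar>"
          using elim \<open>r \<in> S\<close> by (intro mult_right_mono) (auto simp: dist_real_def less_imp_le)
        finally show "norm (deriv (F (real n)) r * h - g r * h) \<le> e * norm h" by simp
      qed
    qed
  qed
  obtain G where G: "\<forall>r\<in>S. (\<lambda>n. F (real n) r) \<longlonglongrightarrow> G r \<and> (G has_derivative (\<lambda>h. g r * h)) (at r within S)"
    using has_derivative_sequence[OF S(2) der nle S(3) seq[OF S(3)]] by blast
  have Gf: "G r = f r" if "r \<in> S" for r
    using G seq that LIMSEQ_unique by blast
  have "(f has_derivative (\<lambda>h. g x * h)) (at x within S)"
    by (rule has_derivative_transform[of x S f G]) (use G Gf S in auto)
  hence d: "(f has_real_derivative g x) (at x)"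
    unfolding has_field_derivative_def at_within_open[OF S(3,1)] .
  show ?thesis unfolding DERIV_imp_deriv[OF d] by (rule d)
qed

theorem theorem1:
  fixes N :: "('x, 'k::finite, 'i::finite) network"
    and P :: "real^'k \<Rightarrow> 'x \<Rightarrow> 'w measure"
    and X :: "real \<Rightarrow> 'w \<Rightarrow> 'x"
    and \<phi> :: "'x \<Rightarrow> real"
    and v :: "real^'k"
    and \<epsilon> x0 :: real
    and t a :: "nat \<Rightarrow> real"
    and M :: "'a measure"
    and x z :: "nat \<Rightarrow> 'a \<Rightarrow> real"
  defines "rs \<equiv> r_star N P X v"
    and "r\<epsilon> \<equiv> r_root N P X \<phi> v \<epsilon>"
    and "\<phi>t \<equiv> mean_at_ray N P X \<phi> v"
    and "\<phi>l \<equiv> mean_limit_ray N P X \<phi> v"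
  assumes network: "multiclass_network N"
    and process: "queue_process N P X"
    and direction: "0 \<le> v" "norm v = 1"
    and phi_range: "\<And>c. c \<in> configs N \<Longrightarrow> 0 < \<phi> c \<and> \<phi> c \<le> 1"
    and phi_vanishes: "vanishes_at_infinity (configs N) \<phi>"
    and phi_empty: "\<phi> (empty_config N) = 1"
    and M1: "condition_M1 N P X \<phi> (ray v)"
    and M2: "condition_M2 N P X \<phi> (ray v)"
    and eps: "0 < \<epsilon>" "\<epsilon> < 1"
    and x0: "0 < x0" "x0 < r_bar N v"
    and times: "mono t" "t 0 = 0" "filterlim t at_top sequentially"
    and steps: "\<And>n. n \<ge> 1 \<Longrightarrow> 0 < a n" "\<And>m n. 1 \<le> m \<Longrightarrow> m \<le> n \<Longrightarrow> a n \<le> a m"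
      "a \<longlonglongrightarrow> 0"
      "filterlim (\<lambda>n. \<Sum>i=1..n. a i) at_top sequentially"
      "summable (\<lambda>n. (a (Suc n))\<^sup>2)"
    and prob: "prob_space M"
    and z_meas: "\<And>n. n \<ge> 1 \<Longrightarrow> z n \<in> borel_measurable M"
    and x_init: "\<And>\<omega>. \<omega> \<in> space M \<Longrightarrow> x 0 \<omega> = x0"
    and x_step: "\<And>n \<omega>. n \<ge> 1 \<Longrightarrow> \<omega> \<in> space M \<Longrightarrow>
      x n \<omega> = x (n - 1) \<omega> + a n * (z n \<omega> - \<epsilon>)"
    and z_cond: "\<And>n. n \<ge> 1 \<Longrightarrow> has_conditional_distr M (history M x n) (z n)
      (\<lambda>\<omega>. sampling_distr N P X \<phi> v (t n) (x (n - 1) \<omega>))"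
  shows "(AE \<omega> in M. (\<lambda>n. x n \<omega>) \<longlonglongrightarrow> r\<epsilon>) \<and>
    (\<forall>g w c \<kappa>.
       (\<forall>s\<ge>0. \<phi>t s differentiable_on {0<..<rs}) \<longrightarrow>
       uniform_limit {0<..<rs} (\<lambda>s. deriv (\<phi>t s)) g at_top \<longrightarrow>
       (INF r\<in>{0<..<rs}. \<bar>deriv \<phi>l r\<bar>) > 0 \<longrightarrow>
       1 / 2 < w \<longrightarrow> w \<le> 1 \<longrightarrow>
       (\<forall>n\<ge>1. a n = c * real n powr (- w)) \<longrightarrow>
       c > (w - 1 / 2) / (INF r\<in>{0<..<rs}. \<bar>deriv \<phi>l r\<bar>) \<longrightarrow>
       \<kappa> > w - 1 / 2 \<longrightarrow>
       (\<lambda>n. SUP r\<in>{0..rs}. \<bar>\<phi>t (t n) r - \<phi>l r\<bar>) \<in> o(\<lambda>n. real n powr (- \<kappa>)) \<longrightarrow>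
       tight (\<lambda>n. distr M borel (\<lambda>\<omega>. real n powr (w - 1 / 2) * (x n \<omega> - r\<epsilon>))))"
proof -
  interpret monotone_ray N P X \<phi> v
    by (rule monotone_ray.intro[OF network], unfold_locales)
      (fact process direction phi_range phi_vanishes phi_empty M1 M2)+
  interpret M: prob_space M by (rule prob)
  define \<rho> where "\<rho> = r_root N P X \<phi> v \<epsilon>"
  note \<rho> = r_root[OF eps, folded \<rho>_def]
  have t: "0 \<le> t n" for n using times(1,2) monoD[of t 0 n] by simp
  \<comment> \<open>Negative arguments are sampled at zero, as in \<open>sampling_distr\<close>; the
    regression functions are thus antitone on the whole line, hence Borel.\<close>
  define f where "f n y = mean (t n) (max 0 y)" for n y
  have f_anti: "f n y' \<le> f n y" if "y \<le> y'" for n y y'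
    unfolding f_def using that t[of n] by (intro mean_mono) auto
  have f_meas: "f n \<in> borel_measurable borel" for n
  proof -
    have "mono (\<lambda>y. - f n y)" using f_anti by (auto simp: mono_def)
    hence "(\<lambda>y. - f n y) \<in> borel_measurable borel" by (rule borel_measurable_mono)
    thus ?thesis by simp
  qed
  have f_bounds: "0 \<le> f n y \<and> f n y \<le> 1" for n y
    unfolding f_def using mean_bounds[of "max 0 y" "t n"] t by simp
  have x_meas: "x n \<in> borel_measurable M" for n
    by (rule recursion_measurable[OF z_meas x_init x_step])
  have sub: "subalgebra M (history M x n)" for n by (rule subalgebra_history[OF x_meas])
  note kernel = prob_space_sampling[OF t] sets_sampling[OF t] AE_sampling[OF t]
  interpret stochastic_approximation M x z a \<epsilon> x0 f
  proof
    fix n :: nat assume n: "1 \<le> n"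
    show "0 < a n" by (rule steps(1)[OF n])
    show "f n \<in> borel_measurable borel" by (rule f_meas)
    show "0 \<le> f n y \<and> f n y \<le> 1" for y by (rule f_bounds)
    show "z n \<in> borel_measurable M" by (rule z_meas[OF n])
    show "x n \<omega> = x (n - 1) \<omega> + a n * (z n \<omega> - \<epsilon>)" if "\<omega> \<in> space M" for \<omega>
      by (rule x_step[OF n that])
    show "AE \<omega> in M. 0 \<le> z n \<omega> \<and> z n \<omega> \<le> 1"
      by (rule conditional_distr_unit_interval[OF prob sub z_meas[OF n] z_cond[OF n] kernel])
    show "(LINT \<omega>|M. z n \<omega> * h \<omega>) = (LINT \<omega>|M. f n (x (n - 1) \<omega>) * h \<omega>)"
      if "h \<in> borel_measurable (history M x n)" "\<And>\<omega>. \<omega> \<in> space M \<Longrightarrow> \<bar>h \<omega>\<bar> \<le> C" for h C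
    proof (rule integral_conditional_mean[OF prob sub z_meas[OF n] z_cond[OF n] kernel _ _ that])
      show "(LINT s|sampling_distr N P X \<phi> v (t n) (x (n - 1) \<omega>). s) = f n (x (n - 1) \<omega>)" for \<omega>
        unfolding f_def by (rule mean_sampling[OF t])
      show "(\<lambda>\<omega>. f n (x (n - 1) \<omega>)) \<in> borel_measurable M"
        by (rule measurable_compose[OF x_meas f_meas])
    qed
  qed (use eps x_init in auto)
  have conv: "AE \<omega> in M. (\<lambda>n. x n \<omega>) \<longlonglongrightarrow> \<rho>"
  proof (rule converges_AE[OF steps(3,4,5)])
    fix \<delta> :: real assume \<delta>: "0 < \<delta>"
    \<comment> \<open>Below the root the margin \<open>c1\<close> is uniform in \<open>n\<close>,
      since the means lie above their limit. Above the root only half of the limiting gap,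
      \<open>c2\<close>, is available, and only for late \<open>n\<close>.\<close>
    define r where "r = max 0 (\<rho> - \<delta>)"
    have r: "0 \<le> r" "r < \<rho>" using \<delta> \<rho>(1) by (auto simp: r_def)
    define c1 where "c1 = mlim r - \<epsilon>"
    have c1: "0 < c1" using \<rho>(4)[OF r] by (simp add: c1_def)
    define c2 where "c2 = (\<epsilon> - mlim (\<rho> + \<delta>)) / 2"
    have c2: "0 < c2" using \<rho>(5)[of "\<rho> + \<delta>"] \<delta> by (simp add: c2_def)
    have "(\<lambda>n. mean (t n) (\<rho> + \<delta>)) \<longlonglongrightarrow> mlim (\<rho> + \<delta>)"
      by (rule filterlim_compose[OF mean_tendsto times(3)]) (use \<rho>(1) \<delta> in simp)
    hence "\<forall>\<^sub>F n in sequentially. mean (t n) (\<rho> + \<delta>) < \<epsilon> - c2"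
    proof (rule order_tendstoD(2))
      have "u = e - 2 * s" if "s = (e - u) / 2" for e u s :: real using that by simp
      from this[OF c2_def] have "mlim (\<rho> + \<delta>) = \<epsilon> - 2 * c2" .
      thus "mlim (\<rho> + \<delta>) < \<epsilon> - c2" using c2 by simp
    qed
    then obtain n0 where n0: "\<And>n. n0 \<le> n \<Longrightarrow> mean (t n) (\<rho> + \<delta>) < \<epsilon> - c2"
      unfolding eventually_sequentially by blast
    have "f n y - \<epsilon> \<le> - min c1 c2" if "n0 \<le> n" "\<rho> + \<delta> \<le> y" for n y
    proof -
      have "f n y \<le> f n (\<rho> + \<delta>)" by (rule f_anti[OF that(2)])
      also have "\<dots> = mean (t n) (\<rho> + \<delta>)" using \<rho>(1) \<delta> by (simp add: f_def)
      finally show ?thesis using n0[OF that(1)] by simp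
    qed
    moreover have "min c1 c2 \<le> f n y - \<epsilon>" if "y \<le> \<rho> - \<delta>" for n y
    proof -
      have "mlim r \<le> mlim (max 0 y)" by (rule mlim_antimono) (use that in \<open>auto simp: r_def\<close>)
      also have "\<dots> \<le> f n y" unfolding f_def by (rule mlim_le_mean) (use t in auto)
      finally show ?thesis by (simp add: c1_def)
    qed
    ultimately show "\<exists>c>0. \<exists>N. \<forall>n\<ge>N. \<forall>y. (\<rho> + \<delta> \<le> y \<longrightarrow> f n y - \<epsilon> \<le> - c) \<and> (y \<le> \<rho> - \<delta> \<longrightarrow> c \<le> f n y - \<epsilon>)"
      using c1 c2 by (intro exI[of _ "min c1 c2"] conjI exI[of _ n0]) auto
  qed
  show ?thesis
    unfolding rs_def r\<epsilon>_def \<phi>t_def \<phi>l_def \<rho>_def[symmetric]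
  proof (intro conjI allI impI conv)
    fix g :: "real \<Rightarrow> real" and w c \<kappa> :: real
    assume diff: "\<forall>s\<ge>0. mean s differentiable_on {0<..<rstar}"
      and unif: "uniform_limit {0<..<rstar} (\<lambda>s. deriv (mean s)) g at_top"
      and inf: "0 < (INF r\<in>{0<..<rstar}. \<bar>deriv mlim r\<bar>)"
      and w: "1 / 2 < w" "w \<le> 1" and a: "\<forall>n\<ge>1. a n = c * real n powr - w"
      and c: "(w - 1 / 2) / (INF r\<in>{0<..<rstar}. \<bar>deriv mlim r\<bar>) < c"
      and \<kappa>: "w - 1 / 2 < \<kappa>"
      and rate: "(\<lambda>n. SUP r\<in>{0..rstar}. \<bar>mean (t n) r - mlim r\<bar>) \<in> o(\<lambda>n. real n powr - \<kappa>)"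
    define m where "m = (INF r\<in>{0<..<rstar}. \<bar>deriv mlim r\<bar>)"
    have m: "0 < m" using inf by (simp add: m_def)
    have m_le: "m \<le> \<bar>deriv mlim r\<bar>" if "r \<in> {0<..<rstar}" for r
      unfolding m_def using that by (intro cINF_lower bdd_belowI[of _ 0]) auto
    have deriv: "(mlim has_real_derivative deriv mlim r) (at r)" if "r \<in> {0<..<rstar}" for r
      by (rule uniform_limit_deriv[OF diff unif _ that]) (auto intro: mean_tendsto)
    \<comment> \<open>The mean value theorem between \<open>y\<close> and \<open>\<rho>\<close>
      gives a derivative of modulus at least \<open>m\<close>; its sign comes from the strict
      crossing at the root.\<close>
    have slope: "(y - \<rho>) * (mlim y - \<epsilon>) \<le> - m * (y - \<rho>)\<^sup>2" if y: "y \<in> {0<..<rstar}" for y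
    proof (cases "y = \<rho>")
      case False
      obtain \<xi> where \<xi>: "\<xi> \<in> {0<..<rstar}" "mlim y - \<epsilon> = (y - \<rho>) * deriv mlim \<xi>"
      proof (cases "y < \<rho>")
        case True
        have "\<exists>\<xi>>y. \<xi> < \<rho> \<and> mlim \<rho> - mlim y = (\<rho> - y) * deriv mlim \<xi>"
          by (rule MVT2[OF True]) (use y \<rho>(1,2) in \<open>auto intro!: deriv\<close>)
        then obtain \<xi> where "y < \<xi>" "\<xi> < \<rho>" "mlim \<rho> - mlim y = (\<rho> - y) * deriv mlim \<xi>" by blast
        thus ?thesis using y \<rho>(2,3) by (intro that[of \<xi>]) (auto simp: algebra_simps)
      next
        case False
        with \<open>y \<noteq> \<rho>\<close> have "\<rho> < y" by simp
        hence "\<exists>\<xi>>\<rho>. \<xi> < y \<and> mlim y - mlim \<rho> = (y - \<rho>) * deriv mlim \<xi>"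
          by (rule MVT2) (use y \<rho>(1,2) in \<open>auto intro!: deriv\<close>)
        then obtain \<xi> where "\<rho> < \<xi>" "\<xi> < y" "mlim y - mlim \<rho> = (y - \<rho>) * deriv mlim \<xi>" by blast
        thus ?thesis using y \<rho>(1,3) by (intro that[of \<xi>]) auto
      qed
      have pos: "0 < (y - \<rho>)\<^sup>2" using False by simp
      have eq: "(y - \<rho>) * (mlim y - \<epsilon>) = (y - \<rho>)\<^sup>2 * deriv mlim \<xi>"
        by (simp add: \<xi>(2) power2_eq_square)
      have "(y - \<rho>) * (mlim y - \<epsilon>) < 0"
        using \<rho>(4)[of y] \<rho>(5)[of y] y False by (cases "y < \<rho>") (auto simp: mult_less_0_iff)
      hence "deriv mlim \<xi> < 0" using pos by (simp add: eq mult_less_0_iff)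
      hence "deriv mlim \<xi> \<le> - m" using m_le[OF \<xi>(1)] by simp
      hence "(y - \<rho>)\<^sup>2 * deriv mlim \<xi> \<le> (y - \<rho>)\<^sup>2 * (- m)" by (intro mult_left_mono) auto
      thus ?thesis by (simp add: eq mult.commute)
    qed simp
    have mlim_le_1: "mlim r \<le> 1" if "0 \<le> r" for r using mlim_antimono[of 0 r] mlim_0 that by simp
    define B where "B n = (SUP r\<in>{0..rstar}. \<bar>mean (t n) r - mlim r\<bar>)" for n
    \<comment> \<open>The supremum is over a set bounded by 1, since both functions take values in
      the unit interval.\<close>
    have B: "\<bar>mean (t n) r - mlim r\<bar> \<le> B n" if "r \<in> {0..rstar}" for n r
      unfolding B_def
    proof (rule cSUP_upper[OF that])
      have "\<bar>mean (t n) r - mlim r\<bar> \<le> 1" if "0 \<le> r" for r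
        by (rule abs_diff_le_1) (use mean_bounds[OF that t] mlim_nonneg[OF that] mlim_le_1[OF that] in auto)
      thus "bdd_above ((\<lambda>r. \<bar>mean (t n) r - mlim r\<bar>) ` {0..rstar})" by (intro bdd_aboveI[of _ 1]) auto
    qed
    have "\<forall>\<^sub>F n in sequentially. norm (B n) \<le> 1 * norm (real n powr - \<kappa>)"
      using landau_o.smallD[OF rate, of 1] by (simp add: B_def)
    hence "\<forall>\<^sub>F n in sequentially. B n \<le> real n powr - (w - 1 / 2)"
      using eventually_ge_at_top[of 1]
    proof eventually_elim
      case (elim n)
      have "B n \<le> real n powr - \<kappa>" using elim(1) by simp
      also have "\<dots> \<le> real n powr - (w - 1 / 2)" using elim(2) \<kappa> by (intro powr_mono) auto
      finally show ?case .
    qed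
    then obtain n1 where n1: "\<And>n. n1 \<le> n \<Longrightarrow> B n \<le> real n powr - (w - 1 / 2)"
      unfolding eventually_sequentially by blast
    \<comment> \<open>This radius keeps the neighbourhood inside \<open>(0, r_star)\<close>, where
      the slope bound holds.\<close>
    define \<eta> where "\<eta> = min \<rho> (rstar - \<rho>) / 2"
    have \<eta>: "0 < \<eta>" "\<eta> < \<rho>" "\<eta> < rstar - \<rho>" using \<rho>(1,2) by (auto simp: \<eta>_def)
    show "tight (\<lambda>n. distr M borel (\<lambda>\<omega>. real n powr (w - 1 / 2) * (x n \<omega> - \<rho>)))"
    proof (rule rescaled_error_tight[OF conv w _ _ _ \<eta>(1), of c m 1 n1])
      show "a n = c * real n powr - w" if "1 \<le> n" for n using a that by simp
      have "0 < (w - 1 / 2) / m" using w m by simp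
      thus "0 < c" using c by (simp add: m_def)
      show "w - 1 / 2 < m * c" using c m by (simp add: m_def[symmetric] pos_divide_less_eq mult.commute)
      fix n y assume n: "n1 \<le> n" and y: "\<bar>y - \<rho>\<bar> \<le> \<eta>"
      have yS: "y \<in> {0<..<rstar}" using y \<eta> by (auto simp: abs_le_iff)
      have "(y - \<rho>) * (mean (t n) y - mlim y) \<le> \<bar>y - \<rho>\<bar> * \<bar>mean (t n) y - mlim y\<bar>"
        by (metis abs_ge_self abs_mult)
      also have "\<dots> \<le> \<bar>y - \<rho>\<bar> * real n powr - (w - 1 / 2)"
        using B[of y n] n1[OF n] yS by (intro mult_left_mono) auto
      finally have "(y - \<rho>) * (mean (t n) y - mlim y) \<le> \<bar>y - \<rho>\<bar> * real n powr - (w - 1 / 2)" .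
      moreover have "(y - \<rho>) * (f n y - \<epsilon>) = (y - \<rho>) * (mlim y - \<epsilon>) + (y - \<rho>) * (mean (t n) y - mlim y)"
        using yS by (simp add: f_def algebra_simps)
      ultimately show "(y - \<rho>) * (f n y - \<epsilon>) \<le> - m * (y - \<rho>)\<^sup>2 + 1 * real n powr - (w - 1 / 2) * \<bar>y - \<rho>\<bar>"
        using slope[OF yS] by (simp add: mult.commute)
    qed simp
  qed
qed

end
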